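(* Let $0<\alpha<n$ and $1<p<n/\alpha$, and define $q$ by $\frac1p-\frac1q=\frac{\alpha}{n}$. Let $w\in A_{p,q}$ and set $u=w^q$ and $\sigma=w^{-p'}$. Then $$\|I_\alpha(\,\cdot\,\sigma)\|_{L^p(\sigma)\to L^{q,\infty}(u)}\lesssim [u]_{A_{s(p)}}^{\frac1q}\,[u]_{A_\infty'}^{\frac1{p'}}$$ and $$\|I_\alpha(\,\cdot\,\sigma)\|_{L^p(\sigma)\to L^{q}(u)}\lesssim [u]_{A_{s(p)}}^{\frac1q}\Big([u]_{A_\infty'}^{\frac1{p'}}+[\sigma]_{A_\infty'}^{\frac1q}\Big).$$
   Context: All functions are on $\mathbb{R}^n$; suprema over $Q$ are over all cubes in $\mathbb{R}^n$ with sides parallel to the axes; $|Q|$ is Lebesgue measure, $\frac{1}{|Q|}\int_Q$ is the average over $Q$, and $w(Q)=\int_Q w\,dx$. A weight is a non-negative locally integrable function. For $1<r<\infty$, $r'=r/(r-1)$. Riesz potential: $I_\alpha f(x)=\int_{\mathbb{R}^n}\frac{f(y)}{|x-y|^{n-\alpha}}\,dy$. $w\in A_{p,q}$ means $[w]_{A_{p,q}}=\sup_Q\big(\frac1{|Q|}\int_Q w^q\,dx\big)^{1/q}\big(\frac1{|Q|}\int_Q w^{-p'}\,dx\big)^{1/p'}<\infty$. $s(p)=1+\frac{q}{p'}$. For $1<r<\infty$, $[u]_{A_r}=\sup_Q\big(\frac1{|Q|}\int_Q u\,dx\big)\big(\frac1{|Q|}\int_Q u^{1-r'}\,dx\big)^{r-1}$.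 $[w]_{A_\infty'}=\sup_Q\frac{1}{w(Q)}\int_Q M(\chi_Q w)(x)\,dx$, where $M$ is the Hardy–Littlewood maximal operator, $Mf(x)=\sup_{Q\ni x}\frac{1}{|Q|}\int_Q|f|\,dy$. $\|f\|_{L^p(\sigma)}=(\int|f|^p\sigma\,dx)^{1/p}$ and $\|g\|_{L^{q,\infty}(u)}=\sup_{t>0}t\,u(\{x:|g(x)|>t\})^{1/q}$. The quantity $\|I_\alpha(\,\cdot\,\sigma)\|_{L^p(\sigma)\to X}$ is the smallest constant $C$ such that $\|I_\alpha(f\sigma)\|_X\le C\|f\|_{L^p(\sigma)}$ for all $f\in L^p(\sigma)$. $A\lesssim B$ means $A\le CB$ with $C$ depending only on $\alpha,p,n$ (not on the weights). *)

theory Defs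
  imports "HOL-Analysis.Analysis"
begin

text \<open>
  Weights take values in \<^typ>\<open>ennreal\<close> because \<open>w\<^sup>-\<^sup>p\<^sup>'\<close> must be \<open>\<infinity>\<close> where \<open>w = 0\<close>, whereas
  \<open>powr\<close> on the reals has \<open>0 powr a = 0\<close> also for negative \<open>a\<close>.
\<close>

definition epowr :: "ennreal \<Rightarrow> real \<Rightarrow> ennreal"  (infixr "epowr" 80) where
  "x epowr a =
    (if a = 0 then 1
     else if x = 0 then (if a > 0 then 0 else \<infinity>)
     else if x = \<infinity> then (if a > 0 then \<infinity> else 0)
     else ennreal (enn2real x powr a))"

definition conj_exp :: "real \<Rightarrow> real" where
  "conj_exp r = r / (r - 1)"

definition cubes :: "(real ^ 'n) set set" where
  "cubes = {cbox a (a + (\<chi> i. l)) | a l. 0 < l}"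

definition wmeas :: "(real ^ 'n \<Rightarrow> ennreal) \<Rightarrow> (real ^ 'n) set \<Rightarrow> ennreal" where
  "wmeas w E = (\<integral>\<^sup>+x\<in>E. w x \<partial>lebesgue)"

definition avg :: "(real ^ 'n \<Rightarrow> ennreal) \<Rightarrow> (real ^ 'n) set \<Rightarrow> ennreal" where
  "avg f Q = wmeas f Q / emeasure lebesgue Q"

definition weight :: "(real ^ 'n \<Rightarrow> ennreal) \<Rightarrow> bool" where
  "weight w \<longleftrightarrow> w \<in> borel_measurable lebesgue \<and> (\<forall>K. compact K \<longrightarrow> wmeas w K < \<infinity>)"

definition Apq_const :: "real \<Rightarrow> real \<Rightarrow> (real ^ 'n \<Rightarrow> ennreal) \<Rightarrow> ennreal" where
  "Apq_const p q w =
    (SUP Q\<in>cubes. (avg (\<lambda>x. w x epowr q) Q) epowr (1 / q)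
       * (avg (\<lambda>x. w x epowr (- conj_exp p)) Q) epowr (1 / conj_exp p))"

definition Apq :: "real \<Rightarrow> real \<Rightarrow> (real ^ 'n \<Rightarrow> ennreal) set" where
  "Apq p q = {w. weight w \<and> Apq_const p q w < \<infinity>}"

definition Ar_const :: "real \<Rightarrow> (real ^ 'n \<Rightarrow> ennreal) \<Rightarrow> ennreal" where
  "Ar_const r u =
    (SUP Q\<in>cubes. avg u Q * (avg (\<lambda>x. u x epowr (1 - conj_exp r)) Q) epowr (r - 1))"

text \<open>Only non-negative functions are needed here, so the modulus in \<open>M f\<close> is omitted.\<close>

definition HL_maximal :: "(real ^ 'n \<Rightarrow> ennreal) \<Rightarrow> real ^ 'n \<Rightarrow> ennreal" where
  "HL_maximal f x = (SUP Q\<in>{Q\<in>cubes. x \<in> Q}. avg f Q)"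

definition Ainf_const :: "(real ^ 'n \<Rightarrow> ennreal) \<Rightarrow> ennreal" where
  "Ainf_const w =
    (SUP Q\<in>cubes. (\<integral>\<^sup>+x\<in>Q. HL_maximal (\<lambda>y. indicator Q y * w y) x \<partial>lebesgue) / wmeas w Q)"

definition Lp_norm :: "real \<Rightarrow> (real ^ 'n \<Rightarrow> ennreal) \<Rightarrow> (real ^ 'n \<Rightarrow> complex) \<Rightarrow> ennreal" where
  "Lp_norm p \<sigma> f = (\<integral>\<^sup>+x. ennreal (norm (f x)) epowr p * \<sigma> x \<partial>lebesgue) epowr (1 / p)"

definition Lp_space :: "real \<Rightarrow> (real ^ 'n \<Rightarrow> ennreal) \<Rightarrow> (real ^ 'n \<Rightarrow> complex) set" where
  "Lp_space p \<sigma> = {f. f \<in> borel_measurable lebesgue \<and> Lp_norm p \<sigma> f < \<infinity>}"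

definition weak_Lp_norm :: "real \<Rightarrow> (real ^ 'n \<Rightarrow> ennreal) \<Rightarrow> (real ^ 'n \<Rightarrow> complex) \<Rightarrow> ennreal" where
  "weak_Lp_norm q u g = (SUP t\<in>{0<..}. ennreal t * (wmeas u {x. norm (g x) > t}) epowr (1 / q))"

definition riesz_kernel :: "real \<Rightarrow> (real ^ 'n \<Rightarrow> complex) \<Rightarrow> real ^ 'n \<Rightarrow> real ^ 'n \<Rightarrow> complex" where
  "riesz_kernel \<alpha> f x y = f y / of_real (norm (x - y) powr (real CARD('n) - \<alpha>))"

definition riesz_potential :: "real \<Rightarrow> (real ^ 'n \<Rightarrow> complex) \<Rightarrow> real ^ 'n \<Rightarrow> complex" where
  "riesz_potential \<alpha> f x = (\<integral>y. riesz_kernel \<alpha> f x y \<partial>lebesgue)"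

text \<open>
  The product \<open>f \<sigma>\<close>; replacing the value \<open>\<infinity>\<close> of \<open>\<sigma>\<close> by \<open>0\<close> only matters where \<open>\<sigma> = \<infinity>\<close>,
  which is a null set whenever \<open>\<sigma>\<close> is locally integrable.
\<close>

definition wmult :: "(real ^ 'n \<Rightarrow> complex) \<Rightarrow> (real ^ 'n \<Rightarrow> ennreal) \<Rightarrow> real ^ 'n \<Rightarrow> complex" where
  "wmult f \<sigma> y = f y * of_real (enn2real (\<sigma> y))"

text \<open>
  The smallest \<open>C\<close> with \<open>X (I\<^sub>\<alpha> (f \<sigma>)) \<le> C \<parallel>f\<parallel>\<close> for all \<open>f \<in> L\<^sup>p(\<sigma>)\<close>, and \<open>\<infinity>\<close> if there is none;
  \<open>X\<close> is the norm of the target space. The Bochner integral is \<open>0\<close> where it does not exist, so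
  absolute convergence almost everywhere is demanded separately: without it, an \<open>f\<close> whose
  potential diverges would satisfy the bound for free.
\<close>

definition riesz_opnorm ::
  "real \<Rightarrow> real \<Rightarrow> (real ^ 'n \<Rightarrow> ennreal) \<Rightarrow> ((real ^ 'n \<Rightarrow> complex) \<Rightarrow> ennreal) \<Rightarrow> ennreal" where
  "riesz_opnorm \<alpha> p \<sigma> X =
    Inf {C. \<forall>f\<in>Lp_space p \<sigma>.
          (AE x in lebesgue. integrable lebesgue (riesz_kernel \<alpha> (wmult f \<sigma>) x)) \<and>
          X (riesz_potential \<alpha> (wmult f \<sigma>)) \<le> C * Lp_norm p \<sigma> f}"

end

theory Submission
  imports Defs
begin

text \<open>
  Two points lie in a common cube, of side comparable to their distance, of one of \<open>2\<^sup>n\<close> shifted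
  dyadic grids, so the potential is dominated by the operators
  \<open>T h = \<Sum>\<^sub>Q |Q|\<^sup>\<alpha>\<^sup>/\<^sup>n\<^sup>-\<^sup>1 (\<integral>\<^sub>Q h) \<chi>\<^sub>Q\<close>, with \<open>Q\<close> running over the cubes of a grid
  inside one large cube and above some size. Averaging over the smallest cubes turns the estimate for \<open>T\<close>
  into one for finite sums over the leaves of a tree.

  On the tree, \<open>\<parallel>T\<^sub>R u\<parallel>\<close> in \<open>L\<^sup>p\<^sup>'(\<sigma>)\<close> is estimated for every cube \<open>R\<close>, where \<open>T\<^sub>R\<close> sums over the cubes inside
  \<open>R\<close>. The condition \<open>u(Q)\<^sup>1\<^sup>/\<^sup>q \<sigma>(Q)\<^sup>1\<^sup>/\<^sup>p\<^sup>' \<le> A |Q|\<^sup>1\<^sup>-\<^sup>\<alpha>\<^sup>/\<^sup>n\<close> makes the lower power \<open>p' - 1\<close> of \<open>T\<^sub>R u\<close>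
  decay geometrically in the generation, and the remaining factor is summed along the increments of
  the dyadic maximal function of \<open>u\<close>, which costs exactly \<open>[u]\<close> of \<open>A\<^sub>\<infinity>'\<close>. Exchanging \<open>u\<close> and \<open>\<sigma>\<close> gives the
  second testing condition. The first one implies the weak-type bound by a good-\<open>\<lambda>\<close> argument.
  For the strong-type bound the averages of \<open>f\<close> and \<open>g\<close> in \<open>\<integral> T(f \<sigma>) g u\<close> are replaced by
  running maxima, their product is split into increments as in the product rule, and each
  half is estimated by one testing condition after grouping by the
  generations where the other running maximum doubles.
\<close>

section \<open>Inequalities for powers\<close>

text \<open>The joint condition raised to the power \<open>r - 1\<close> removes every power of the
  volume from \<open>(T u) powr (r - 1)\<close>, so nothing is left that sums over the generations.
  It is therefore used with the larger power \<open>e = r - 1 + \<epsilon>\<close>: the surplus is a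
  positive power of the volume and decays geometrically. The missing power \<open>r - e\<close> is
  applied afterwards, at the scale of a single cube.

  The testing estimate is of order \<open>r\<close> in \<open>A\<close> and linear in the A-infinity
  constant, with \<open>r = p'\<close> for \<open>u\<close> and \<open>r = q\<close> for
  \<open>\<sigma>\<close>; the roots of these orders are the exponents of the theorem.

  Finite trees keep all quantities finite, so terms may be absorbed or divided out, and no bound
  depends on the size or depth of the tree. The grids belonging to different truncations are not
  nested, so their majorants are not monotone and the limit is taken by Fatou's lemma along a
  \<open>liminf\<close>.\<close>

lemma conjugate_exponent_gt_1:
  fixes p p' :: real
  assumes "p > 1" "1/p + 1/p' = 1"
  shows "p' > 1"
  using assms by (smt (verit) divide_less_eq_1_pos divide_nonpos_nonneg divide_pos_pos less_divide_eq_1 zero_less_divide_iff)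

lemma Young_powr:
  fixes a b p p' :: real
  assumes "p > 1" "1/p + 1/p' = 1" "a \<ge> 0" "b \<ge> 0"
  shows "a * b \<le> a powr p / p + b powr p' / p'"
proof -
  have "p' > 1"
    using assms(1,2) by (rule conjugate_exponent_gt_1)
  then show ?thesis
    using Youngs_inequality [of p p' a b] assms by simp
qed

text \<open>Young's inequality after normalising both factors. A vanishing norm is split off because
  the normalisation divides by it.\<close>

lemma Holder_sum:
  fixes a b w :: "'i \<Rightarrow> real"
  assumes fin: "finite I" and p: "p > 1" and pp': "1/p + 1/p' = 1"
    and nn: "\<And>i. i \<in> I \<Longrightarrow> 0 \<le> a i" "\<And>i. i \<in> I \<Longrightarrow> 0 \<le> b i" "\<And>i. i \<in> I \<Longrightarrow> 0 \<le> w i"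
  shows "(\<Sum>i\<in>I. a i * b i * w i)
    \<le> (\<Sum>i\<in>I. a i powr p * w i) powr (1/p) * (\<Sum>i\<in>I. b i powr p' * w i) powr (1/p')"
proof -
  have p': "p' > 1"
    using p pp' by (rule conjugate_exponent_gt_1)
  define A where "A = (\<Sum>i\<in>I. a i powr p * w i)"
  define B where "B = (\<Sum>i\<in>I. b i powr p' * w i)"
  have A0: "A \<ge> 0" and B0: "B \<ge> 0"
    unfolding A_def B_def using nn by (auto intro!: sum_nonneg)
  have zero: "(\<Sum>i\<in>I. a i * b i * w i) = 0" if "A = 0 \<or> B = 0"
  proof (rule sum.neutral, rule ballI)
    fix i assume i: "i \<in> I"
    from that show "a i * b i * w i = 0"
    proof
      assume "A = 0"
      then have "a i powr p * w i = 0"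
        unfolding A_def using fin nn i by (subst (asm) sum_nonneg_eq_0_iff) auto
      then show ?thesis by auto
    next
      assume "B = 0"
      then have "b i powr p' * w i = 0"
        unfolding B_def using fin nn i by (subst (asm) sum_nonneg_eq_0_iff) auto
      then show ?thesis by auto
    qed
  qed
  show ?thesis
  proof (cases "A = 0 \<or> B = 0")
    case True
    then show ?thesis using zero A0 B0 by simp
  next
    case False
    then have pos: "A > 0" "B > 0" using A0 B0 by auto
    define s where "s = A powr (1/p)"
    define t where "t = B powr (1/p')"
    have st: "s > 0" "t > 0" "s powr p = A" "t powr p' = B"
      using pos p p' by (auto simp: s_def t_def powr_powr)
    have "(\<Sum>i\<in>I. a i * b i * w i) = s * t * (\<Sum>i\<in>I. (a i / s) * (b i / t) * w i)"
      using st by (simp add: sum_distrib_left field_simps)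
    also have "(\<Sum>i\<in>I. (a i / s) * (b i / t) * w i)
        \<le> (\<Sum>i\<in>I. ((a i / s) powr p / p + (b i / t) powr p' / p') * w i)"
      using nn st p pp' by (intro sum_mono mult_right_mono Young_powr) auto
    also have "\<dots> = (\<Sum>i\<in>I. a i powr p * w i) / (A * p) + (\<Sum>i\<in>I. b i powr p' * w i) / (B * p')"
      using st by (simp add: powr_divide sum_divide_distrib sum.distrib distrib_right field_simps)
    also have "\<dots> = 1"
      using pos pp' by (simp flip: A_def B_def)
    finally show ?thesis
      using st by (simp add: A_def B_def s_def t_def mult_left_mono)
  qed
qed

text \<open>By Young's inequality this needs no case distinction between \<open>p \<le> 2\<close> and \<open>p > 2\<close>, unlike
  the tangent-line estimate.\<close>

lemma powr_diff_le:
  fixes a b p :: real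
  assumes p: "p > 1" and ab: "0 \<le> b" "b \<le> a"
  shows "a powr p - b powr p \<le> p / (p - 1) * (a * (a powr (p - 1) - b powr (p - 1)))"
proof -
  have "1/p + 1/(p/(p-1)) = 1" using p by (simp add: field_simps)
  from Young_powr[OF p this, of a "b powr (p-1)"]
  have "a * b powr (p-1) \<le> a powr p / p + b powr p / (p/(p-1))"
    using p ab by (simp add: powr_powr)
  moreover have "a * a powr (p-1) = a powr p"
    using ab by (simp add: powr_mult_base)
  ultimately show ?thesis
    using p by (simp add: field_simps)
qed

lemma powr_diff_le_deriv:
  fixes a b r :: real
  assumes r: "r \<ge> 1" and ab: "0 \<le> b" "b \<le> a"
  shows "a powr r - b powr r \<le> r * (a - b) * a powr (r - 1)"
\<comment> \<open>The mean value theorem is used on an interval of positive numbers, hence the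
  separate treatment of \<open>b = 0\<close>.\<close>
proof (cases "b = a \<or> b = 0")
  case True
  then show ?thesis
    using r ab mult_right_mono[of 1 r "a powr r"] by (auto simp: powr_mult_base mult.assoc)
next
  case False
  then have b: "0 < b" "b < a" using ab by auto
  have "\<exists>z>b. z < a \<and> a powr r - b powr r = (a - b) * (r * z powr (r - 1))"
    using b by (intro MVT2 has_real_derivative_powr) auto
  then obtain z where z: "b < z" "z < a" "a powr r - b powr r = (a - b) * (r * z powr (r - 1))"
    by blast
  have "z powr (r - 1) \<le> a powr (r - 1)"
    using z b r by (intro powr_mono2) auto
  then show ?thesis
    using z b r by (simp add: mult_ac mult_left_mono)
qed

text \<open>The powers of the tail sums telescope, and each drop is estimated by the derivative.
  This leaves one linear factor and the lower power \<open>r - 1\<close> of a tail, the power that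
  \<open>local_bound\<close> controls.\<close>

lemma powr_sum_chain:
  fixes x :: "nat \<Rightarrow> real"
  assumes r: "r \<ge> 1" and nn: "\<And>k. 0 \<le> x k"
  shows "(\<Sum>k=i..N. x k) powr r \<le> r * (\<Sum>k=i..N. x k * (\<Sum>l=k..N. x l) powr (r - 1))"
proof (induction "Suc N - i" arbitrary: i)
  case 0
  then show ?case by simp
next
  case (Suc m)
  then have iN: "i \<le> N" by linarith
  have e: "(\<Sum>k=i..N. y k) = y i + (\<Sum>k=Suc i..N. y k)" for y :: "nat \<Rightarrow> real"
    using iN by (simp add: sum.atLeast_Suc_atMost)
  have "(\<Sum>k=i..N. x k) powr r - (\<Sum>k=Suc i..N. x k) powr r
      \<le> r * x i * (\<Sum>k=i..N. x k) powr (r - 1)"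
    using powr_diff_le_deriv[OF r, of "\<Sum>k=Suc i..N. x k" "\<Sum>k=i..N. x k"] nn
    by (simp add: e sum_nonneg)
  moreover have "(\<Sum>k=Suc i..N. x k) powr r
      \<le> r * (\<Sum>k=Suc i..N. x k * (\<Sum>l=k..N. x l) powr (r - 1))"
    using Suc by (intro Suc(1)) auto
  ultimately show ?case
    by (simp add: e[of "\<lambda>k. x k * (\<Sum>l=k..N. x l) powr (r - 1)"] algebra_simps)
qed

lemma geometric_sum_le:
  fixes b :: real
  assumes "0 \<le> b" "b < 1"
  shows "(\<Sum>k=i..N. b ^ (k - i)) \<le> 1 / (1 - b)"
proof -
  have "(\<Sum>k=i..N. b ^ (k - i)) = (\<Sum>k<Suc N - i. b ^ k)"
    by (rule sum.reindex_bij_witness[of _ "\<lambda>k. k + i" "\<lambda>k. k - i"]) auto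
  also have "\<dots> \<le> (\<Sum>k. b ^ k)"
    using assms by (intro sum_le_suminf summable_geometric) auto
  also have "\<dots> = 1 / (1 - b)"
    using assms by (intro suminf_geometric) auto
  finally show ?thesis .
qed

text \<open>The largest weighted term is pulled out of a geometric series. The argument is the same
  for \<open>m < 1\<close> and \<open>m > 1\<close>, which matters because \<open>m = r - 1\<close>
  can be either; the price, the weights \<open>b ^ (k - i)\<close>, is paid by geometric decay of
  the terms.\<close>

lemma powr_sum_le_weighted:
  fixes x :: "nat \<Rightarrow> real"
  assumes m: "m > 0" and b: "0 < b" "b < 1" and nn: "\<And>k. 0 \<le> x k" and iN: "i \<le> N"
  shows "(\<Sum>k=i..N. x k) powr m
    \<le> (1 / (1 - b)) powr m * (\<Sum>k=i..N. (x k / b ^ (k - i)) powr m)"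
proof -
  define z where "z k = x k / b ^ (k - i)" for k
  define Z where "Z = Max (z ` {i..N})"
  have "Z \<in> z ` {i..N}" unfolding Z_def using iN by (intro Max_in) auto
  then obtain j where j: "j \<in> {i..N}" "Z = z j" by auto
  have z0: "z k \<ge> 0" for k unfolding z_def using nn b by auto
  have "(\<Sum>k=i..N. x k) = (\<Sum>k=i..N. z k * b ^ (k - i))"
    unfolding z_def using b by simp
  also have "\<dots> \<le> (\<Sum>k=i..N. Z * b ^ (k - i))"
    unfolding Z_def using b by (intro sum_mono mult_right_mono Max_ge) auto
  also have "\<dots> = Z * (\<Sum>k=i..N. b ^ (k - i))" by (simp add: sum_distrib_left)
  also have "\<dots> \<le> Z * (1 / (1 - b))"
    using b j z0 by (intro mult_left_mono geometric_sum_le) auto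
  finally have "(\<Sum>k=i..N. x k) powr m \<le> (Z * (1 / (1 - b))) powr m"
    using m nn by (intro powr_mono2 sum_nonneg) auto
  also have "\<dots> = (1 / (1 - b)) powr m * z j powr m"
    using j by (simp flip: powr_mult add: mult.commute)
  also have "z j powr m \<le> (\<Sum>k=i..N. z k powr m)"
    using j by (intro member_le_sum) auto
  finally show ?thesis by (simp add: z_def mult_left_mono)
qed

section \<open>Functions on a finite tree\<close>

lemma Max_atLeastAtMost_Suc:
  fixes g :: "nat \<Rightarrow> 'a::linorder"
  assumes "i \<le> k"
  shows "Max (g ` {i..Suc k}) = max (g (Suc k)) (Max (g ` {i..k}))"
  using assms by (simp add: atLeastAtMostSuc_conv)

definition running_max :: "nat \<Rightarrow> (nat \<Rightarrow> real) \<Rightarrow> nat \<Rightarrow> real" where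
  "running_max i g k = Max (g ` {i..k})"

text \<open>The first index carries the whole value, as if \<open>g\<close> started from zero, so
  that the increments add up without a boundary term.\<close>

definition increment :: "nat \<Rightarrow> (nat \<Rightarrow> real) \<Rightarrow> nat \<Rightarrow> real" where
  "increment i g k = (if k = i then g i else g k - g (k - 1))"

lemma sum_increment: "i \<le> k \<Longrightarrow> (\<Sum>j=i..k. increment i g j) = g k"
  by (induction k rule: dec_induct) (auto simp: increment_def)

lemma running_max_same [simp]: "running_max i g i = g i"
  by (simp add: running_max_def)

lemma running_max_Suc: "i \<le> k \<Longrightarrow> running_max i g (Suc k) = max (g (Suc k)) (running_max i g k)"
  by (simp add: running_max_def Max_atLeastAtMost_Suc)

lemma running_max_ge: "i \<le> j \<Longrightarrow> j \<le> k \<Longrightarrow> g j \<le> running_max i g k"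
  unfolding running_max_def by (intro Max_ge) auto

lemma running_max_mono: "i \<le> j \<Longrightarrow> j \<le> k \<Longrightarrow> running_max i g j \<le> running_max i g k"
  unfolding running_max_def by (intro Max_mono) auto

lemma running_max_in: "i \<le> k \<Longrightarrow> \<exists>j\<in>{i..k}. running_max i g k = g j"
  unfolding running_max_def using Max_in[of "g ` {i..k}"] by fastforce

lemma increment_running_max_nonneg:
  assumes "i \<le> k" "0 \<le> g i"
  shows "0 \<le> increment i (running_max i g) k"
  using assms running_max_mono[of i "k - 1" k g] by (auto simp: increment_def)

lemma running_max_cong: "(\<And>j. i \<le> j \<Longrightarrow> j \<le> k \<Longrightarrow> g j = h j) \<Longrightarrow> running_max i g k = running_max i h k"
  unfolding running_max_def by (intro arg_cong[where f = Max] image_cong) auto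

lemma sum_triangle:
  fixes h :: "nat \<Rightarrow> nat \<Rightarrow> real"
  shows "(\<Sum>k=i..N. \<Sum>j=i..k. h j k) = (\<Sum>j=i..N. \<Sum>k=j..N. h j k)"
proof -
  have "(\<Sum>k=i..N. \<Sum>j=i..k. h j k) = (\<Sum>k\<in>{i..N}. \<Sum>j | j \<in> {i..N} \<and> j \<le> k. h j k)"
    by (intro sum.cong refl) auto
  also have "\<dots> = (\<Sum>j\<in>{i..N}. \<Sum>k | k \<in> {i..N} \<and> j \<le> k. h j k)"
    by (rule sum.swap_restrict) auto
  also have "\<dots> = (\<Sum>j=i..N. \<Sum>k=j..N. h j k)"
    by (intro sum.cong refl) auto
  finally show ?thesis .
qed

text \<open>
  The leaves of a finite tree, grouped by the label \<open>c i x\<close> of their ancestor in generation \<open>i\<close>.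
\<close>

locale finite_filtration =
  fixes X :: "'x set" and c :: "nat \<Rightarrow> 'x \<Rightarrow> 'b"
  assumes finX: "finite X"
    and nested: "\<And>i x y. c (Suc i) x = c (Suc i) y \<Longrightarrow> c i x = c i y"
begin

definition cell :: "nat \<Rightarrow> 'x \<Rightarrow> 'x set" where
  "cell i x = {y \<in> X. c i y = c i x}"

abbreviation mass :: "('x \<Rightarrow> real) \<Rightarrow> nat \<Rightarrow> 'x \<Rightarrow> real" where
  "mass f i x \<equiv> sum f (cell i x)"

text \<open>The unions of cells of generation \<open>i\<close>; \<open>adapted\<close> is the
  corresponding notion for functions. The latter quantifies over the whole type, which spares
  membership side conditions.\<close>

definition saturated :: "nat \<Rightarrow> 'x set \<Rightarrow> bool" where
  "saturated i S \<longleftrightarrow> S \<subseteq> X \<and> (\<forall>x\<in>S. cell i x \<subseteq> S)"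

definition adapted :: "nat \<Rightarrow> ('x \<Rightarrow> 'c) \<Rightarrow> bool" where
  "adapted i f \<longleftrightarrow> (\<forall>x y. c i x = c i y \<longrightarrow> f x = f y)"

lemma label_le: "i \<le> j \<Longrightarrow> c j x = c j y \<Longrightarrow> c i x = c i y"
  by (induction j rule: dec_induct) (simp_all, metis nested)

lemma finite_cell [simp]: "finite (cell i x)"
  using finX by (simp add: cell_def)

lemma cell_subset: "cell i x \<subseteq> X"
  by (auto simp: cell_def)

lemma cell_eq: "c i x = c i y \<Longrightarrow> cell i x = cell i y"
  by (simp add: cell_def)

lemma cell_antimono: "i \<le> j \<Longrightarrow> cell j x \<subseteq> cell i x"
  unfolding cell_def using label_le by blast

lemma in_cell_iff: "y \<in> cell i x \<longleftrightarrow> y \<in> X \<and> c i y = c i x"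
  by (simp add: cell_def)

lemma saturated_X [simp]: "saturated i X"
  by (simp add: saturated_def cell_subset)

lemma saturated_cell: "i \<le> j \<Longrightarrow> saturated j (cell i x)"
  unfolding saturated_def
proof (intro conjI ballI)
  fix y assume "i \<le> j" "y \<in> cell i x"
  then show "cell j y \<subseteq> cell i x"
    using cell_antimono[of i j y] cell_eq[of i y x] by (simp add: in_cell_iff)
qed (rule cell_subset)

lemma saturated_finite: "saturated i S \<Longrightarrow> finite S"
  using finX finite_subset by (auto simp: saturated_def)

lemma adaptedI: "(\<And>x y. c i x = c i y \<Longrightarrow> f x = f y) \<Longrightarrow> adapted i f"
  unfolding adapted_def by blast

lemma adaptedD: "adapted i f \<Longrightarrow> c i x = c i y \<Longrightarrow> f x = f y"
  unfolding adapted_def by blast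

lemma saturated_adapted:
  assumes S: "saturated i S" and P: "adapted i P"
  shows "saturated i {x \<in> S. P x}"
  unfolding saturated_def
proof (intro conjI ballI subsetI)
  fix x y assume x: "x \<in> {x \<in> S. P x}" and y: "y \<in> cell i x"
  then have "y \<in> S" using S by (auto simp: saturated_def)
  moreover have "P y = P x" using y P by (intro adaptedD[of i P]) (auto simp: in_cell_iff)
  ultimately show "y \<in> {x \<in> S. P x}" using x by simp
qed (use S in \<open>auto simp: saturated_def\<close>)

lemma mass_adapted: "i \<le> j \<Longrightarrow> c j x = c j y \<Longrightarrow> mass f i x = mass f i y"
  by (rule arg_cong[where f = "sum f"], rule cell_eq, erule label_le)

lemma mass_pos: "(\<And>y. y \<in> X \<Longrightarrow> 0 < f y) \<Longrightarrow> x \<in> X \<Longrightarrow> 0 < mass f i x"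
  by (intro sum_pos) (auto simp: cell_def finX)

lemma mass_antimono:
  "(\<And>y. y \<in> X \<Longrightarrow> 0 \<le> f y) \<Longrightarrow> i \<le> j \<Longrightarrow> mass f j x \<le> mass f i x"
  by (intro sum_mono2) (use cell_antimono in \<open>auto simp: cell_def finX\<close>)

text \<open>Both sides are the sum of \<open>f y * g x\<close> over the pairs in \<open>S\<close>
  with a common cell. Saturation keeps the whole cell inside \<open>S\<close>.\<close>

lemma sum_cell_swap:
  assumes S: "saturated i S"
  shows "(\<Sum>x\<in>S. mass f i x * g x) = (\<Sum>y\<in>S. f y * mass g i y)"
proof -
  have fS: "finite S" using S by (rule saturated_finite)
  have *: "mass h i x = (\<Sum>y\<in>S. if c i x = c i y then h y else 0)" if "x \<in> S" for h x
  proof -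
    have "cell i x = {y \<in> S. c i x = c i y}"
      using S that by (auto simp: saturated_def cell_def)
    then show ?thesis using fS by (simp add: sum.inter_filter)
  qed
  have "(\<Sum>x\<in>S. mass f i x * g x) = (\<Sum>x\<in>S. \<Sum>y\<in>S. if c i x = c i y then f y * g x else 0)"
    by (intro sum.cong refl) (auto simp: * sum_distrib_right intro!: sum.cong)
  also have "\<dots> = (\<Sum>y\<in>S. \<Sum>x\<in>S. if c i x = c i y then f y * g x else 0)"
    by (rule sum.swap)
  also have "\<dots> = (\<Sum>y\<in>S. f y * mass g i y)"
    by (intro sum.cong refl) (auto simp: * sum_distrib_left intro!: sum.cong)
  finally show ?thesis .
qed

text \<open>Conditional expectation: a factor that is constant on cells does not distinguish
  \<open>h\<close> from its cell density with respect to \<open>l\<close>. It is the swap identity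
  with second function \<open>\<phi> / mass l * l\<close>.\<close>

lemma sum_tower:
  assumes S: "saturated i S" and l: "\<And>x. x \<in> X \<Longrightarrow> 0 < l x" and \<phi>: "adapted i \<phi>"
  shows "(\<Sum>x\<in>S. \<phi> x * h x) = (\<Sum>x\<in>S. \<phi> x * mass h i x / mass l i x * l x)"
proof -
  have "(\<Sum>x\<in>S. mass h i x * (\<phi> x / mass l i x * l x))
      = (\<Sum>z\<in>S. h z * mass (\<lambda>x. \<phi> x / mass l i x * l x) i z)"
    by (rule sum_cell_swap[OF S])
  also have "\<dots> = (\<Sum>z\<in>S. h z * \<phi> z)"
  proof (intro sum.cong refl)
    fix z assume z: "z \<in> S"
    then have "z \<in> X" using S by (auto simp: saturated_def)
    then have pos: "mass l i z > 0" using l by (intro mass_pos) auto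
    have "mass (\<lambda>x. \<phi> x / mass l i x * l x) i z = mass (\<lambda>x. \<phi> z / mass l i z * l x) i z"
    proof (intro sum.cong refl)
      fix x assume "x \<in> cell i z"
      then have "c i x = c i z" by (simp add: cell_def)
      then show "\<phi> x / mass l i x * l x = \<phi> z / mass l i z * l x"
        using \<phi> cell_eq[of i x z] by (metis adaptedD)
    qed
    also have "\<dots> = \<phi> z" 
      using pos unfolding sum_distrib_left[symmetric] by simp
    finally show "h z * mass (\<lambda>x. \<phi> x / mass l i x * l x) i z = h z * \<phi> z" by simp
  qed
  finally show ?thesis by (simp add: mult_ac)
qed

lemma sum_tower_cell:
  assumes "\<And>x. x \<in> X \<Longrightarrow> 0 < l x" "i \<le> k"
  shows "(\<Sum>x\<in>cell i z. mass h k x / mass l k x * l x) = mass h i z"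
  using sum_tower[of k "cell i z" l "\<lambda>_. 1" h] assms saturated_cell[of i k z]
  by (simp add: adapted_def)

end

section \<open>The testing condition\<close>

lemma real_le_by_ln:
  fixes x y :: real
  assumes "0 < x" "0 < y" "ln x \<le> ln y"
  shows "x \<le> y"
  using assms by (simp add: ln_le_cancel_iff)

lemma power_powr_commute:
  fixes x :: real
  assumes "0 < x"
  shows "(x ^ n) powr a = (x powr a) ^ n"
  using assms by (simp add: powr_realpow[symmetric] powr_powr mult.commute)

text \<open>
  The gain \<open>\<epsilon>\<close> is positive, so that powers of the cube sizes decay in the local bound, and so small that
  \<open>e = r - 1 + \<epsilon>\<close> satisfies \<open>e < r\<close> and \<open>e (1 - \<delta>) \<le> r - 1\<close>.
\<close>

definition decay_gain :: "real \<Rightarrow> real \<Rightarrow> real" where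
  "decay_gain \<delta> r = min (1/2) ((r - 1) * \<delta>)"

text \<open>This is \<open>r * C1 / (1 - \<rho> powr \<delta>)\<close> with the \<open>C1\<close> of
  the locale \<open>two_weight\<close>. It is written out beforehand to make visible that it depends
  on no weight.\<close>

definition testing_const :: "real \<Rightarrow> real \<Rightarrow> real \<Rightarrow> real" where
  "testing_const \<rho> \<delta> r = r * ((1 / (1 - \<rho> powr (decay_gain \<delta> r * (1 - \<delta>) / (2 * (r - 1))))) powr (r - 1)
    * (1 / (1 - \<rho> powr (decay_gain \<delta> r * (1 - \<delta>) / 2)))) / (1 - \<rho> powr \<delta>)"

lemma testing_const_pos:
  assumes "0 < \<rho>" "\<rho> < 1" "1 < r" "0 < \<delta>" "\<delta> < 1"
  shows "0 < testing_const \<rho> \<delta> r"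
proof -
  have "0 < decay_gain \<delta> r" using assms by (simp add: decay_gain_def)
  then have "0 < decay_gain \<delta> r * (1 - \<delta>) / 2" "0 < decay_gain \<delta> r * (1 - \<delta>) / (2 * (r - 1))"
    using assms by auto
  moreover have "\<rho> powr x < 1" if "0 < x" for x
    using powr_less_mono2[OF that _ assms(2)] assms by simp
  ultimately show ?thesis
    using assms unfolding testing_const_def
    by (intro divide_pos_pos mult_pos_pos) (auto simp: less_le)
qed

text \<open>
  The exponents of \<open>\<nu>\<close> and \<open>\<mu>\<close> in \<open>joint\<close> and that of \<open>A\<close> below are those for which all scales cancel;
  \<open>V i\<close> is the Lebesgue measure of a cube of generation \<open>i\<close>.
\<close>

locale two_weight = finite_filtration X c
  for X :: "'x set" and c :: "nat \<Rightarrow> 'x \<Rightarrow> 'b" +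
  fixes \<mu> \<nu> l :: "'x \<Rightarrow> real" and V :: "nat \<Rightarrow> real" and \<rho> \<delta> r A :: real and N :: nat
  assumes mu_pos: "\<And>x. x \<in> X \<Longrightarrow> 0 < \<mu> x" and nu_pos: "\<And>x. x \<in> X \<Longrightarrow> 0 < \<nu> x"
    and l_pos: "\<And>x. x \<in> X \<Longrightarrow> 0 < l x"
    and mass_l: "\<And>i x. x \<in> X \<Longrightarrow> i \<le> N \<Longrightarrow> mass l i x = V i"
    and V_pos: "\<And>i. 0 < V i" and V_Suc: "\<And>i. V (Suc i) = \<rho> * V i"
    and rho: "0 < \<rho>" "\<rho> < 1" and delta: "0 < \<delta>" and r: "1 < r" and exps: "0 < 1 - \<delta> - 1/r"
    and A_pos: "0 < A"
    and joint: "\<And>i x. x \<in> X \<Longrightarrow> i \<le> N \<Longrightarrow>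
      mass \<nu> i x powr (1 - \<delta> - 1/r) * mass \<mu> i x powr (1/r) \<le> A * V i powr (1 - \<delta>)"
begin

definition \<epsilon> :: real where "\<epsilon> = decay_gain \<delta> r"

definition e :: real where "e = r - 1 + \<epsilon>"

text \<open>The decay per generation in the local bound is \<open>\<theta> * \<theta>\<close>. One
  factor, as \<open>\<beta> powr (r - 1)\<close>, pays for the weights of
  \<open>powr_sum_le_weighted\<close>; the other makes the sum over generations converge.\<close>

definition \<theta> :: real where "\<theta> = \<rho> powr (\<epsilon> * (1 - \<delta>) / 2)"

definition \<beta> :: real where "\<beta> = \<rho> powr (\<epsilon> * (1 - \<delta>) / (2 * (r - 1)))"

definition C1 :: real where "C1 = (1 / (1 - \<beta>)) powr (r - 1) * (1 / (1 - \<theta>))"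

definition partial :: "nat \<Rightarrow> 'x \<Rightarrow> real" where
  "partial i y = (\<Sum>k=i..N. V k powr (\<delta> - 1) * mass \<nu> k y)"

lemma delta_less: "\<delta> < 1"
  using exps r by (smt (verit) divide_nonneg_nonneg)

lemma eps: "0 < \<epsilon>" "\<epsilon> \<le> 1/2" "\<epsilon> \<le> (r - 1) * \<delta>"
  using delta r by (auto simp: \<epsilon>_def decay_gain_def)

lemma e_bounds: "0 < e" "e < r" "e * (1 - \<delta>) \<le> r - 1"
proof -
  show "0 < e" "e < r" using eps r by (auto simp: e_def)
  have "e * (1 - \<delta>) \<le> ((r - 1) + (r - 1) * \<delta>) * (1 - \<delta>)"
    using eps delta_less by (intro mult_right_mono) (auto simp: e_def)
  also have "\<dots> = (r - 1) * (1 - \<delta>\<^sup>2)" by (simp add: algebra_simps power2_eq_square)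
  also have "\<dots> \<le> r - 1" using r by (simp add: mult_left_le)
  finally show "e * (1 - \<delta>) \<le> r - 1" .
qed

lemma theta_beta: "0 < \<theta>" "\<theta> < 1" "0 < \<beta>" "\<beta> < 1" "\<beta> powr (r - 1) = \<theta>"
proof -
  have "0 < \<epsilon> * (1 - \<delta>)" using eps delta_less by simp
  then have "0 < \<epsilon> * (1 - \<delta>) / 2" "0 < \<epsilon> * (1 - \<delta>) / (2 * (r - 1))"
    using r by (auto intro: divide_pos_pos)
  then show "0 < \<theta>" "\<theta> < 1" "0 < \<beta>" "\<beta> < 1"
    unfolding \<theta>_def \<beta>_def using rho powr_less_mono2[of _ \<rho> 1] by auto
  have "\<epsilon> * (1 - \<delta>) / (2 * (r - 1)) * (r - 1) = \<epsilon> * (1 - \<delta>) / 2"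
    using r by (simp add: field_simps)
  then show "\<beta> powr (r - 1) = \<theta>" by (simp only: \<theta>_def \<beta>_def powr_powr)
qed

lemma C1_pos: "0 < C1"
  using theta_beta by (simp add: C1_def)

section \<open>Balance of exponents on a single cube\<close>

lemma V_add: "i \<le> k \<Longrightarrow> V k = V i * \<rho> ^ (k - i)"
proof (induction k rule: dec_induct)
  case (step k)
  then have "Suc k - i = Suc (k - i)" by linarith
  then show ?case using step V_Suc[of k] by (simp only:) simp
qed simp

text \<open>As \<open>e = r - 1 + \<epsilon>\<close>, the volume factor is
  \<open>V k powr (- e * (1 - \<delta>))\<close> times
  \<open>V k powr (\<epsilon> * (1 - \<delta>))\<close>. The joint condition to the power
  \<open>e\<close> removes the first and the second remains as a gain. Logarithms make the exponent
  count linear.\<close>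

lemma term_bound:
  assumes y: "y \<in> X" and k: "k \<le> N"
  shows "(V k powr (\<delta> - 1) * mass \<nu> k y) powr (r - 1)
    \<le> A powr e * V k powr (\<epsilon> * (1 - \<delta>)) * mass \<nu> k y powr (r - 1 - e * (1 - \<delta> - 1/r))
      * mass \<mu> k y powr (- (e / r))"
proof -
  define m where "m = mass \<mu> k y"
  define n where "n = mass \<nu> k y"
  have pos: "0 < m" "0 < n" "0 < V k"
    unfolding m_def n_def using mass_pos[of \<mu>] mass_pos[of \<nu>] mu_pos nu_pos y V_pos by auto
  have "ln (n powr (1 - \<delta> - 1/r) * m powr (1/r)) \<le> ln (A * V k powr (1 - \<delta>))"
    using joint[OF y k] pos A_pos by (simp add: m_def n_def)
  then have "(1 - \<delta> - 1/r) * ln n + (1/r) * ln m \<le> ln A + (1 - \<delta>) * ln (V k)"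
    using pos A_pos by (simp add: ln_mult)
  from mult_left_mono[OF this, of e]
  have *: "e * (1 - \<delta> - 1/r) * ln n + e/r * ln m \<le> e * ln A + e * (1 - \<delta>) * ln (V k)"
    using e_bounds by (simp add: distrib_left mult.assoc)
  have "ln ((V k powr (\<delta> - 1) * n) powr (r - 1))
      = (r - 1) * ((\<delta> - 1) * ln (V k) + ln n)"
    using pos by (simp add: ln_mult)
  also have "\<dots> \<le> e * ln A + (\<epsilon> * (1 - \<delta>)) * ln (V k)
      + (r - 1 - e * (1 - \<delta> - 1/r)) * ln n + (- (e / r)) * ln m"
  proof -
    have "\<epsilon> = e - (r - 1)" by (simp add: e_def)
    then show ?thesis using * by (simp only:) (simp add: algebra_simps)
  qed
  also have "\<dots> = ln (A powr e * V k powr (\<epsilon> * (1 - \<delta>)) * n powr (r - 1 - e * (1 - \<delta> - 1/r))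
      * m powr (- (e / r)))"
    using pos A_pos by (simp add: ln_mult)
  finally show ?thesis
    unfolding m_def[symmetric] n_def[symmetric]
    by (rule real_le_by_ln[rotated 2]) (use pos A_pos in \<open>simp_all\<close>)
qed

text \<open>The total power of the volume is \<open>- (1 - \<delta>) * (1 - \<epsilon>)\<close>, and
  \<open>1 - \<epsilon> = r - e\<close>. The joint condition to the power \<open>r - e\<close>
  therefore removes the volume and the mass of \<open>\<mu>\<close> together.\<close>

lemma scales_cancel:
  assumes y: "y \<in> X" and k: "k \<le> N"
  shows "V k powr (\<delta> - 1) * (A powr e * V k powr (\<epsilon> * (1 - \<delta>))
      * mass \<nu> k y powr (r - 1 - e * (1 - \<delta> - 1/r)) * mass \<mu> k y powr (1 - e / r))
    \<le> A powr r * mass \<nu> k y powr (r * \<delta>)"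
proof -
  define m where "m = mass \<mu> k y"
  define n where "n = mass \<nu> k y"
  have pos: "0 < m" "0 < n" "0 < V k"
    unfolding m_def n_def using mass_pos[of \<mu>] mass_pos[of \<nu>] mu_pos nu_pos y V_pos by auto
  have "ln (n powr (1 - \<delta> - 1/r) * m powr (1/r)) \<le> ln (A * V k powr (1 - \<delta>))"
    using joint[OF y k] pos A_pos by (simp add: m_def n_def)
  then have "(1 - \<delta> - 1/r) * ln n + (1/r) * ln m \<le> ln A + (1 - \<delta>) * ln (V k)"
    using pos A_pos by (simp add: ln_mult)
  from mult_left_mono[OF this, of "r - e"]
  have *: "(r - e) * (1 - \<delta> - 1/r) * ln n + (r - e)/r * ln m \<le> (r - e) * ln A + (r - e) * (1 - \<delta>) * ln (V k)"
    using e_bounds by (simp add: distrib_left mult.assoc)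
  have "ln (V k powr (\<delta> - 1) * (A powr e * V k powr (\<epsilon> * (1 - \<delta>))
      * n powr (r - 1 - e * (1 - \<delta> - 1/r)) * m powr (1 - e / r)))
      = (\<delta> - 1) * ln (V k) + e * ln A + (\<epsilon> * (1 - \<delta>)) * ln (V k)
        + (r - 1 - e * (1 - \<delta> - 1/r)) * ln n + (1 - e / r) * ln m"
    using pos A_pos by (simp add: ln_mult)
  also have "\<dots> \<le> r * ln A + r * \<delta> * ln n"
  proof -
    have eps_eq: "\<epsilon> = e - (r - 1)" by (simp add: e_def)
    have c1: "(r - e) / r = 1 - e / r" using r by (simp add: field_simps)
    have "r * (1 - \<delta> - 1/r) = r - 1 - r * \<delta>" using r by (simp add: field_simps)
    then have c2: "(r - e) * (1 - \<delta> - 1/r) = r - 1 - r * \<delta> - e * (1 - \<delta> - 1/r)"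
      by (simp only: left_diff_distrib)
    show ?thesis using * unfolding c1 c2 eps_eq by (simp add: algebra_simps)
  qed
  also have "\<dots> = ln (A powr r * n powr (r * \<delta>))"
    using pos A_pos by (simp add: ln_mult)
  finally show ?thesis
    unfolding m_def[symmetric] n_def[symmetric]
    by (rule real_le_by_ln[rotated 2]) (use pos A_pos in \<open>simp_all\<close>)
qed

text \<open>Jensen's inequality for the concave power \<open>e / r\<close>, applied to the density
  of \<open>\<nu>\<close> against \<open>\<mu>\<close> in generation \<open>k\<close>; the integral
  of that density over the coarser cell is the mass of \<open>\<nu>\<close>.\<close>

lemma ratio_sum:
  assumes z: "z \<in> X" and ik: "i \<le> k"
  shows "(\<Sum>y\<in>cell i z. (mass \<nu> k y / mass \<mu> k y) powr (e / r) * \<mu> y)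
    \<le> mass \<nu> i z powr (e / r) * mass \<mu> i z powr (1 - e / r)"
proof -
  define b where "b = e / r"
  have b: "0 < b" "b < 1" using e_bounds r by (auto simp: b_def)
  have p: "1 / b > 1" "1 / (1/b) + 1 / (1 / (1 - b)) = 1" using b by (auto simp: field_simps)
  have m0: "0 \<le> mass \<nu> k y / mass \<mu> k y" for y
    using mu_pos nu_pos by (intro divide_nonneg_nonneg sum_nonneg) (auto simp: in_cell_iff intro: less_imp_le)
  have "(\<Sum>y\<in>cell i z. (mass \<nu> k y / mass \<mu> k y) powr b * 1 * \<mu> y)
    \<le> (\<Sum>y\<in>cell i z. ((mass \<nu> k y / mass \<mu> k y) powr b) powr (1/b) * \<mu> y) powr (1 / (1/b))
      * (\<Sum>y\<in>cell i z. 1 powr (1 / (1 - b)) * \<mu> y) powr (1 / (1 / (1 - b)))"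
    using mu_pos by (intro Holder_sum p) (auto simp: in_cell_iff intro: less_imp_le)
  also have "(\<Sum>y\<in>cell i z. ((mass \<nu> k y / mass \<mu> k y) powr b) powr (1/b) * \<mu> y) = mass \<nu> i z"
  proof -
    have "((mass \<nu> k y / mass \<mu> k y) powr b) powr (1/b) = mass \<nu> k y / mass \<mu> k y" for y
      using b m0[of y] by (simp only: powr_powr) (simp del: abs_divide)
    then show ?thesis
      using sum_tower_cell[of \<mu> i k \<nu> z] mu_pos ik by simp
  qed
  finally show ?thesis by (simp add: b_def)
qed

lemma partial_nonneg: "0 \<le> partial i y"
  unfolding partial_def using nu_pos
  by (intro sum_nonneg mult_nonneg_nonneg) (auto simp: in_cell_iff intro: less_imp_le)

text \<open>Each generation is bounded by \<open>term_bound\<close> and then integrated by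
  \<open>ratio_sum\<close>; the gain in the volume sums the generations. The result involves only
  the data of the top cell.\<close>

lemma local_bound:
  assumes z: "z \<in> X" and i: "i \<le> N"
  shows "(\<Sum>y\<in>cell i z. partial i y powr (r - 1) * \<mu> y)
    \<le> C1 * (A powr e * V i powr (\<epsilon> * (1 - \<delta>))
      * mass \<nu> i z powr (r - 1 - e * (1 - \<delta> - 1/r)) * mass \<mu> i z powr (1 - e / r))"
proof -
  define x where "x k y = V k powr (\<delta> - 1) * mass \<nu> k y" for k y
  define b where "b = r - 1 - e * (1 - \<delta> - 1/r) - e / r"
  define B where "B = A powr e * mass \<nu> i z powr b"
  \<comment> \<open>Here \<open>b = r - 1 - e * (1 - \<delta>)\<close>. Its sign lets the part
    \<open>b\<close> of the power of the mass of \<open>\<nu>\<close> be moved to the larger cell,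
    while the part \<open>e / r\<close> joins the mass of \<open>\<mu>\<close> in the ratio.\<close>
  have b0: "b \<ge> 0" using e_bounds(3) by (simp add: b_def algebra_simps)
  have npos: "0 < mass \<nu> k y" "0 < mass \<mu> k y" if "y \<in> X" for k y
    using mass_pos[of \<nu>] mass_pos[of \<mu>] mu_pos nu_pos that by auto
  have level: "(\<Sum>y\<in>cell i z. x k y powr (r - 1) * \<mu> y)
      \<le> B * V k powr (\<epsilon> * (1 - \<delta>)) * (mass \<nu> i z powr (e / r) * mass \<mu> i z powr (1 - e / r))"
    if k: "k \<in> {i..N}" for k
  proof -
    have "x k y powr (r - 1) \<le> B * V k powr (\<epsilon> * (1 - \<delta>)) * (mass \<nu> k y / mass \<mu> k y) powr (e / r)"
      if y: "y \<in> cell i z" for y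
    proof -
      have yX: "y \<in> X" using y by (simp add: in_cell_iff)
      have "mass \<nu> k y powr (r - 1 - e * (1 - \<delta> - 1/r)) = mass \<nu> k y powr b * mass \<nu> k y powr (e / r)"
        by (simp add: b_def flip: powr_add)
      moreover have "mass \<nu> k y \<le> mass \<nu> i z"
        using mass_antimono[of \<nu> i k y] nu_pos k y cell_eq[of i y z]
        by (auto simp: in_cell_iff intro: less_imp_le)
      then have "mass \<nu> k y powr b \<le> mass \<nu> i z powr b"
        using b0 npos[OF yX, of k] by (intro powr_mono2) auto
      moreover have "mass \<nu> k y powr (e / r) * mass \<mu> k y powr (- (e / r))
          = (mass \<nu> k y / mass \<mu> k y) powr (e / r)"
        by (simp add: powr_divide powr_minus_divide)
      moreover have "x k y powr (r - 1) \<le> A powr e * V k powr (\<epsilon> * (1 - \<delta>))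
          * mass \<nu> k y powr (r - 1 - e * (1 - \<delta> - 1/r)) * mass \<mu> k y powr (- (e / r))"
        unfolding x_def using term_bound[OF yX] k by simp
      ultimately have "x k y powr (r - 1) \<le> A powr e * V k powr (\<epsilon> * (1 - \<delta>))
          * mass \<nu> k y powr b * (mass \<nu> k y / mass \<mu> k y) powr (e / r)"
        by (simp add: mult.assoc)
      also have "\<dots> \<le> A powr e * V k powr (\<epsilon> * (1 - \<delta>))
          * mass \<nu> i z powr b * (mass \<nu> k y / mass \<mu> k y) powr (e / r)"
        using \<open>mass \<nu> k y powr b \<le> mass \<nu> i z powr b\<close>
        by (intro mult_right_mono mult_left_mono) auto
      finally show ?thesis by (simp add: B_def mult_ac)
    qed
    then have "(\<Sum>y\<in>cell i z. x k y powr (r - 1) * \<mu> y)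
      \<le> (\<Sum>y\<in>cell i z. B * V k powr (\<epsilon> * (1 - \<delta>)) * (mass \<nu> k y / mass \<mu> k y) powr (e / r) * \<mu> y)"
      using mu_pos by (intro sum_mono mult_right_mono) (auto simp: in_cell_iff intro: less_imp_le)
    also have "\<dots> = B * V k powr (\<epsilon> * (1 - \<delta>))
        * (\<Sum>y\<in>cell i z. (mass \<nu> k y / mass \<mu> k y) powr (e / r) * \<mu> y)"
      by (simp add: sum_distrib_left mult.assoc)
    also have "\<dots> \<le> B * V k powr (\<epsilon> * (1 - \<delta>)) * (mass \<nu> i z powr (e / r) * mass \<mu> i z powr (1 - e / r))"
      using k by (intro mult_left_mono ratio_sum z) (auto simp: B_def)
    finally show ?thesis .
  qed
  have scale: "V k powr (\<epsilon> * (1 - \<delta>)) / (\<beta> ^ (k - i)) powr (r - 1) = V i powr (\<epsilon> * (1 - \<delta>)) * \<theta> ^ (k - i)"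
    if "i \<le> k" for k
  proof -
    have "(\<beta> ^ (k - i)) powr (r - 1) = \<theta> ^ (k - i)"
      using theta_beta by (simp add: power_powr_commute)
    moreover have "V k powr (\<epsilon> * (1 - \<delta>)) = V i powr (\<epsilon> * (1 - \<delta>)) * (\<rho> powr (\<epsilon> * (1 - \<delta>))) ^ (k - i)"
      using V_add[OF that] rho by (simp add: powr_mult power_powr_commute)
    moreover have "\<rho> powr (\<epsilon> * (1 - \<delta>)) = \<theta> * \<theta>"
      by (simp add: \<theta>_def mult.commute flip: powr_add)
    ultimately show ?thesis using theta_beta by (simp add: power_mult_distrib)
  qed
  let ?D = "(1 / (1 - \<beta>)) powr (r - 1)"
  let ?E = "B * (mass \<nu> i z powr (e / r) * mass \<mu> i z powr (1 - e / r))"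
  have E0: "0 \<le> B" by (simp add: B_def)
  have "(\<Sum>y\<in>cell i z. partial i y powr (r - 1) * \<mu> y)
      \<le> (\<Sum>y\<in>cell i z. (?D * (\<Sum>k=i..N. (x k y / \<beta> ^ (k - i)) powr (r - 1))) * \<mu> y)"
  proof (intro sum_mono mult_right_mono)
    fix y assume y: "y \<in> cell i z"
    have "0 \<le> x k y" for k
      unfolding x_def using npos y by (auto simp: in_cell_iff intro!: mult_nonneg_nonneg intro: less_imp_le)
    then show "partial i y powr (r - 1) \<le> ?D * (\<Sum>k=i..N. (x k y / \<beta> ^ (k - i)) powr (r - 1))"
      using powr_sum_le_weighted[of "r - 1" \<beta> "\<lambda>k. x k y" i N] r i theta_beta
      by (simp add: partial_def x_def)
  qed (use mu_pos in \<open>auto simp: in_cell_iff intro: less_imp_le\<close>)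
  also have "\<dots> = ?D * (\<Sum>k=i..N. (\<Sum>y\<in>cell i z. x k y powr (r - 1) * \<mu> y) / (\<beta> ^ (k - i)) powr (r - 1))"
    by (simp add: sum_distrib_left sum_distrib_right sum_divide_distrib powr_divide mult_ac sum.swap[of _ "cell i z"])
  also have "\<dots> \<le> ?D * (\<Sum>k=i..N. B * V k powr (\<epsilon> * (1 - \<delta>)) * (mass \<nu> i z powr (e / r) * mass \<mu> i z powr (1 - e / r))
      / (\<beta> ^ (k - i)) powr (r - 1))"
    using level by (intro mult_left_mono sum_mono divide_right_mono) auto
  also have "\<dots> = ?D * (\<Sum>k=i..N. ?E * V i powr (\<epsilon> * (1 - \<delta>)) * \<theta> ^ (k - i))"
  proof (intro arg_cong[where f = "\<lambda>t. ?D * t"] sum.cong refl)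
    fix k assume "k \<in> {i..N}"
    then have "V k powr (\<epsilon> * (1 - \<delta>)) / (\<beta> ^ (k - i)) powr (r - 1) = V i powr (\<epsilon> * (1 - \<delta>)) * \<theta> ^ (k - i)"
      using scale[of k] by simp
    from arg_cong[OF this, of "\<lambda>t. ?E * t"]
    show "B * V k powr (\<epsilon> * (1 - \<delta>)) * (mass \<nu> i z powr (e / r) * mass \<mu> i z powr (1 - e / r))
      / (\<beta> ^ (k - i)) powr (r - 1) = ?E * V i powr (\<epsilon> * (1 - \<delta>)) * \<theta> ^ (k - i)"
      by (simp only: times_divide_eq_right mult_ac)
  qed
  also have "\<dots> = ?D * (?E * V i powr (\<epsilon> * (1 - \<delta>)) * (\<Sum>k=i..N. \<theta> ^ (k - i)))"
    by (simp add: sum_distrib_left)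
  also have "\<dots> \<le> ?D * (?E * V i powr (\<epsilon> * (1 - \<delta>)) * (1 / (1 - \<theta>)))"
    using theta_beta E0 by (intro mult_left_mono geometric_sum_le mult_nonneg_nonneg) auto
  also have "\<dots> = C1 * (A powr e * V i powr (\<epsilon> * (1 - \<delta>))
      * (mass \<nu> i z powr b * mass \<nu> i z powr (e / r)) * mass \<mu> i z powr (1 - e / r))"
    by (simp add: C1_def B_def)
  also have "mass \<nu> i z powr b * mass \<nu> i z powr (e / r) = mass \<nu> i z powr (r - 1 - e * (1 - \<delta> - 1/r))"
    by (simp add: b_def flip: powr_add)
  finally show ?thesis .
qed

text \<open>Every term is \<open>V k powr \<delta>\<close> times an average, which is at most a sum
  of increments of the running maximum. After exchanging the sums, \<open>V k powr \<delta>\<close>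
  is geometric in \<open>k\<close> and the tail is largest at \<open>k = j\<close>, so only the
  generation \<open>j\<close> of the increment survives.\<close>

lemma sum_chain_le_increments:
  assumes y: "y \<in> X" and i: "i \<le> N"
  defines "g \<equiv> running_max i (\<lambda>k. mass \<nu> k y / V k)"
  shows "partial i y powr r
    \<le> r / (1 - \<rho> powr \<delta>) * (\<Sum>j=i..N. increment i g j * V j powr \<delta> * partial j y powr (r - 1))"
proof -
  define x where "x k = V k powr (\<delta> - 1) * mass \<nu> k y" for k
  define d where "d = increment i g"
  have n0: "0 < mass \<nu> k y" for k
    using mass_pos[of \<nu>] nu_pos y by auto
  have x0: "0 \<le> x k" for k
    unfolding x_def using n0[of k] by (intro mult_nonneg_nonneg) auto
  have d0: "0 \<le> d j" if "i \<le> j" for j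
    unfolding d_def g_def using that n0[of i] V_pos[of i] by (intro increment_running_max_nonneg) auto
  have px: "(\<Sum>l=k..N. x l) = partial k y" for k
    by (simp add: partial_def x_def)
  have rd: "0 < \<rho> powr \<delta>" "\<rho> powr \<delta> < 1"
    using rho delta powr_less_mono2[of \<delta> \<rho> 1] by auto
  have x_le: "x k \<le> V k powr \<delta> * (\<Sum>j=i..k. d j)" if k: "i \<le> k" for k
  proof -
    have "x k = V k powr \<delta> * (mass \<nu> k y / V k)"
      using V_pos[of k] by (simp add: x_def powr_diff)
    also have "mass \<nu> k y / V k \<le> g k"
      unfolding g_def using k by (intro running_max_ge[of i k k "\<lambda>k. mass \<nu> k y / V k"]) auto
    also have "g k = (\<Sum>j=i..k. d j)"
      using k by (simp add: d_def sum_increment)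
    finally show ?thesis by (simp add: mult_left_mono)
  qed
  have "partial i y powr r \<le> r * (\<Sum>k=i..N. x k * partial k y powr (r - 1))"
    using powr_sum_chain[of r x i N] r x0 by (simp add: px)
  also have "\<dots> \<le> r * (\<Sum>k=i..N. (V k powr \<delta> * (\<Sum>j=i..k. d j)) * partial k y powr (r - 1))"
    using r x_le by (intro mult_left_mono sum_mono mult_right_mono) auto
  also have "\<dots> = r * (\<Sum>k=i..N. \<Sum>j=i..k. d j * (V k powr \<delta> * partial k y powr (r - 1)))"
    by (simp add: sum_distrib_left sum_distrib_right mult_ac)
  also have "\<dots> = r * (\<Sum>j=i..N. \<Sum>k=j..N. d j * (V k powr \<delta> * partial k y powr (r - 1)))"
    by (simp add: sum_triangle)
  also have "\<dots> \<le> r * (\<Sum>j=i..N. d j * V j powr \<delta> * partial j y powr (r - 1) * (1 / (1 - \<rho> powr \<delta>)))"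
  proof (intro mult_left_mono sum_mono)
    fix j assume j: "j \<in> {i..N}"
    have "(\<Sum>k=j..N. d j * (V k powr \<delta> * partial k y powr (r - 1)))
        \<le> (\<Sum>k=j..N. d j * (V j powr \<delta> * (\<rho> powr \<delta>) ^ (k - j) * partial j y powr (r - 1)))"
    proof (intro sum_mono mult_left_mono mult_mono)
      fix k assume k: "k \<in> {j..N}"
      then show "V k powr \<delta> \<le> V j powr \<delta> * (\<rho> powr \<delta>) ^ (k - j)"
        using V_add[of j k] rho by (simp add: powr_mult power_powr_commute)
      have "partial k y \<le> partial j y"
        unfolding px[symmetric] using k x0 by (intro sum_mono2) auto
      then show "partial k y powr (r - 1) \<le> partial j y powr (r - 1)"
        using r partial_nonneg by (intro powr_mono2) auto
    qed (use d0 j rho in auto)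
    also have "\<dots> = d j * V j powr \<delta> * partial j y powr (r - 1) * (\<Sum>k=j..N. (\<rho> powr \<delta>) ^ (k - j))"
      by (simp add: sum_distrib_left sum_distrib_right mult_ac)
    also have "\<dots> \<le> d j * V j powr \<delta> * partial j y powr (r - 1) * (1 / (1 - \<rho> powr \<delta>))"
      using d0 j rd by (intro mult_left_mono geometric_sum_le mult_nonneg_nonneg) auto
    finally show "(\<Sum>k=j..N. d j * (V k powr \<delta> * partial k y powr (r - 1)))
      \<le> d j * V j powr \<delta> * partial j y powr (r - 1) * (1 / (1 - \<rho> powr \<delta>))" .
  qed (use r in auto)
  also have "\<dots> = r / (1 - \<rho> powr \<delta>) * (\<Sum>j=i..N. d j * V j powr \<delta> * partial j y powr (r - 1))"
    by (simp flip: sum_divide_distrib)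
  finally show ?thesis by (simp add: d_def)
qed

lemma testing_const_eq: "testing_const \<rho> \<delta> r = r * C1 / (1 - \<rho> powr \<delta>)"
  by (simp add: testing_const_def C1_def \<beta>_def \<theta>_def \<epsilon>_def)

text \<open>An increment of generation \<open>j\<close> is constant on the cells of that generation,
  so the factor \<open>partial j y powr (r - 1)\<close> can be averaged there and bounded by
  \<open>local_bound\<close> and \<open>scales_cancel\<close>. What remains is a constant times the
  increments; they add up to the running maximum, whose integral brings in \<open>K\<close> to the
  first power.\<close>

lemma testing:
  assumes z: "z \<in> X" and i: "i \<le> N"
    and K: "(\<Sum>y\<in>cell i z. running_max i (\<lambda>k. mass \<nu> k y / V k) N * l y) \<le> K * mass \<nu> i z"
  shows "(\<Sum>y\<in>cell i z. partial i y powr r * \<mu> y) \<le> testing_const \<rho> \<delta> r * A powr r * K * mass \<nu> i z powr (1 + r * \<delta>)"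
proof -
  define d where "d y = increment i (running_max i (\<lambda>k. mass \<nu> k y / V k))" for y
  let ?G = "r / (1 - \<rho> powr \<delta>)"
  let ?B = "C1 * (A powr r * mass \<nu> i z powr (r * \<delta>))"
  have G0: "0 \<le> ?G"
    using r rho delta powr_less_mono2[of \<delta> \<rho> 1] by auto
  have zn: "0 < mass \<nu> i z" using mass_pos[of \<nu>] nu_pos z by auto
  have d0: "0 \<le> d y j" if "i \<le> j" for y j
    unfolding d_def using that V_pos[of i] nu_pos
    by (intro increment_running_max_nonneg divide_nonneg_nonneg sum_nonneg) (auto simp: in_cell_iff intro: less_imp_le)
  have ad: "adapted j (\<lambda>y. d y j)" if j: "i \<le> j" for j
  proof (rule adaptedI)
    fix x y assume xy: "c j x = c j y"
    have "running_max i (\<lambda>k. mass \<nu> k x / V k) k = running_max i (\<lambda>k. mass \<nu> k y / V k) k" if "k \<le> j" for k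
      using that mass_adapted[OF _ xy, of _ \<nu>] by (intro running_max_cong) auto
    moreover have "mass \<nu> i x = mass \<nu> i y"
      using j mass_adapted[OF _ xy, of i \<nu>] by simp
    ultimately show "d x j = d y j"
      using j by (simp add: d_def increment_def)
  qed
  have "(\<Sum>y\<in>cell i z. partial i y powr r * \<mu> y)
      \<le> (\<Sum>y\<in>cell i z. ?G * (\<Sum>j=i..N. d y j * V j powr \<delta> * partial j y powr (r - 1)) * \<mu> y)"
    using sum_chain_le_increments[OF _ i] mu_pos
    by (intro sum_mono mult_right_mono) (auto simp: in_cell_iff d_def intro: less_imp_le)
  also have "\<dots> = ?G * (\<Sum>j=i..N. \<Sum>y\<in>cell i z. (d y j * V j powr \<delta>) * (partial j y powr (r - 1) * \<mu> y))"
    by (simp add: sum_distrib_left sum_distrib_right sum.swap[of _ "cell i z"] mult_ac)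
  also have "\<dots> \<le> ?G * (\<Sum>j=i..N. \<Sum>y\<in>cell i z. ?B * (d y j * l y))"
  proof (rule mult_left_mono[OF sum_mono G0])
    fix j assume j: "j \<in> {i..N}"
    have "(\<Sum>y\<in>cell i z. (d y j * V j powr \<delta>) * (partial j y powr (r - 1) * \<mu> y))
      = (\<Sum>y\<in>cell i z. (d y j * V j powr \<delta>) * mass (\<lambda>y. partial j y powr (r - 1) * \<mu> y) j y / mass l j y * l y)"
    proof (rule sum_tower)
      show "adapted j (\<lambda>y. d y j * V j powr \<delta>)"
        using ad j unfolding adapted_def by (metis atLeastAtMost_iff)
    qed (use j l_pos saturated_cell in auto)
    also have "\<dots> \<le> (\<Sum>y\<in>cell i z. ?B * (d y j * l y))"
    proof (intro sum_mono)
      fix y assume y: "y \<in> cell i z"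
      then have yX: "y \<in> X" by (simp add: in_cell_iff)
      have l: "mass l j y = V j" using mass_l yX j by simp
      let ?R = "A powr e * V j powr (\<epsilon> * (1 - \<delta>))
          * mass \<nu> j y powr (r - 1 - e * (1 - \<delta> - 1/r)) * mass \<mu> j y powr (1 - e / r)"
      have "V j powr \<delta> * mass (\<lambda>y. partial j y powr (r - 1) * \<mu> y) j y / V j
          = V j powr (\<delta> - 1) * mass (\<lambda>y. partial j y powr (r - 1) * \<mu> y) j y"
        using V_pos[of j] by (simp add: powr_diff)
      also have "\<dots> \<le> V j powr (\<delta> - 1) * (C1 * ?R)"
        using local_bound[OF yX] j by (intro mult_left_mono) auto
      also have "\<dots> = C1 * (V j powr (\<delta> - 1) * ?R)" by simp
      also have "\<dots> \<le> C1 * (A powr r * mass \<nu> j y powr (r * \<delta>))"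
        using C1_pos scales_cancel[OF yX] j by (intro mult_left_mono) auto
      also have "\<dots> \<le> ?B"
      proof -
        have "mass \<nu> j y \<le> mass \<nu> i y"
          using j nu_pos by (intro mass_antimono) (auto intro: less_imp_le)
        also have "\<dots> = mass \<nu> i z" using y cell_eq[of i y z] by (simp add: in_cell_iff)
        finally show ?thesis
          using C1_pos A_pos r delta mass_pos[of \<nu> y j] nu_pos yX
          by (intro mult_left_mono powr_mono2) auto
      qed
      finally have "V j powr \<delta> * mass (\<lambda>y. partial j y powr (r - 1) * \<mu> y) j y / V j * (d y j * l y) \<le> ?B * (d y j * l y)"
        using d0[of j y] j l_pos[OF yX] by (intro mult_right_mono) auto
      then show "(d y j * V j powr \<delta>) * mass (\<lambda>y. partial j y powr (r - 1) * \<mu> y) j y / mass l j y * l y \<le> ?B * (d y j * l y)"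
        by (simp add: l mult_ac)
    qed
    finally show "(\<Sum>y\<in>cell i z. (d y j * V j powr \<delta>) * (partial j y powr (r - 1) * \<mu> y))
      \<le> (\<Sum>y\<in>cell i z. ?B * (d y j * l y))" .
  qed
  also have "\<dots> = ?G * ?B * (\<Sum>y\<in>cell i z. (\<Sum>j=i..N. d y j) * l y)"
    by (simp add: sum_divide_distrib sum_distrib_left sum_distrib_right sum.swap[of _ "cell i z"] mult_ac)
  also have "\<dots> = ?G * ?B * (\<Sum>y\<in>cell i z. running_max i (\<lambda>k. mass \<nu> k y / V k) N * l y)"
    using i by (simp add: d_def sum_increment)
  also have "\<dots> \<le> ?G * ?B * (K * mass \<nu> i z)"
    using K G0 C1_pos by (intro mult_left_mono mult_nonneg_nonneg) auto
  also have "\<dots> = testing_const \<rho> \<delta> r * A powr r * K * mass \<nu> i z powr (1 + r * \<delta>)"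
    using zn by (simp add: testing_const_eq powr_add)
  finally show ?thesis .
qed

end

section \<open>The maximal inequality and the weak-type bound\<close>

text \<open>Where the running maximum grows, it equals the current average. So each increment of its
  \<open>p\<close>-th power is bounded by the average times an increment of the power
  \<open>p - 1\<close>. That increment is adapted, the average may be replaced by \<open>f\<close>,
  and Hoelder's inequality closes the estimate with the constant \<open>p / (p - 1)\<close>.\<close>

lemma (in finite_filtration) Doob_maximal:
  assumes mu: "\<And>x. x \<in> X \<Longrightarrow> 0 < \<mu> x" and f: "\<And>x. x \<in> X \<Longrightarrow> 0 \<le> f x" and p: "p > 1"
  shows "(\<Sum>x\<in>X. running_max 0 (\<lambda>k. mass (\<lambda>y. f y * \<mu> y) k x / mass \<mu> k x) N powr p * \<mu> x)
    \<le> (p / (p - 1)) powr p * (\<Sum>x\<in>X. f x powr p * \<mu> x)"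
proof -
  define av where "av k x = mass (\<lambda>y. f y * \<mu> y) k x / mass \<mu> k x" for k x
  define G where "G k x = running_max 0 (\<lambda>k. av k x) k" for k x
  define D where "D i x = increment 0 (\<lambda>k. G k x powr (p - 1)) i" for i x
  define Y where "Y = (\<Sum>x\<in>X. G N x powr p * \<mu> x)"
  define F where "F = (\<Sum>x\<in>X. f x powr p * \<mu> x)"
  have pp': "1/p + 1/(p/(p-1)) = 1" using p by (simp add: field_simps)
  have av0: "0 \<le> av k x" for k x
    unfolding av_def using mu f
    by (intro divide_nonneg_nonneg sum_nonneg mult_nonneg_nonneg) (auto simp: in_cell_iff intro!: mult_nonneg_nonneg intro: less_imp_le)
  have G0: "0 \<le> G k x" for k x
    using av0[of k x] running_max_ge[of 0 k k "\<lambda>k. av k x"] by (simp add: G_def)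
  have Gm: "G k x \<le> G (Suc k) x" for k x
    unfolding G_def by (intro running_max_mono) auto
  have adG: "adapted i (G k)" if "k \<le> i" for i k
  proof (rule adaptedI)
    fix x y assume xy: "c i x = c i y"
    have "av j x = av j y" if "j \<le> k" for j
      using \<open>k \<le> i\<close> that mass_adapted[OF _ xy, of j] by (simp add: av_def)
    then show "G k x = G k y" unfolding G_def by (intro running_max_cong) auto
  qed
  have adD: "adapted i (D i)" for i
  proof (rule adaptedI)
    fix x y assume xy: "c i x = c i y"
    have "G k x = G k y" if "k \<le> i" for k
      by (rule adaptedD[OF adG[OF that] xy])
    then show "D i x = D i y" by (simp add: D_def increment_def)
  qed
  have step: "increment 0 (\<lambda>k. G k x powr p) i \<le> p / (p - 1) * (av i x * D i x)" for i x
  proof (cases i)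
    case 0
    then show ?thesis
      using p G0[of 0 x] powr_diff_le[OF p, of 0 "G 0 x"] by (simp add: increment_def D_def G_def)
  next
    case (Suc k)
    show ?thesis
    proof (cases "av i x \<le> G k x")
      case True
      then have "G i x = G k x" by (simp add: G_def Suc running_max_Suc)
      then show ?thesis by (simp add: increment_def D_def Suc)
    next
      case False
      then have "av i x = G i x" by (simp add: G_def Suc running_max_Suc)
      then show ?thesis
        using powr_diff_le[OF p G0 Gm, of k x] by (simp add: increment_def D_def Suc)
    qed
  qed
  have "Y = (\<Sum>x\<in>X. (\<Sum>i=0..N. increment 0 (\<lambda>k. G k x powr p) i) * \<mu> x)"
    by (simp add: Y_def sum_increment)
  also have "\<dots> \<le> (\<Sum>x\<in>X. (\<Sum>i=0..N. p / (p - 1) * (av i x * D i x)) * \<mu> x)"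
    using mu step by (intro sum_mono mult_right_mono) (auto intro!: mult_nonneg_nonneg intro: less_imp_le)
  also have "\<dots> = p / (p - 1) * (\<Sum>i=0..N. \<Sum>x\<in>X. D i x * mass (\<lambda>y. f y * \<mu> y) i x / mass \<mu> i x * \<mu> x)"
    by (simp add: sum_distrib_left sum_distrib_right sum_divide_distrib sum.swap[of _ X] av_def mult_ac)
  also have "\<dots> = p / (p - 1) * (\<Sum>i=0..N. \<Sum>x\<in>X. D i x * (f x * \<mu> x))"
    using sum_tower[OF saturated_X mu adD] by simp
  also have "\<dots> = p / (p - 1) * (\<Sum>x\<in>X. f x * (\<Sum>i=0..N. D i x) * \<mu> x)"
    by (simp add: sum_distrib_left sum_distrib_right sum_divide_distrib sum.swap[of _ X] mult_ac)
  also have "\<dots> = p / (p - 1) * (\<Sum>x\<in>X. f x * G N x powr (p - 1) * \<mu> x)"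
    by (simp add: D_def sum_increment)
  also have "\<dots> \<le> p / (p - 1) * (F powr (1/p)
      * (\<Sum>x\<in>X. (G N x powr (p - 1)) powr (p / (p - 1)) * \<mu> x) powr (1 / (p / (p - 1))))"
    unfolding F_def using p mu f
    by (intro mult_left_mono Holder_sum finX pp') (auto intro!: mult_nonneg_nonneg intro: less_imp_le)
  also have "\<dots> = p / (p - 1) * (F powr (1/p) * Y powr (1 - 1/p))"
    using p by (simp add: powr_powr Y_def diff_divide_distrib)
  finally have YF: "Y \<le> p / (p - 1) * (F powr (1/p) * Y powr (1 - 1/p))" .
  have Y0: "0 \<le> Y" unfolding Y_def using mu by (intro sum_nonneg) (auto intro!: mult_nonneg_nonneg intro: less_imp_le)
  have F0: "0 \<le> F" unfolding F_def using mu by (intro sum_nonneg) (auto intro!: mult_nonneg_nonneg intro: less_imp_le)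
  have "Y \<le> (p / (p - 1)) powr p * F"
  proof (cases "Y = 0")
    case True
    then show ?thesis using F0 by simp
  next
    case False
    then have Y: "0 < Y" using Y0 by simp
    have "Y powr (1/p) * Y powr (1 - 1/p) = Y" using Y by (simp flip: powr_add)
    then have "Y powr (1/p) * Y powr (1 - 1/p) \<le> p / (p - 1) * F powr (1/p) * Y powr (1 - 1/p)"
      using YF by (simp add: mult.assoc)
    then have "Y powr (1/p) \<le> p / (p - 1) * F powr (1/p)"
      by (rule mult_right_le_imp_le) (use Y in simp)
    then have "(Y powr (1/p)) powr p \<le> (p / (p - 1) * F powr (1/p)) powr p"
      using p by (intro powr_mono2) auto
    then show ?thesis using Y F0 p unfolding powr_mult powr_powr by simp
  qed
  then show ?thesis by (simp add: Y_def F_def G_def av_def)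
qed

text \<open>Iterating the recursion \<open>n\<close> times multiplies the crude bound by
  \<open>2\<close> to the power \<open>- n\<close>, so it disappears in the limit. It replaces the a
  priori finite supremum that an absorption argument would use.\<close>

lemma halving_bound:
  fixes h :: "real \<Rightarrow> real"
  assumes step: "\<And>t. t > 0 \<Longrightarrow> h t \<le> h (t / 2) / 2 + D"
    and crude: "\<And>t. t > 0 \<Longrightarrow> h t \<le> K * t powr q" and K: "0 \<le> K" "0 \<le> q" and t: "t > 0"
  shows "h t \<le> 2 * D"
proof -
  have *: "h t \<le> (1/2) ^ n * (K * t powr q) + 2 * D * (1 - (1/2)^n)" if "t > 0" for n t
    using that
  proof (induction n arbitrary: t)
    case 0
    then show ?case using crude by simp
  next
    case (Suc n)
    have "h t \<le> h (t / 2) / 2 + D" using Suc step by simp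
    also have "\<dots> \<le> ((1/2) ^ n * (K * (t/2) powr q) + 2 * D * (1 - (1/2)^n)) / 2 + D"
      using Suc(1)[of "t/2"] Suc(2) by simp
    also have "\<dots> \<le> ((1/2) ^ n * (K * t powr q) + 2 * D * (1 - (1/2)^n)) / 2 + D"
      using K Suc(2) by (intro add_right_mono divide_right_mono mult_left_mono powr_mono2) auto
    also have "\<dots> = (1/2) ^ Suc n * (K * t powr q) + 2 * D * (1 - (1/2) ^ Suc n)"
      by (simp add: field_simps)
    finally show ?case .
  qed
  have "(\<lambda>n. (1/2) ^ n * (K * t powr q) + 2 * D * (1 - (1/2)^n)) \<longlonglongrightarrow> 0 * (K * t powr q) + 2 * D * (1 - 0)"
    by (intro tendsto_intros LIMSEQ_power_zero) auto
  then show ?thesis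
    using * t by (intro LIMSEQ_le_const) auto
qed

text \<open>A good-lambda inequality compares the levels \<open>2 * t\<close> and \<open>t\<close>
  on the cells where the truncated potential first passes \<open>t\<close>. Duality moves the
  potential from \<open>f\<close> to \<open>\<nu>\<close>, where the testing condition
  applies.\<close>

lemma (in finite_filtration) weak_type:
  fixes a :: "nat \<Rightarrow> real" and \<mu> \<nu> f :: "'x \<Rightarrow> real" and N :: nat
  defines "T \<equiv> \<lambda>k x. \<Sum>i=0..k. a i * mass (\<lambda>y. f y * \<mu> y) i x"
  assumes mu: "\<And>x. x \<in> X \<Longrightarrow> 0 < \<mu> x" and nu: "\<And>x. x \<in> X \<Longrightarrow> 0 < \<nu> x"
    and a: "\<And>k. 0 \<le> a k" and f: "\<And>x. x \<in> X \<Longrightarrow> 0 \<le> f x"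
    and p: "1 < p" "p \<le> q" "1/p + 1/p' = 1" "1/q + 1/q' = 1" and W: "0 \<le> W"
    and test: "\<And>i z. z \<in> X \<Longrightarrow> i \<le> N \<Longrightarrow>
      (\<Sum>y\<in>cell i z. (\<Sum>k=i..N. a k * mass \<nu> k y) powr p' * \<mu> y) \<le> W powr p' * mass \<nu> i z powr (p' / q')"
    and t: "t > 0"
  shows "t powr q * sum \<nu> {x\<in>X. t < T N x}
    \<le> 2 * (2 powr (q + 2) * W * (\<Sum>x\<in>X. f x powr p * \<mu> x) powr (1/p)) powr q"
proof -
  define \<Phi> where "\<Phi> = (\<Sum>x\<in>X. f x powr p * \<mu> x)"
  define Ph where "Ph i x = mass (\<lambda>y. f y powr p * \<mu> y) i x" for i x
  \<comment> \<open>Doubling the level multiplies \<open>t powr q\<close> by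
    \<open>2 powr q\<close>; this choice turns the factor of the recursion into exactly one
    half.\<close>
  define eps where "eps = 2 powr (- q - 1)"
  define D where "D = (2 powr (q + 2) * W * \<Phi> powr (1/p)) powr q"
  have eps: "0 < eps" "2 powr q * eps = 1/2"
    by (auto simp: eps_def powr_minus_divide simp flip: powr_add)
  have pq: "0 < p" "0 < q" "1 < q" "p' > 1" "q' > 1"
    using p conjugate_exponent_gt_1[of p p'] conjugate_exponent_gt_1[of q q'] by auto
  have fm0: "0 \<le> mass (\<lambda>y. f y * \<mu> y) i x" for i x
    using mu f by (intro sum_nonneg) (auto simp: in_cell_iff intro!: mult_nonneg_nonneg intro: less_imp_le)
  have Ph0: "0 \<le> Ph i x" for i x
    unfolding Ph_def using mu by (intro sum_nonneg) (auto simp: in_cell_iff intro!: mult_nonneg_nonneg intro: less_imp_le)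
  have Ph_le: "Ph i x \<le> \<Phi>" for i x
    unfolding Ph_def \<Phi>_def using mu by (intro sum_mono2 finX cell_subset) (auto intro!: mult_nonneg_nonneg intro: less_imp_le)
  have \<Phi>0: "0 \<le> \<Phi>" using Ph0 Ph_le order_trans by blast
  have Tmono: "T j x \<le> T k x" if "j \<le> k" for j k x
    unfolding T_def using a fm0 that by (intro sum_mono2) auto
  have adT: "T k x = T k y" if "c i x = c i y" "k \<le> i" for i k x y
    unfolding T_def using that mass_adapted[OF _ that(1)] by (intro sum.cong refl) auto
  have good: "sum \<nu> {x\<in>X. 2 * t < T N x}
      \<le> eps * sum \<nu> {x\<in>X. t < T N x} + (W * \<Phi> powr (1/p) / (eps * t)) powr q" if t: "t > 0" for t
  proof -
    define E where "E = {x\<in>X. 2 * t < T N x}"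
    define ch where "ch x = (if x \<in> E then \<nu> x else 0)" for x
    \<comment> \<open>The stopping time is \<open>i\<close>. Since \<open>T\<close> increases with
      the generation, these sets partition the level set of \<open>T N\<close>.\<close>
    define Z where "Z i = {x\<in>X. t < T i x \<and> (\<forall>j<i. T j x \<le> t)}" for i
    define B where "B = (W / (eps * t)) powr q * \<Phi> powr (q/p - 1)"
    have satZ: "saturated i (Z i)" for i
    proof -
      have "adapted i (\<lambda>x. t < T i x \<and> (\<forall>j<i. T j x \<le> t))"
      proof (rule adaptedI)
        fix x y assume xy: "c i x = c i y"
        have "T j x = T j y" if "j \<le> i" for j by (rule adT[OF xy that])
        then show "(t < T i x \<and> (\<forall>j<i. T j x \<le> t)) = (t < T i y \<and> (\<forall>j<i. T j y \<le> t))"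
          by simp
      qed
      then show ?thesis unfolding Z_def by (rule saturated_adapted[OF saturated_X])
    qed
    have disj: "i = j" if "x \<in> Z i" "x \<in> Z j" for i j x
      using that unfolding Z_def by (cases i j rule: linorder_cases) auto
    have ex: "\<exists>i\<in>{0..N}. x \<in> Z i" if "x \<in> X" "t < T N x" for x
    proof -
      define i where "i = (LEAST i. t < T i x)"
      have "t < T i x" "i \<le> N" unfolding i_def using that by (auto intro: LeastI Least_le)
      moreover have "T j x \<le> t" if "j < i" for j
        using not_less_Least[of j "\<lambda>i. t < T i x"] that by (simp add: i_def)
      ultimately show ?thesis using that by (auto simp: Z_def)
    qed
    have split: "sum g {x\<in>X. t < T N x} = (\<Sum>i=0..N. sum g (Z i))" for g :: "'x \<Rightarrow> real"
    proof -
      have "{x\<in>X. t < T N x} = (\<Union>i\<in>{0..N}. Z i)"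
      proof (intro set_eqI iffI)
        fix x assume "x \<in> (\<Union>i\<in>{0..N}. Z i)"
        then obtain i where i: "i \<le> N" "x \<in> Z i" by auto
        then have "t < T N x" using Tmono[OF i(1), of x] by (simp add: Z_def)
        then show "x \<in> {x\<in>X. t < T N x}" using i by (simp add: Z_def)
      qed (use ex in simp)
      then show ?thesis
        using disj saturated_finite[OF satZ] by (simp only:) (intro sum.UNION_disjoint, auto)
    qed
    \<comment> \<open>Either \<open>E\<close> occupies at most the fraction \<open>eps\<close> of
      the cell, or the duality estimate \<open>main\<close> bounds the mass of the whole cell by the
      local norm of \<open>f\<close>.\<close>
    have key: "mass ch i x \<le> eps * mass \<nu> i x + B * Ph i x" if x: "x \<in> Z i" and i: "i \<le> N" for i x
    proof -
      have xX: "x \<in> X" using x by (simp add: Z_def)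
      have n0: "0 < mass \<nu> i x" using mass_pos[of \<nu>] nu xX by auto
      have ch_pt: "ch y \<le> \<nu> y" if "y \<in> X" for y
        using nu[OF that] by (auto simp: ch_def)
      have chi_le: "mass ch k y \<le> mass \<nu> k y" for k y
        unfolding ch_def using nu by (intro sum_mono) (auto simp: in_cell_iff intro!: mult_nonneg_nonneg intro: less_imp_le)
      \<comment> \<open>On \<open>E\<close> the full sum exceeds \<open>2 * t\<close>, while the
        generations before \<open>i\<close> give at most \<open>t\<close> by the choice of
        \<open>i\<close>; those from \<open>i\<close> on give more than \<open>t\<close>.\<close>
      have local: "t * ch y \<le> (\<Sum>k=i..N. a k * (mass (\<lambda>y. f y * \<mu> y) k y * ch y))" if y: "y \<in> cell i x" for y
      proof (cases "y \<in> E")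
        case True
        have "T N y \<le> t + (\<Sum>k=i..N. a k * mass (\<lambda>y. f y * \<mu> y) k y)"
        proof (cases i)
          case 0
          then show ?thesis using t by (simp add: T_def)
        next
          case (Suc j)
          have "c i y = c i x" using y by (simp add: in_cell_iff)
          then have "T j y \<le> t" using adT[of i y x j] x Suc by (simp add: Z_def)
          moreover have "T N y = T j y + (\<Sum>k=i..N. a k * mass (\<lambda>y. f y * \<mu> y) k y)"
            unfolding T_def Suc using i Suc
            by (metis (no_types, lifting) Suc_eq_plus1 le0 sum.ub_add_nat le_add_diff_inverse Suc_leD)
          ultimately show ?thesis by simp
        qed
        then have "t \<le> (\<Sum>k=i..N. a k * mass (\<lambda>y. f y * \<mu> y) k y)"
          using True by (simp add: E_def)
        then have "t * ch y \<le> (\<Sum>k=i..N. a k * mass (\<lambda>y. f y * \<mu> y) k y) * ch y"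
          using True nu by (intro mult_right_mono) (auto simp: ch_def E_def intro: less_imp_le)
        then show ?thesis by (simp add: sum_distrib_right mult.assoc)
      qed (simp add: ch_def)
      have "t * mass ch i x \<le> (\<Sum>y\<in>cell i x. \<Sum>k=i..N. a k * (mass (\<lambda>y. f y * \<mu> y) k y * ch y))"
        unfolding sum_distrib_left by (intro sum_mono local)
      also have "\<dots> = (\<Sum>k=i..N. a k * (\<Sum>y\<in>cell i x. mass (\<lambda>y. f y * \<mu> y) k y * ch y))"
        by (subst sum.swap) (simp add: sum_distrib_left)
      also have "\<dots> = (\<Sum>k=i..N. a k * (\<Sum>y\<in>cell i x. f y * \<mu> y * mass ch k y))"
        using sum_cell_swap[OF saturated_cell[of i _ x]] by (intro sum.cong refl) auto
      also have "\<dots> \<le> (\<Sum>k=i..N. a k * (\<Sum>y\<in>cell i x. f y * \<mu> y * mass \<nu> k y))"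
        using a f mu ch_pt
        by (intro sum_mono mult_left_mono) (auto simp: in_cell_iff intro!: mult_nonneg_nonneg intro: less_imp_le)
      also have "\<dots> = (\<Sum>y\<in>cell i x. f y * (\<Sum>k=i..N. a k * mass \<nu> k y) * \<mu> y)"
        by (simp add: sum_distrib_left sum_distrib_right sum.swap[of _ "cell i x"] mult_ac)
      also have "\<dots> \<le> Ph i x powr (1/p) * (\<Sum>y\<in>cell i x. (\<Sum>k=i..N. a k * mass \<nu> k y) powr p' * \<mu> y) powr (1/p')"
        unfolding Ph_def using f mu nu a p
        by (intro Holder_sum) (auto simp: in_cell_iff intro!: sum_nonneg mult_nonneg_nonneg intro: less_imp_le)
      also have "\<dots> \<le> Ph i x powr (1/p) * (W powr p' * mass \<nu> i x powr (p' / q')) powr (1/p')"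
        using test[OF xX i] pq mu
        by (intro mult_left_mono powr_mono2 sum_nonneg) (auto simp: in_cell_iff intro!: mult_nonneg_nonneg intro: less_imp_le)
      also have "\<dots> = W * Ph i x powr (1/p) * mass \<nu> i x powr (1/q')"
        using pq W n0 by (simp add: powr_mult powr_powr)
      finally have main: "t * mass ch i x \<le> W * Ph i x powr (1/p) * mass \<nu> i x powr (1/q')" .
      show ?thesis
      proof (cases "mass ch i x \<le> eps * mass \<nu> i x")
        case True
        then show ?thesis using Ph0[of i x] \<Phi>0 by (simp add: B_def add_increasing2)
      next
        case False
        then have "t * (eps * mass \<nu> i x) \<le> W * Ph i x powr (1/p) * mass \<nu> i x powr (1/q')"
          using main t by (smt (verit) mult_left_mono)
        moreover have "mass \<nu> i x = mass \<nu> i x powr (1/q) * mass \<nu> i x powr (1/q')"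
          using n0 p(4) by (simp flip: powr_add)
        ultimately have "(t * eps * mass \<nu> i x powr (1/q)) * mass \<nu> i x powr (1/q') \<le> W * Ph i x powr (1/p) * mass \<nu> i x powr (1/q')"
          by (metis mult.assoc)
        then have "t * eps * mass \<nu> i x powr (1/q) \<le> W * Ph i x powr (1/p)"
          by (rule mult_right_le_imp_le) (use n0 in simp)
        then have "mass \<nu> i x powr (1/q) \<le> W / (eps * t) * Ph i x powr (1/p)"
          using t eps by (simp add: field_simps)
        then have "(mass \<nu> i x powr (1/q)) powr q \<le> (W / (eps * t) * Ph i x powr (1/p)) powr q"
          using pq by (intro powr_mono2) auto
        then have "mass \<nu> i x \<le> (W / (eps * t)) powr q * Ph i x powr (q/p)"
          using pq n0 unfolding powr_mult powr_powr by simp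
        also have "Ph i x powr (q/p) = Ph i x powr (q/p - 1) * Ph i x"
          using powr_mult_base[OF Ph0, of i x "q/p - 1"] by (simp add: mult.commute)
        \<comment> \<open>This is where \<open>p \<le> q\<close> enters: one factor stays linear in
          \<open>Ph\<close>, so that it can be added over disjoint cells.\<close>
        also have "\<dots> \<le> \<Phi> powr (q/p - 1) * Ph i x"
          using Ph0 Ph_le pq p by (intro mult_right_mono powr_mono2) auto
        finally have "mass \<nu> i x \<le> B * Ph i x"
          by (simp add: B_def mult_left_mono mult.assoc)
        then show ?thesis
          using chi_le[of i x] eps(1) n0 by (smt (verit) mult_pos_pos)
      qed
    qed
    have "sum \<nu> E = sum ch {x\<in>X. t < T N x}"
      unfolding ch_def using t finX by (intro sum.mono_neutral_cong_left) (auto simp: E_def)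
    also have "\<dots> = (\<Sum>i=0..N. \<Sum>x\<in>Z i. 1 * ch x)" by (simp add: split)
    \<comment> \<open>The estimate \<open>key\<close> concerns whole cells. Each sum over points is
      rewritten through cell masses, estimated, and turned back.\<close>
    also have "\<dots> = (\<Sum>i=0..N. \<Sum>x\<in>Z i. 1 * mass ch i x / mass \<mu> i x * \<mu> x)"
      by (intro sum.cong refl sum_tower satZ mu) (auto simp: adapted_def)
    also have "\<dots> \<le> (\<Sum>i=0..N. \<Sum>x\<in>Z i. 1 * mass (\<lambda>x. eps * \<nu> x + B * (f x powr p * \<mu> x)) i x / mass \<mu> i x * \<mu> x)"
    proof (intro sum_mono mult_right_mono divide_right_mono)
      fix i x assume "i \<in> {0..N}" "x \<in> Z i"
      then show "1 * mass ch i x \<le> 1 * mass (\<lambda>x. eps * \<nu> x + B * (f x powr p * \<mu> x)) i x"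
        using key[of x i] by (simp add: sum.distrib Ph_def flip: sum_distrib_left)
    qed (use mu mass_pos[of \<mu>] in \<open>auto simp: Z_def intro: less_imp_le\<close>)
    also have "\<dots> = (\<Sum>i=0..N. \<Sum>x\<in>Z i. 1 * (eps * \<nu> x + B * (f x powr p * \<mu> x)))"
      by (intro sum.cong refl sum_tower[symmetric] satZ mu) (auto simp: adapted_def)
    also have "\<dots> = (\<Sum>x | x \<in> X \<and> t < T N x. eps * \<nu> x + B * (f x powr p * \<mu> x))"
      by (simp add: split)
    also have "\<dots> = eps * sum \<nu> {x\<in>X. t < T N x} + B * (\<Sum>x | x \<in> X \<and> t < T N x. f x powr p * \<mu> x)"
      by (simp add: sum.distrib sum_distrib_left)
    also have "\<dots> \<le> eps * sum \<nu> {x\<in>X. t < T N x} + B * \<Phi>"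
      unfolding \<Phi>_def B_def using mu finX by (intro add_left_mono mult_left_mono sum_mono2) (auto intro!: mult_nonneg_nonneg intro: less_imp_le)
    also have "B * \<Phi> = (W * \<Phi> powr (1/p) / (eps * t)) powr q"
    proof -
      have "\<Phi> powr (q/p - 1) * \<Phi> = \<Phi> powr (q/p)"
        using powr_mult_base[OF \<Phi>0, of "q/p - 1"] by (simp add: mult.commute)
      moreover have "W * \<Phi> powr (1/p) / (eps * t) = W / (eps * t) * \<Phi> powr (1/p)" by simp
      ultimately show ?thesis
        unfolding B_def by (simp only: powr_mult powr_powr mult.assoc) simp
    qed
    finally show ?thesis by (simp add: E_def)
  qed
  define h where "h t = t powr q * sum \<nu> {x\<in>X. t < T N x}" for t
  have "h t \<le> h (t / 2) / 2 + D" if t: "t > 0" for t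
  proof -
    have "h t \<le> t powr q * (eps * sum \<nu> {x\<in>X. t / 2 < T N x} + (W * \<Phi> powr (1/p) / (eps * (t / 2))) powr q)"
      unfolding h_def using good[of "t / 2"] t by (intro mult_left_mono) auto
    also have "\<dots> = (2 powr q * eps) * h (t / 2) + (t * (W * \<Phi> powr (1/p) / (eps * (t / 2)))) powr q"
      using t by (simp add: h_def powr_mult powr_divide distrib_left)
    also have "t * (W * \<Phi> powr (1/p) / (eps * (t / 2))) = 2 powr (q + 2) * W * \<Phi> powr (1/p)"
    proof -
      have "t * (W * \<Phi> powr (1/p) / (eps * (t / 2))) = (2 / eps) * W * \<Phi> powr (1/p)"
        using t eps(1) by (simp add: field_simps)
      also have "2 / eps = 2 powr (q + 2)"
        by (simp add: eps_def powr_add powr_diff powr_minus_divide)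
      finally show ?thesis .
    qed
    finally show ?thesis using eps by (simp add: D_def)
  qed
  moreover have "h t \<le> sum \<nu> X * t powr q" for t
    unfolding h_def using nu finX by (simp add: mult.commute[of "sum \<nu> X"]) (intro mult_left_mono sum_mono2, auto intro: less_imp_le)
  ultimately have "h t \<le> 2 * D"
    using t pq nu by (intro halving_bound[of h D "sum \<nu> X" q] sum_nonneg) (auto intro!: mult_nonneg_nonneg intro: less_imp_le)
  then show ?thesis by (simp add: h_def D_def \<Phi>_def)
qed

section \<open>The strong-type bound\<close>

text \<open>
  The indices fixed by \<open>doubling \<phi>\<close> play the role of principal cubes: \<open>\<phi>\<close> is comparable to its value at
  the last of them, and its values at them grow geometrically.
\<close>

primrec doubling :: "(nat \<Rightarrow> real) \<Rightarrow> nat \<Rightarrow> nat" where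
  "doubling \<phi> 0 = 0"
| "doubling \<phi> (Suc j) = (if 2 * \<phi> (doubling \<phi> j) < \<phi> (Suc j) then Suc j else doubling \<phi> j)"

lemma doubling_le: "doubling \<phi> j \<le> j"
  by (induction j) auto

lemma doubling_idem: "doubling \<phi> (doubling \<phi> j) = doubling \<phi> j"
  by (induction j) auto

lemma le_doubling: "(\<And>j. 0 \<le> \<phi> j) \<Longrightarrow> \<phi> j \<le> 2 * \<phi> (doubling \<phi> j)"
  by (cases j) auto

lemma doubling_cong: "(\<And>i. i \<le> j \<Longrightarrow> \<phi> i = \<psi> i) \<Longrightarrow> doubling \<phi> j = doubling \<psi> j"
proof (induction j)
  case (Suc j)
  then have "doubling \<phi> j = doubling \<psi> j" by simp
  moreover have "\<phi> (doubling \<psi> j) = \<psi> (doubling \<psi> j)"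
    using Suc(2) doubling_le[of \<psi> j] by simp
  ultimately show ?case using Suc(2)[of "Suc j"] by simp
qed simp

text \<open>Each recorded value is more than twice the preceding one, so for
  \<open>p \<ge> 1\<close> the powers grow at least geometrically with ratio two and the last one
  dominates.\<close>

lemma sum_doublings_le:
  fixes \<phi> :: "nat \<Rightarrow> real"
  assumes nn: "\<And>j. 0 \<le> \<phi> j" and p: "p \<ge> 1"
  shows "(\<Sum>i=0..N. if doubling \<phi> i = i then \<phi> i powr p else 0) \<le> 2 * \<phi> (doubling \<phi> N) powr p"
proof (induction N)
  case (Suc N)
  show ?case
  proof (cases "2 * \<phi> (doubling \<phi> N) < \<phi> (Suc N)")
    case True
    have "\<phi> (doubling \<phi> N) powr p \<le> (\<phi> (Suc N) / 2) powr p"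
      using True nn p by (intro powr_mono2) auto
    also have "\<dots> = \<phi> (Suc N) powr p / 2 powr p" by (simp add: powr_divide)
    also have "\<dots> \<le> \<phi> (Suc N) powr p / 2"
      using p powr_mono[of 1 p 2] by (intro divide_left_mono) auto
    finally show ?thesis using Suc True by simp
  next
    case False
    then have "doubling \<phi> (Suc N) \<noteq> Suc N" using doubling_le[of \<phi> N] by simp
    then show ?thesis using Suc False by simp
  qed
qed simp

lemma sum_powr_le_powr_sum:
  fixes z :: "'i \<Rightarrow> real"
  assumes fin: "finite I" and nn: "\<And>i. i \<in> I \<Longrightarrow> 0 \<le> z i" and s: "s \<ge> 1"
  shows "(\<Sum>i\<in>I. z i powr s) \<le> (\<Sum>i\<in>I. z i) powr s"
proof -
  have S: "0 \<le> sum z I" using nn by (rule sum_nonneg)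
  have "(\<Sum>i\<in>I. z i powr s) \<le> (\<Sum>i\<in>I. z i * sum z I powr (s - 1))"
  proof (rule sum_mono)
    fix i assume i: "i \<in> I"
    have "z i powr s = z i * z i powr (s - 1)" using nn[OF i] by (simp add: powr_mult_base)
    also have "\<dots> \<le> z i * sum z I powr (s - 1)"
      using nn i s member_le_sum[of i I z] fin by (intro mult_left_mono powr_mono2) auto
    finally show "z i powr s \<le> z i * sum z I powr (s - 1)" .
  qed
  also have "\<dots> = sum z I powr s"
    using S by (simp add: powr_mult_base flip: sum_distrib_right)
  finally show ?thesis .
qed

context finite_filtration
begin

lemma mass_adapted_mult: "adapted i \<phi> \<Longrightarrow> mass (\<lambda>x. \<phi> x * h x) i z = \<phi> z * mass h i z"
  unfolding sum_distrib_left
  by (intro sum.cong refl) (metis adaptedD in_cell_iff)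

lemma mass_nonneg: "(\<And>y. y \<in> X \<Longrightarrow> 0 \<le> f y) \<Longrightarrow> 0 \<le> mass f i x"
  by (intro sum_nonneg) (auto simp: in_cell_iff)

lemma half_form:
  fixes a :: "nat \<Rightarrow> real" and \<mu> \<nu> :: "'x \<Rightarrow> real" and \<phi> \<psi> :: "nat \<Rightarrow> 'x \<Rightarrow> real" and N :: nat
  defines "T \<equiv> \<lambda>j x. \<Sum>k=j..N. a k * mass \<mu> k x"
  assumes mu: "\<And>x. x \<in> X \<Longrightarrow> 0 < \<mu> x" and nu: "\<And>x. x \<in> X \<Longrightarrow> 0 < \<nu> x"
    and a: "\<And>k. 0 \<le> a k"
    and phi: "\<And>j x. 0 \<le> \<phi> j x" "\<And>i j x. i \<le> j \<Longrightarrow> \<phi> i x \<le> \<phi> j x" "\<And>i j. i \<le> j \<Longrightarrow> adapted j (\<phi> i)"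
    and psi: "\<And>j x. 0 \<le> \<psi> j x" "\<And>i j x. i \<le> j \<Longrightarrow> \<psi> i x \<le> \<psi> j x"
    and p: "1 < p" "p \<le> q" "1/p + 1/p' = 1" "1/q + 1/q' = 1" and W: "0 \<le> W"
    and test: "\<And>i z. z \<in> X \<Longrightarrow> i \<le> N \<Longrightarrow>
      (\<Sum>y\<in>cell i z. T i y powr q * \<nu> y) \<le> W powr q * mass \<mu> i z powr (q / p)"
  shows "(\<Sum>x\<in>X. (\<Sum>j=0..N. increment 0 (\<lambda>j. \<psi> j x) j * \<phi> j x * T j x) * \<nu> x)
    \<le> 4 * W * (\<Sum>x\<in>X. \<phi> N x powr p * \<mu> x) powr (1/p) * (\<Sum>x\<in>X. \<psi> N x powr q' * \<nu> x) powr (1/q')"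
proof -
  define d where "d j x = increment 0 (\<lambda>j. \<psi> j x) j" for j x
  define R where "R j x = doubling (\<lambda>j. \<phi> j x) j" for j x
  define \<gamma> where "\<gamma> i x = (\<Sum>j=0..N. if R j x = i then d j x else 0)" for i x
  define \<phi>' where "\<phi>' i x = (if R i x = i then \<phi> i x else 0)" for i x
  define G where "G i x = mass (\<lambda>y. \<gamma> i y powr q' * \<nu> y) i x" for i x
  define \<Phi> where "\<Phi> = (\<Sum>x\<in>X. \<phi> N x powr p * \<mu> x)"
  define \<Psi> where "\<Psi> = (\<Sum>x\<in>X. \<psi> N x powr q' * \<nu> x)"
  have mu0: "0 \<le> \<mu> x" and nu0: "0 \<le> \<nu> x" if "x \<in> X" for x
    using mu[OF that] nu[OF that] by auto
  have q: "1 < q" "1 < p'" "1 < q'" using p conjugate_exponent_gt_1[of p p'] conjugate_exponent_gt_1[of q q'] by auto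
  have "1 / p' \<le> 1 / q'"
    using p frac_le[of 1 1 p q] by auto
  then have qp': "q' \<le> p'" using q by (simp add: field_simps)
  have d0: "0 \<le> d j x" for j x
    unfolding d_def increment_def using psi by auto
  have T0: "0 \<le> T j x" for j x
    unfolding T_def using a mu0 by (intro sum_nonneg mult_nonneg_nonneg mass_nonneg) auto
  have Tanti: "T j x \<le> T i x" if "i \<le> j" for i j x
    unfolding T_def using that a mu0 by (intro sum_mono2) (auto intro!: mult_nonneg_nonneg mass_nonneg)
  have \<gamma>0: "0 \<le> \<gamma> i x" for i x
    unfolding \<gamma>_def using d0 by (intro sum_nonneg) auto
  have \<phi>'0: "0 \<le> \<phi>' i x" for i x
    unfolding \<phi>'_def using phi by auto
  have sum_\<gamma>: "(\<Sum>i=0..N. \<gamma> i x) = \<psi> N x" for x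
  proof -
    have "(\<Sum>i=0..N. \<gamma> i x) = (\<Sum>j=0..N. \<Sum>i=0..N. if R j x = i then d j x else 0)"
      unfolding \<gamma>_def by (rule sum.swap)
    also have "\<dots> = (\<Sum>j=0..N. d j x)"
    proof (rule sum.cong[OF refl])
      fix j assume "j \<in> {0..N}"
      then have "R j x \<in> {0..N}" using doubling_le[of "\<lambda>j. \<phi> j x" j] by (simp add: R_def)
      then show "(\<Sum>i=0..N. if R j x = i then d j x else 0) = d j x" by simp
    qed
    finally show ?thesis by (simp add: d_def sum_increment)
  qed
  have pointwise: "(\<Sum>j=0..N. d j x * \<phi> j x * T j x) \<le> 2 * (\<Sum>i=0..N. \<phi>' i x * (\<gamma> i x * T i x))" for x
  proof -
    have "(\<Sum>j=0..N. d j x * \<phi> j x * T j x) \<le> (\<Sum>j=0..N. 2 * (\<Sum>i=0..N. if R j x = i then d j x * \<phi>' i x * T i x else 0))"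
    proof (rule sum_mono)
      fix j assume "j \<in> {0..N}"
      then have R: "R j x \<le> j" "R j x \<in> {0..N}"
        using doubling_le[of "\<lambda>j. \<phi> j x" j] by (auto simp: R_def)
      have "\<phi> j x \<le> 2 * \<phi> (R j x) x"
        unfolding R_def using le_doubling[of "\<lambda>j. \<phi> j x" j] phi by simp
      moreover have "\<phi> (R j x) x = \<phi>' (R j x) x"
        by (simp add: \<phi>'_def R_def doubling_idem)
      \<comment> \<open>\<open>T\<close> is a sum over the generations from its index on, so moving
        back to \<open>R j x\<close> can only enlarge it.\<close>
      ultimately have "d j x * \<phi> j x * T j x \<le> d j x * (2 * \<phi>' (R j x) x) * T (R j x) x"
        using d0 T0 Tanti[OF R(1)] \<phi>'0 by (intro mult_mono mult_left_mono) auto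
      then show "d j x * \<phi> j x * T j x \<le> 2 * (\<Sum>i=0..N. if R j x = i then d j x * \<phi>' i x * T i x else 0)"
        using R by simp
    qed
    also have "\<dots> = 2 * (\<Sum>i=0..N. \<Sum>j=0..N. if R j x = i then d j x * \<phi>' i x * T i x else 0)"
      by (subst sum.swap) (simp add: sum_distrib_left)
    also have "\<dots> = 2 * (\<Sum>i=0..N. \<phi>' i x * (\<gamma> i x * T i x))"
      unfolding \<gamma>_def
      by (intro arg_cong[where f = "\<lambda>t. 2 * t"] sum.cong refl)
        (auto simp: sum_distrib_left sum_distrib_right intro!: sum.cong)
    finally show ?thesis .
  qed
  have ad: "adapted i (\<phi>' i)" for i
  proof (rule adaptedI)
    fix x y assume xy: "c i x = c i y"
    have eq: "\<phi> j x = \<phi> j y" if "j \<le> i" for j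
      by (rule adaptedD[OF phi(3)[OF that] xy])
    then have "R i x = R i y" unfolding R_def by (rule doubling_cong)
    then show "\<phi>' i x = \<phi>' i y" using eq by (simp add: \<phi>'_def)
  qed
  have G0: "0 \<le> G i x" for i x
    unfolding G_def using nu0 by (intro mass_nonneg mult_nonneg_nonneg) auto
  have G_sum: "(\<Sum>i=0..N. \<Sum>x\<in>X. G i x / mass \<mu> i x * \<mu> x) \<le> \<Psi>"
  proof -
    have "(\<Sum>x\<in>X. G i x / mass \<mu> i x * \<mu> x) = (\<Sum>x\<in>X. \<gamma> i x powr q' * \<nu> x)" for i
      using sum_tower[where S = X and l = \<mu> and i = i and \<phi> = "\<lambda>_. 1" and h = "\<lambda>x. \<gamma> i x powr q' * \<nu> x", OF saturated_X mu]
      by (simp add: adapted_def G_def)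
    then have "(\<Sum>i=0..N. \<Sum>x\<in>X. G i x / mass \<mu> i x * \<mu> x) = (\<Sum>x\<in>X. (\<Sum>i=0..N. \<gamma> i x powr q') * \<nu> x)"
      by (simp add: sum_distrib_right sum.swap[of _ X])
    also have "\<dots> \<le> (\<Sum>x\<in>X. (\<Sum>i=0..N. \<gamma> i x) powr q' * \<nu> x)"
      using nu0 \<gamma>0 q by (intro sum_mono mult_right_mono sum_powr_le_powr_sum) auto
    finally show ?thesis by (simp add: sum_\<gamma> \<Psi>_def)
  qed
  have G_le: "G i x \<le> \<Psi>" if "i \<le> N" for i x
  proof -
    have "G i x \<le> (\<Sum>x\<in>X. \<gamma> i x powr q' * \<nu> x)"
      unfolding G_def using nu0 by (intro sum_mono2 finX cell_subset) auto
    also have "\<dots> \<le> \<Psi>"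
      unfolding \<Psi>_def sum_\<gamma>[symmetric] using that \<gamma>0 nu0 q
      by (intro sum_mono mult_right_mono powr_mono2 member_le_sum) auto
    finally show ?thesis .
  qed
  have \<Psi>0: "0 \<le> \<Psi>" unfolding \<Psi>_def using nu0 by (intro sum_nonneg mult_nonneg_nonneg) auto
  have level: "(\<Sum>x\<in>X. \<phi>' i x * (\<gamma> i x * T i x) * \<nu> x)
      \<le> W * (\<Sum>x\<in>X. \<phi>' i x * (G i x powr (1/q') * mass \<mu> i x powr (1/p - 1)) * \<mu> x)" if i: "i \<le> N" for i
  proof -
    have "(\<Sum>x\<in>X. \<phi>' i x * (\<gamma> i x * T i x) * \<nu> x)
      = (\<Sum>x\<in>X. \<phi>' i x * mass (\<lambda>x. \<gamma> i x * T i x * \<nu> x) i x / mass \<mu> i x * \<mu> x)"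
      using sum_tower[where S = X and l = \<mu> and h = "\<lambda>x. \<gamma> i x * T i x * \<nu> x", OF saturated_X mu ad[of i]] by (simp add: mult.assoc)
    also have "\<dots> \<le> (\<Sum>x\<in>X. \<phi>' i x * (W * G i x powr (1/q') * mass \<mu> i x powr (1/p)) / mass \<mu> i x * \<mu> x)"
    proof (intro sum_mono mult_right_mono divide_right_mono mult_left_mono \<phi>'0)
      fix x assume x: "x \<in> X"
      have m0: "0 < mass \<mu> i x" using mass_pos[of \<mu>] mu x by auto
      have q1: "1/q' + 1/q = 1" using p by simp
      have "mass (\<lambda>x. \<gamma> i x * T i x * \<nu> x) i x
          \<le> G i x powr (1/q') * mass (\<lambda>x. T i x powr q * \<nu> x) i x powr (1/q)"
        unfolding G_def using \<gamma>0 T0 nu0 q q1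
        by (intro Holder_sum) (auto simp: in_cell_iff)
      also have "\<dots> \<le> G i x powr (1/q') * (W powr q * mass \<mu> i x powr (q / p)) powr (1/q)"
        using test[OF x i] q T0 nu0 by (intro mult_left_mono powr_mono2 mass_nonneg) auto
      also have "\<dots> = W * G i x powr (1/q') * mass \<mu> i x powr (1/p)"
        using q W m0 by (simp add: powr_mult powr_powr)
      finally show "mass (\<lambda>x. \<gamma> i x * T i x * \<nu> x) i x \<le> W * G i x powr (1/q') * mass \<mu> i x powr (1/p)" .
    qed (use mu0 mass_nonneg[of \<mu>] in auto)
    also have "\<dots> = W * (\<Sum>x\<in>X. \<phi>' i x * (G i x powr (1/q') * mass \<mu> i x powr (1/p - 1)) * \<mu> x)"
      unfolding sum_distrib_left
    proof (rule sum.cong[OF refl])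
      fix x assume x: "x \<in> X"
      have m0: "0 < mass \<mu> i x" using mass_pos[of \<mu>] mu x by auto
      show "\<phi>' i x * (W * G i x powr (1/q') * mass \<mu> i x powr (1/p)) / mass \<mu> i x * \<mu> x
        = W * (\<phi>' i x * (G i x powr (1/q') * mass \<mu> i x powr (1/p - 1)) * \<mu> x)"
        using m0 by (simp add: powr_diff)
    qed
    finally show ?thesis .
  qed
  have "(\<Sum>x\<in>X. (\<Sum>j=0..N. d j x * \<phi> j x * T j x) * \<nu> x)
      \<le> (\<Sum>x\<in>X. (2 * (\<Sum>i=0..N. \<phi>' i x * (\<gamma> i x * T i x))) * \<nu> x)"
    using pointwise nu0 by (intro sum_mono mult_right_mono) auto
  also have "\<dots> = 2 * (\<Sum>i=0..N. \<Sum>x\<in>X. \<phi>' i x * (\<gamma> i x * T i x) * \<nu> x)"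
    by (simp add: sum_distrib_left sum_distrib_right sum.swap[of _ X] mult_ac)
  also have "\<dots> \<le> 2 * (\<Sum>i=0..N. W * (\<Sum>x\<in>X. \<phi>' i x * (G i x powr (1/q') * mass \<mu> i x powr (1/p - 1)) * \<mu> x))"
    by (rule mult_left_mono[OF sum_mono]) (auto simp: level)
  also have "\<dots> = 2 * W * (\<Sum>(i, x)\<in>{0..N} \<times> X. \<phi>' i x * (G i x powr (1/q') * mass \<mu> i x powr (1/p - 1)) * \<mu> x)"
    by (simp add: sum_distrib_left mult.assoc flip: sum.cartesian_product)
  also have "\<dots> \<le> 2 * W * ((\<Sum>(i, x)\<in>{0..N} \<times> X. \<phi>' i x powr p * \<mu> x) powr (1/p)
      * (\<Sum>(i, x)\<in>{0..N} \<times> X. (G i x powr (1/q') * mass \<mu> i x powr (1/p - 1)) powr p' * \<mu> x) powr (1/p'))"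
    using Holder_sum[of "{0..N} \<times> X" p p' "\<lambda>(i, x). \<phi>' i x" "\<lambda>(i, x). G i x powr (1/q') * mass \<mu> i x powr (1/p - 1)" "\<lambda>(i, x). \<mu> x"]
      finX p W \<phi>'0 mu0
    by (intro mult_left_mono) (auto simp: case_prod_unfold)
  also have "\<dots> \<le> 2 * W * ((2 * \<Phi>) powr (1/p) * (\<Psi> powr (p'/q')) powr (1/p'))"
  proof (intro mult_left_mono mult_mono powr_mono2)
    have "(\<Sum>(i, x)\<in>{0..N} \<times> X. \<phi>' i x powr p * \<mu> x) = (\<Sum>x\<in>X. (\<Sum>i=0..N. \<phi>' i x powr p) * \<mu> x)"
      by (simp add: sum_distrib_right sum.swap[of _ X] flip: sum.cartesian_product)
    also have "\<dots> \<le> (\<Sum>x\<in>X. (2 * \<phi> N x powr p) * \<mu> x)"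
    proof (intro sum_mono mult_right_mono mu0)
      fix x
      have "(\<Sum>i=0..N. \<phi>' i x powr p) = (\<Sum>i=0..N. if R i x = i then \<phi> i x powr p else 0)"
        unfolding \<phi>'_def by (intro sum.cong refl) auto
      also have "\<dots> \<le> 2 * \<phi> (R N x) x powr p"
        unfolding R_def using sum_doublings_le[of "\<lambda>j. \<phi> j x" p N] phi p by simp
      also have "\<dots> \<le> 2 * \<phi> N x powr p"
        using phi p doubling_le[of "\<lambda>j. \<phi> j x" N] by (intro mult_left_mono powr_mono2) (auto simp: R_def)
      finally show "(\<Sum>i=0..N. \<phi>' i x powr p) \<le> 2 * \<phi> N x powr p" .
    qed
    finally show "(\<Sum>(i, x)\<in>{0..N} \<times> X. \<phi>' i x powr p * \<mu> x) \<le> 2 * \<Phi>"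
      by (simp add: \<Phi>_def sum_distrib_left mult.assoc)
    have "(\<Sum>(i, x)\<in>{0..N} \<times> X. (G i x powr (1/q') * mass \<mu> i x powr (1/p - 1)) powr p' * \<mu> x)
      = (\<Sum>i=0..N. \<Sum>x\<in>X. (G i x powr (1/q') * mass \<mu> i x powr (1/p - 1)) powr p' * \<mu> x)"
      by (simp flip: sum.cartesian_product)
    also have "\<dots> \<le> (\<Sum>i=0..N. \<Sum>x\<in>X. \<Psi> powr (p'/q' - 1) * (G i x / mass \<mu> i x * \<mu> x))"
    proof (intro sum_mono)
      fix i x assume i: "i \<in> {0..N}" and x: "x \<in> X"
      have m0: "0 < mass \<mu> i x" using mass_pos[of \<mu>] mu x by auto
      have e1: "(1/p - 1) * p' = -1" using p q by (simp add: field_simps)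
      \<comment> \<open>Since \<open>p \<le> q\<close>, the exponent \<open>p'/q'\<close> is at
        least one. The excess is bounded by a power of \<open>\<Psi>\<close>, and the remaining
        linear factor is summed by \<open>G_sum\<close>.\<close>
      have "(G i x powr (1/q') * mass \<mu> i x powr (1/p - 1)) powr p' = G i x powr (p'/q') * mass \<mu> i x powr (-1)"
        unfolding powr_mult powr_powr e1 by simp
      also have "\<dots> = (G i x powr (p'/q' - 1) * G i x) / mass \<mu> i x"
        using m0 powr_mult_base[OF G0, of i x "p'/q' - 1"] by (simp add: powr_minus_divide mult.commute)
      also have "\<dots> \<le> (\<Psi> powr (p'/q' - 1) * G i x) / mass \<mu> i x"
        using m0 G0 G_le i qp' q by (intro divide_right_mono mult_right_mono powr_mono2) auto
      finally show "(G i x powr (1/q') * mass \<mu> i x powr (1/p - 1)) powr p' * \<mu> x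
        \<le> \<Psi> powr (p'/q' - 1) * (G i x / mass \<mu> i x * \<mu> x)"
        using mult_right_mono[OF _ mu0[OF x]] by fastforce
    qed
    also have "\<dots> = \<Psi> powr (p'/q' - 1) * (\<Sum>i=0..N. \<Sum>x\<in>X. G i x / mass \<mu> i x * \<mu> x)"
      by (simp add: sum_distrib_left)
    also have "\<dots> \<le> \<Psi> powr (p'/q' - 1) * \<Psi>"
      by (rule mult_left_mono[OF G_sum]) simp
    also have "\<dots> = \<Psi> powr (p'/q')"
      using powr_mult_base[OF \<Psi>0, of "p'/q' - 1"] by (simp add: mult.commute)
    finally show "(\<Sum>(i, x)\<in>{0..N} \<times> X. (G i x powr (1/q') * mass \<mu> i x powr (1/p - 1)) powr p' * \<mu> x) \<le> \<Psi> powr (p'/q')" .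
  qed (use p q W mu0 in \<open>auto simp: case_prod_unfold intro!: sum_nonneg mult_nonneg_nonneg\<close>)
  also have "\<dots> = (2 * 2 powr (1/p)) * (W * \<Phi> powr (1/p) * \<Psi> powr (1/q'))"
    using q by (simp add: powr_mult powr_powr)
  also have "\<dots> \<le> 4 * (W * \<Phi> powr (1/p) * \<Psi> powr (1/q'))"
    using p W powr_mono[of "1/p" 1 2] by (intro mult_right_mono) auto
  finally show ?thesis by (simp add: d_def \<Phi>_def \<Psi>_def mult.assoc)
qed

text \<open>The discrete product rule. Its exact second term contains the earlier value of
  \<open>G\<close>; monotonicity replaces it by the current one, which gives both halves the same
  shape.\<close>

lemma increment_mult_le:
  fixes F G :: "nat \<Rightarrow> real"
  assumes "\<And>j. 0 \<le> F j" "\<And>j. 0 \<le> G j" "\<And>j. F j \<le> F (Suc j)" "\<And>j. G j \<le> G (Suc j)"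
  shows "increment 0 (\<lambda>j. F j * G j) j \<le> increment 0 G j * F j + increment 0 F j * G j"
proof (cases j)
  case 0
  then show ?thesis using assms(1,2)[of 0] by (simp add: increment_def)
next
  case (Suc i)
  have "F j * G j - F i * G i = (G j - G i) * F j + (F j - F i) * G i"
    by (simp add: algebra_simps)
  also have "\<dots> \<le> (G j - G i) * F j + (F j - F i) * G j"
    using assms(3,4)[of i] Suc by (intro add_left_mono mult_left_mono) auto
  finally show ?thesis by (simp add: increment_def Suc)
qed

text \<open>In generation \<open>k\<close> the form is the product of two averages against
  \<open>mass \<mu> k\<close>. Splitting the product of the running maxima into increments and
  summing over \<open>k\<close> last produces the tails of the potential that the two testing
  conditions bound.\<close>

lemma strong_bilinear:
  fixes a :: "nat \<Rightarrow> real" and \<mu> \<nu> f g :: "'x \<Rightarrow> real" and N :: nat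
  assumes mu: "\<And>x. x \<in> X \<Longrightarrow> 0 < \<mu> x" and nu: "\<And>x. x \<in> X \<Longrightarrow> 0 < \<nu> x"
    and a: "\<And>k. 0 \<le> a k" and f: "\<And>x. x \<in> X \<Longrightarrow> 0 \<le> f x" and g: "\<And>x. x \<in> X \<Longrightarrow> 0 \<le> g x"
    and p: "1 < p" "p \<le> q" "1/p + 1/p' = 1" "1/q + 1/q' = 1" and W: "0 \<le> W" "0 \<le> W'"
    and test: "\<And>i z. z \<in> X \<Longrightarrow> i \<le> N \<Longrightarrow>
      (\<Sum>y\<in>cell i z. (\<Sum>k=i..N. a k * mass \<mu> k y) powr q * \<nu> y) \<le> W powr q * mass \<mu> i z powr (q / p)"
    and test': "\<And>i z. z \<in> X \<Longrightarrow> i \<le> N \<Longrightarrow>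
      (\<Sum>y\<in>cell i z. (\<Sum>k=i..N. a k * mass \<nu> k y) powr p' * \<mu> y) \<le> W' powr p' * mass \<nu> i z powr (p' / q')"
  shows "(\<Sum>x\<in>X. (\<Sum>k=0..N. a k * mass (\<lambda>y. f y * \<mu> y) k x) * g x * \<nu> x)
    \<le> 4 * p' * q * (W + W') * (\<Sum>x\<in>X. f x powr p * \<mu> x) powr (1/p) * (\<Sum>x\<in>X. g x powr q' * \<nu> x) powr (1/q')"
proof -
  define Ff where "Ff k x = running_max 0 (\<lambda>k. mass (\<lambda>y. f y * \<mu> y) k x / mass \<mu> k x) k" for k x
  define Gg where "Gg k x = running_max 0 (\<lambda>k. mass (\<lambda>y. g y * \<nu> y) k x / mass \<nu> k x) k" for k x
  define H1 where "H1 k x = (\<Sum>j=0..k. increment 0 (\<lambda>j. Gg j x) j * Ff j x)" for k x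
  define H2 where "H2 k x = (\<Sum>j=0..k. increment 0 (\<lambda>j. Ff j x) j * Gg j x)" for k x
  define nf where "nf = (\<Sum>x\<in>X. f x powr p * \<mu> x) powr (1/p)"
  define ng where "ng = (\<Sum>x\<in>X. g x powr q' * \<nu> x) powr (1/q')"
  define Nf where "Nf = (\<Sum>x\<in>X. Ff N x powr p * \<mu> x) powr (1/p)"
  define Ng where "Ng = (\<Sum>x\<in>X. Gg N x powr q' * \<nu> x) powr (1/q')"
  have mu0: "0 \<le> \<mu> x" and nu0: "0 \<le> \<nu> x" if "x \<in> X" for x
    using mu[OF that] nu[OF that] by auto
  have q: "1 < q" "1 < p'" "1 < q'" using p conjugate_exponent_gt_1[of p p'] conjugate_exponent_gt_1[of q q'] by auto
  have "1 / p' \<le> 1 / q'"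
    using p frac_le[of 1 1 p q] by auto
  then have qp': "q' \<le> p'" using q by (simp add: field_simps)
  \<comment> \<open>The maximal inequality for \<open>f\<close> in exponent \<open>p\<close> and for
    \<open>g\<close> in exponent \<open>q'\<close> has these constants, whence the factor
    \<open>p' * q\<close>.\<close>
  have conj: "p / (p - 1) = p'" "q' / (q' - 1) = q"
    using p q by (auto simp: field_simps)
  have av_nonneg: "0 \<le> mass (\<lambda>y. h y * w y) k x / mass w k x"
    if "\<And>x. x \<in> X \<Longrightarrow> 0 \<le> h x" "\<And>x. x \<in> X \<Longrightarrow> 0 \<le> w x" for h w k x
    using that by (intro divide_nonneg_nonneg mass_nonneg mult_nonneg_nonneg) auto
  have F0: "0 \<le> Ff k x" for k x
    unfolding Ff_def using av_nonneg[of f \<mu> k x] f mu0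
      running_max_ge[of 0 k k "\<lambda>k. mass (\<lambda>y. f y * \<mu> y) k x / mass \<mu> k x"] by force
  have G0: "0 \<le> Gg k x" for k x
    unfolding Gg_def using av_nonneg[of g \<nu> k x] g nu0
      running_max_ge[of 0 k k "\<lambda>k. mass (\<lambda>y. g y * \<nu> y) k x / mass \<nu> k x"] by force
  have Fm: "Ff i x \<le> Ff j x" and Gm: "Gg i x \<le> Gg j x" if "i \<le> j" for i j x
    unfolding Ff_def Gg_def using that by (auto intro: running_max_mono)
  have ad_rmax: "adapted j (\<lambda>x. running_max 0 (\<lambda>k. mass h k x / mass w k x) i)" if "i \<le> j" for h w i j
  proof (rule adaptedI)
    fix x y assume xy: "c j x = c j y"
    have "mass h k x / mass w k x = mass h k y / mass w k y" if "k \<le> i" for k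
      using \<open>i \<le> j\<close> that mass_adapted[OF _ xy, of k] by simp
    then show "running_max 0 (\<lambda>k. mass h k x / mass w k x) i = running_max 0 (\<lambda>k. mass h k y / mass w k y) i"
      by (intro running_max_cong) auto
  qed
  have adF: "adapted j (Ff i)" and adG: "adapted j (Gg i)" if "i \<le> j" for i j
    unfolding Ff_def[abs_def] Gg_def[abs_def] using that by (auto intro!: ad_rmax)
  have adH: "adapted k (H2 k)" for k
  proof (rule adaptedI)
    fix x y assume xy: "c k x = c k y"
    have "Ff j x = Ff j y" "Gg j x = Gg j y" if "j \<le> k" for j
      using adaptedD[OF adF[OF that] xy] adaptedD[OF adG[OF that] xy] by auto
    then show "H2 k x = H2 k y"
      unfolding H2_def increment_def by (intro sum.cong refl) auto
  qed
  have FG: "Ff k x * Gg k x \<le> H1 k x + H2 k x" for k x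
  proof -
    have "Ff k x * Gg k x = (\<Sum>j=0..k. increment 0 (\<lambda>j. Ff j x * Gg j x) j)"
      by (simp add: sum_increment)
    also have "\<dots> \<le> (\<Sum>j=0..k. increment 0 (\<lambda>j. Gg j x) j * Ff j x + increment 0 (\<lambda>j. Ff j x) j * Gg j x)"
      using F0 G0 Fm Gm by (intro sum_mono increment_mult_le) auto
    finally show ?thesis by (simp add: H1_def H2_def sum.distrib)
  qed
  have level: "(\<Sum>x\<in>X. mass (\<lambda>y. f y * \<mu> y) k x * g x * \<nu> x)
      \<le> (\<Sum>x\<in>X. H1 k x * mass \<mu> k x * \<nu> x) + (\<Sum>x\<in>X. H2 k x * mass \<nu> k x * \<mu> x)" for k
  proof -
    have "(\<Sum>x\<in>X. mass (\<lambda>y. f y * \<mu> y) k x * (g x * \<nu> x))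
      = (\<Sum>x\<in>X. mass (\<lambda>y. f y * \<mu> y) k x * mass (\<lambda>y. g y * \<nu> y) k x / mass \<nu> k x * \<nu> x)"
      using nu by (intro sum_tower saturated_X adaptedI mass_adapted) auto
    also have "\<dots> \<le> (\<Sum>x\<in>X. (H1 k x + H2 k x) * mass \<mu> k x * \<nu> x)"
    proof (intro sum_mono mult_right_mono nu0)
      fix x assume x: "x \<in> X"
      have m0: "0 < mass \<mu> k x" using mass_pos[of \<mu>] mu x by auto
      have "mass (\<lambda>y. f y * \<mu> y) k x * mass (\<lambda>y. g y * \<nu> y) k x / mass \<nu> k x
        = (mass (\<lambda>y. f y * \<mu> y) k x / mass \<mu> k x) * (mass (\<lambda>y. g y * \<nu> y) k x / mass \<nu> k x) * mass \<mu> k x"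
        using m0 by simp
      also have "\<dots> \<le> (Ff k x * Gg k x) * mass \<mu> k x"
      proof (intro mult_right_mono mult_mono)
        show "mass (\<lambda>y. f y * \<mu> y) k x / mass \<mu> k x \<le> Ff k x"
          unfolding Ff_def by (rule running_max_ge[of 0 k k "\<lambda>k. mass (\<lambda>y. f y * \<mu> y) k x / mass \<mu> k x"]) auto
        show "mass (\<lambda>y. g y * \<nu> y) k x / mass \<nu> k x \<le> Gg k x"
          unfolding Gg_def by (rule running_max_ge[of 0 k k "\<lambda>k. mass (\<lambda>y. g y * \<nu> y) k x / mass \<nu> k x"]) auto
      qed (use F0 m0 av_nonneg[of g \<nu> k x] g nu0 in auto)
      also have "\<dots> \<le> (H1 k x + H2 k x) * mass \<mu> k x"
        using FG m0 by (intro mult_right_mono) auto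
      finally show "mass (\<lambda>y. f y * \<mu> y) k x * mass (\<lambda>y. g y * \<nu> y) k x / mass \<nu> k x
        \<le> (H1 k x + H2 k x) * mass \<mu> k x" .
    qed
    also have "\<dots> = (\<Sum>x\<in>X. H1 k x * mass \<mu> k x * \<nu> x) + (\<Sum>x\<in>X. mass \<mu> k x * (H2 k x * \<nu> x))"
      by (simp add: algebra_simps sum.distrib)
    \<comment> \<open>The second half has to be integrated against \<open>\<mu>\<close> with the
      potential of \<open>\<nu>\<close>, as in \<open>test'\<close>; the two measures are exchanged
      inside each cell.\<close>
    also have "(\<Sum>x\<in>X. mass \<mu> k x * (H2 k x * \<nu> x)) = (\<Sum>x\<in>X. \<mu> x * mass (\<lambda>x. H2 k x * \<nu> x) k x)"
      by (rule sum_cell_swap[OF saturated_X])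
    also have "\<dots> = (\<Sum>x\<in>X. H2 k x * mass \<nu> k x * \<mu> x)"
      unfolding mass_adapted_mult[OF adH] by (simp add: mult_ac)
    finally show ?thesis by (simp add: mult.assoc)
  qed
  have rearrange: "(\<Sum>k=0..N. a k * (\<Sum>x\<in>X. (\<Sum>j=0..k. D j x) * m k x * w x))
      = (\<Sum>x\<in>X. (\<Sum>j=0..N. D j x * (\<Sum>k=j..N. a k * m k x)) * w x)"
    for D m :: "nat \<Rightarrow> 'x \<Rightarrow> real" and w :: "'x \<Rightarrow> real"
  proof -
    have "(\<Sum>k=0..N. a k * (\<Sum>x\<in>X. (\<Sum>j=0..k. D j x) * m k x * w x))
      = (\<Sum>x\<in>X. \<Sum>k=0..N. \<Sum>j=0..k. D j x * (a k * m k x) * w x)"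
      by (simp add: sum_distrib_left sum_distrib_right sum.swap[of _ X] mult_ac)
    also have "\<dots> = (\<Sum>x\<in>X. \<Sum>j=0..N. \<Sum>k=j..N. D j x * (a k * m k x) * w x)"
      by (simp only: sum_triangle)
    finally show ?thesis by (simp add: sum_distrib_left sum_distrib_right)
  qed
  have Nf_le: "Nf \<le> p' * nf"
  proof -
    have "Nf \<le> (p' powr p * (\<Sum>x\<in>X. f x powr p * \<mu> x)) powr (1/p)"
      unfolding Nf_def Ff_def using Doob_maximal[of \<mu> f p N] mu f p mu0
      by (intro powr_mono2) (auto simp: conj intro!: sum_nonneg)
    also have "\<dots> = p' * nf" using q p by (simp add: powr_mult powr_powr nf_def)
    finally show ?thesis .
  qed
  have Ng_le: "Ng \<le> q * ng"
  proof -
    have "Ng \<le> (q powr q' * (\<Sum>x\<in>X. g x powr q' * \<nu> x)) powr (1/q')"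
      unfolding Ng_def Gg_def using Doob_maximal[of \<nu> g q' N] nu g q nu0
      by (intro powr_mono2) (auto simp: conj intro!: sum_nonneg)
    also have "\<dots> = q * ng" using q p by (simp add: powr_mult powr_powr ng_def)
    finally show ?thesis .
  qed
  have "(\<Sum>x\<in>X. (\<Sum>k=0..N. a k * mass (\<lambda>y. f y * \<mu> y) k x) * g x * \<nu> x)
      = (\<Sum>k=0..N. a k * (\<Sum>x\<in>X. mass (\<lambda>y. f y * \<mu> y) k x * g x * \<nu> x))"
    by (simp add: sum_distrib_left sum_distrib_right sum.swap[of _ X] mult_ac)
  also have "\<dots> \<le> (\<Sum>k=0..N. a k * ((\<Sum>x\<in>X. H1 k x * mass \<mu> k x * \<nu> x) + (\<Sum>x\<in>X. H2 k x * mass \<nu> k x * \<mu> x)))"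
    by (rule sum_mono[OF mult_left_mono[OF level a]])
  also have "\<dots> = (\<Sum>k=0..N. a k * (\<Sum>x\<in>X. H1 k x * mass \<mu> k x * \<nu> x)) + (\<Sum>k=0..N. a k * (\<Sum>x\<in>X. H2 k x * mass \<nu> k x * \<mu> x))"
    by (simp add: distrib_left sum.distrib)
  also have "\<dots> = (\<Sum>x\<in>X. (\<Sum>j=0..N. increment 0 (\<lambda>j. Gg j x) j * Ff j x * (\<Sum>k=j..N. a k * mass \<mu> k x)) * \<nu> x)
      + (\<Sum>x\<in>X. (\<Sum>j=0..N. increment 0 (\<lambda>j. Ff j x) j * Gg j x * (\<Sum>k=j..N. a k * mass \<nu> k x)) * \<mu> x)"
    unfolding H1_def H2_def rearrange ..
  also have "\<dots> \<le> 4 * W * Nf * Ng + 4 * W' * Ng * Nf"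
  proof (rule add_mono)
    show "(\<Sum>x\<in>X. (\<Sum>j=0..N. increment 0 (\<lambda>j. Gg j x) j * Ff j x * (\<Sum>k=j..N. a k * mass \<mu> k x)) * \<nu> x) \<le> 4 * W * Nf * Ng"
      unfolding Nf_def Ng_def
      by (rule half_form[OF mu nu a F0 Fm adF G0 Gm p W(1) test])
    have p2: "1/q' + 1/q = 1" "1/p' + 1/p = 1" using p by auto
    show "(\<Sum>x\<in>X. (\<Sum>j=0..N. increment 0 (\<lambda>j. Ff j x) j * Gg j x * (\<Sum>k=j..N. a k * mass \<nu> k x)) * \<mu> x) \<le> 4 * W' * Ng * Nf"
      unfolding Nf_def Ng_def
      \<comment> \<open>The adjoint case: the measures change places and the exponents
        \<open>(p, q)\<close> become \<open>(q', p')\<close>.\<close>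
      by (rule half_form[OF nu mu a G0 Gm adG F0 Fm q(3) qp' p2 W(2) test'])
  qed
  also have "\<dots> = 4 * (W + W') * (Nf * Ng)" by (simp add: algebra_simps)
  also have "\<dots> \<le> 4 * (W + W') * ((p' * nf) * (q * ng))"
    using W q Nf_le Ng_le by (intro mult_left_mono mult_mono) (auto simp: nf_def ng_def Ng_def)
  finally show ?thesis by (simp add: nf_def ng_def mult_ac)
qed

text \<open>Duality with the extremal function \<open>T x powr (q - 1)\<close>, followed by division
  by a power of the left side, which is a finite sum.\<close>

lemma strong_type:
  fixes a :: "nat \<Rightarrow> real" and \<mu> \<nu> f :: "'x \<Rightarrow> real" and N :: nat
  defines "T \<equiv> \<lambda>x. \<Sum>k=0..N. a k * mass (\<lambda>y. f y * \<mu> y) k x"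
  assumes mu: "\<And>x. x \<in> X \<Longrightarrow> 0 < \<mu> x" and nu: "\<And>x. x \<in> X \<Longrightarrow> 0 < \<nu> x"
    and a: "\<And>k. 0 \<le> a k" and f: "\<And>x. x \<in> X \<Longrightarrow> 0 \<le> f x"
    and p: "1 < p" "p \<le> q" "1/p + 1/p' = 1" "1/q + 1/q' = 1" and W: "0 \<le> W" "0 \<le> W'"
    and test: "\<And>i z. z \<in> X \<Longrightarrow> i \<le> N \<Longrightarrow>
      (\<Sum>y\<in>cell i z. (\<Sum>k=i..N. a k * mass \<mu> k y) powr q * \<nu> y) \<le> W powr q * mass \<mu> i z powr (q / p)"
    and test': "\<And>i z. z \<in> X \<Longrightarrow> i \<le> N \<Longrightarrow>
      (\<Sum>y\<in>cell i z. (\<Sum>k=i..N. a k * mass \<nu> k y) powr p' * \<mu> y) \<le> W' powr p' * mass \<nu> i z powr (p' / q')"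
  shows "(\<Sum>x\<in>X. T x powr q * \<nu> x)
    \<le> (4 * p' * q * (W + W') * (\<Sum>x\<in>X. f x powr p * \<mu> x) powr (1/p)) powr q"
proof -
  define Y where "Y = (\<Sum>x\<in>X. T x powr q * \<nu> x)"
  define B where "B = 4 * p' * q * (W + W') * (\<Sum>x\<in>X. f x powr p * \<mu> x) powr (1/p)"
  have q: "1 < q" using p by simp
  have p'0: "0 < p'" using p conjugate_exponent_gt_1[of p p'] by simp
  have "1 < q'" using p q conjugate_exponent_gt_1[of q q'] by simp
  then have qq': "(q - 1) * q' = q" using p q by (simp add: field_simps)
  have T0: "0 \<le> T x" for x
    unfolding T_def using a mu f
    by (intro sum_nonneg mult_nonneg_nonneg mass_nonneg) (auto intro: less_imp_le)
  have Y0: "0 \<le> Y" unfolding Y_def using nu by (intro sum_nonneg mult_nonneg_nonneg) (auto intro: less_imp_le)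
  have B0: "0 \<le> B" unfolding B_def using W q p'0 by auto
  have "Y = (\<Sum>x\<in>X. T x * T x powr (q - 1) * \<nu> x)"
    unfolding Y_def using T0 by (simp add: powr_mult_base)
  also have "\<dots> \<le> B * (\<Sum>x\<in>X. (T x powr (q - 1)) powr q' * \<nu> x) powr (1/q')"
    unfolding T_def B_def
    by (rule strong_bilinear[OF mu nu a f _ p W test test']) auto
  also have "\<dots> = B * Y powr (1 - 1/q)"
  proof -
    have "1/q' = 1 - 1/q" using p by simp
    then show ?thesis unfolding powr_powr qq' Y_def by simp
  qed
  finally have YB: "Y \<le> B * Y powr (1 - 1/q)" .
  show ?thesis
  proof (cases "Y = 0")
    case True
    then show ?thesis by (simp add: Y_def)
  next
    case False
    then have Y: "0 < Y" using Y0 by simp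
    have "Y powr (1/q) * Y powr (1 - 1/q) = Y" using Y by (simp flip: powr_add)
    then have "Y powr (1/q) * Y powr (1 - 1/q) \<le> B * Y powr (1 - 1/q)"
      using YB by simp
    then have "Y powr (1/q) \<le> B"
      by (rule mult_right_le_imp_le) (use Y in simp)
    then have "(Y powr (1/q)) powr q \<le> B powr q"
      using q by (intro powr_mono2) auto
    then show ?thesis using Y q by (simp add: powr_powr Y_def B_def)
  qed
qed

end

section \<open>Dyadic grids\<close>

lemma wmeas_mono: "A \<subseteq> B \<Longrightarrow> wmeas w A \<le> wmeas w B"
  unfolding wmeas_def by (intro nn_integral_mono) (auto split: split_indicator)

lemma wmeas_cong_null:
  assumes "A \<subseteq> B" "B - A \<in> null_sets lebesgue"
  shows "wmeas w A = wmeas w B"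
  unfolding wmeas_def
proof (rule nn_integral_cong_AE)
  show "AE x in lebesgue. w x * indicator A x = w x * indicator B x"
    using AE_not_in[OF assms(2)] by eventually_elim (use assms(1) in \<open>auto split: split_indicator\<close>)
qed

lemma wmeas_disjoint_UN:
  assumes w: "w \<in> borel_measurable lebesgue" and fin: "finite I"
    and A: "\<And>i. i \<in> I \<Longrightarrow> A i \<in> sets lebesgue" and disj: "disjoint_family_on A I"
  shows "wmeas w (\<Union>i\<in>I. A i) = (\<Sum>i\<in>I. wmeas w (A i))"
proof -
  have "wmeas w (\<Union>i\<in>I. A i) = (\<integral>\<^sup>+x. (\<Sum>i\<in>I. w x * indicator (A i) x) \<partial>lebesgue)"
    unfolding wmeas_def using fin disj
    by (intro nn_integral_cong) (simp add: indicator_UN_disjoint sum_distrib_left)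
  also have "\<dots> = (\<Sum>i\<in>I. wmeas w (A i))"
    unfolding wmeas_def using w A by (intro nn_integral_sum) auto
  finally show ?thesis .
qed

text \<open>Rounding down commutes with passing to a coarser dyadic scale, so ancestors can be
  computed by integer division of labels.\<close>

lemma nat_floor_div:
  fixes t :: real
  assumes "0 \<le> t"
  shows "nat \<lfloor>t\<rfloor> div 2 ^ k = nat \<lfloor>t / 2 ^ k\<rfloor>"
proof -
  have "\<lfloor>t / real_of_int (2 ^ k)\<rfloor> = \<lfloor>t\<rfloor> div 2 ^ k"
    by (rule floor_divide_real_eq_div) simp
  then have "nat \<lfloor>t / 2 ^ k\<rfloor> = nat (\<lfloor>t\<rfloor> div 2 ^ k)" by simp
  also have "\<dots> = nat \<lfloor>t\<rfloor> div nat (2 ^ k)"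
    using assms by (intro nat_div_distrib) auto
  finally show ?thesis by (simp add: nat_power_eq)
qed

locale dyadic_grid =
  fixes a :: "real ^ 'n" and L :: real and M :: nat
  assumes L_pos: "0 < L"
begin

definition root :: "(real ^ 'n) set" where
  "root = {x. \<forall>j. a $ j \<le> x $ j \<and> x $ j < a $ j + L}"

definition loc :: "real ^ 'n \<Rightarrow> 'n \<Rightarrow> nat" where
  "loc x = (\<lambda>j. nat \<lfloor>(x $ j - a $ j) * 2 ^ M / L\<rfloor>)"

definition leaves :: "('n \<Rightarrow> nat) set" where
  "leaves = {m. \<forall>j. m j < 2 ^ M}"

text \<open>The ancestor is found by dropping \<open>M - i\<close> binary digits. For
  \<open>i \<ge> M\<close> the truncated difference is zero and the label stays \<open>m\<close>, so
  the nesting holds in all generations.\<close>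

definition lab :: "nat \<Rightarrow> ('n \<Rightarrow> nat) \<Rightarrow> 'n \<Rightarrow> nat" where
  "lab i m = (\<lambda>j. m j div 2 ^ (M - i))"

text \<open>
  The cells \<open>gcell i m\<close> are half-open and partition \<open>root\<close>; their closures \<open>gcube i m\<close> belong to \<open>cubes\<close>.
\<close>

definition gcell :: "nat \<Rightarrow> ('n \<Rightarrow> nat) \<Rightarrow> (real ^ 'n) set" where
  "gcell i m = {x \<in> root. lab i (loc x) = lab i m}"

definition corner :: "nat \<Rightarrow> ('n \<Rightarrow> nat) \<Rightarrow> real ^ 'n" where
  "corner i m = (\<chi> j. a $ j + L / 2 ^ i * real (lab i m j))"

definition gcube :: "nat \<Rightarrow> ('n \<Rightarrow> nat) \<Rightarrow> (real ^ 'n) set" where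
  "gcube i m = cbox (corner i m) (corner i m + (\<chi> j. L / 2 ^ i))"

definition vol :: "nat \<Rightarrow> real" where
  "vol i = (L / 2 ^ i) ^ CARD('n)"

lemma finite_leaves: "finite leaves"
proof -
  have "leaves = PiE UNIV (\<lambda>_. {..<2 ^ M})"
    by (auto simp: leaves_def PiE_def Pi_def)
  then show ?thesis by (simp add: finite_PiE)
qed

sublocale finite_filtration leaves lab
proof
  fix i and x y :: "'n \<Rightarrow> nat"
  assume eq: "lab (Suc i) x = lab (Suc i) y"
  show "lab i x = lab i y"
  proof (cases "i < M")
    case True
    then have M: "M - i = Suc (M - Suc i)" by simp
    have "m div 2 ^ (M - i) = m div 2 ^ (M - Suc i) div 2" for m :: nat
      unfolding M power_Suc2 by (rule div_mult2_eq)
    then show ?thesis using eq by (simp add: lab_def fun_eq_iff)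
  next
    case False
    then show ?thesis using eq by (simp add: lab_def)
  qed
qed (rule finite_leaves)

lemma loc_leaves: "x \<in> root \<Longrightarrow> loc x \<in> leaves"
proof -
  assume x: "x \<in> root"
  have "(x $ j - a $ j) * 2 ^ M / L < 2 ^ M" for j
  proof -
    have "x $ j - a $ j < L" using x by (auto simp: root_def algebra_simps)
    then have "(x $ j - a $ j) * 2 ^ M < L * 2 ^ M" by simp
    then show ?thesis using L_pos by (simp add: pos_divide_less_eq mult.commute)
  qed
  then show "loc x \<in> leaves"
    using L_pos x by (auto simp: leaves_def loc_def root_def nat_less_iff floor_less_iff)
qed

lemma lab_loc:
  assumes i: "i \<le> M" and x: "a $ j \<le> x $ j"
  shows "lab i (loc x) j = nat \<lfloor>(x $ j - a $ j) * 2 ^ i / L\<rfloor>"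
proof -
  have "(x $ j - a $ j) * 2 ^ M / L / 2 ^ (M - i) = (x $ j - a $ j) * 2 ^ i / L"
    using i by (simp add: power_diff)
  moreover have "0 \<le> (x $ j - a $ j) * 2 ^ M / L" using x L_pos by simp
  ultimately show ?thesis by (simp add: lab_def loc_def nat_floor_div)
qed

lemma gcell_eq:
  assumes i: "i \<le> M" and m: "m \<in> leaves"
  shows "gcell i m = {x. \<forall>j. corner i m $ j \<le> x $ j \<and> x $ j < corner i m $ j + L / 2 ^ i}"
proof -
  have lab_lt: "lab i m j < 2 ^ i" for j
  proof -
    have "m j < 2 ^ i * 2 ^ (M - i)" using m i by (simp add: leaves_def flip: power_add)
    then show ?thesis by (simp add: lab_def less_mult_imp_div_less)
  qed
  have one: "(a $ j \<le> x $ j \<and> x $ j < a $ j + L \<and> lab i (loc x) j = lab i m j)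
      \<longleftrightarrow> (corner i m $ j \<le> x $ j \<and> x $ j < corner i m $ j + L / 2 ^ i)" for x j
  proof -
    define k where "k = lab i m j"
    define t where "t = (x $ j - a $ j) * 2 ^ i / L"
    define s where "s = L / 2 ^ i"
    have s: "0 < s" "L = s * 2 ^ i" using L_pos by (auto simp: s_def)
    have xt: "x $ j = a $ j + s * t" using L_pos by (simp add: t_def s_def)
    have k: "real k + 1 \<le> 2 ^ i"
      using lab_lt[of j] unfolding k_def by (metis Suc_leI of_nat_Suc of_nat_le_iff of_nat_numeral of_nat_power add.commute)
    have c: "corner i m $ j = a $ j + s * real k" by (simp add: corner_def k_def s_def)
    have 1: "a $ j \<le> x $ j \<longleftrightarrow> 0 \<le> t" using s(1) unfolding xt by (simp add: zero_le_mult_iff)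
    have 2: "x $ j < a $ j + L \<longleftrightarrow> t < 2 ^ i" using s(1) unfolding xt s(2) by simp
    have 3: "corner i m $ j \<le> x $ j \<longleftrightarrow> real k \<le> t" using s(1) unfolding xt c by simp
    have "s * t < s * real k + s \<longleftrightarrow> s * t < s * (real k + 1)" by (simp add: algebra_simps)
    also have "\<dots> \<longleftrightarrow> t < real k + 1" using s(1) by (rule mult_less_cancel_left_pos)
    finally have 4: "x $ j < corner i m $ j + L / 2 ^ i \<longleftrightarrow> t < real k + 1"
      unfolding xt c s_def[symmetric] by (simp add: add.assoc)
    have 5: "lab i (loc x) j = k \<longleftrightarrow> real k \<le> t \<and> t < real k + 1" if "0 \<le> t"
    proof -
      have "lab i (loc x) j = nat \<lfloor>t\<rfloor>" using lab_loc[OF i, of j x] 1 that by (simp add: t_def)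
      moreover have "nat \<lfloor>t\<rfloor> = k \<longleftrightarrow> \<lfloor>t\<rfloor> = int k" using that by auto
      ultimately show ?thesis by (simp add: floor_eq_iff)
    qed
    show ?thesis
      unfolding 1 2 3 4 k_def[symmetric] using 5 k by fastforce
  qed
  show ?thesis
    unfolding gcell_def root_def using one by (auto simp: fun_eq_iff)
qed

lemma gcell_M: "m \<in> leaves \<Longrightarrow> gcell M m = {x \<in> root. loc x = m}"
  by (simp add: gcell_def lab_def)

lemma gcell_UN:
  assumes "i \<le> M"
  shows "gcell i m = (\<Union>m'\<in>cell i m. gcell M m')"
  using loc_leaves by (auto simp: gcell_def lab_def in_cell_iff)

lemma gcube_in_cubes: "gcube i m \<in> cubes"
proof -
  have "0 < L / 2 ^ i" using L_pos by simp
  then show ?thesis unfolding gcube_def cubes_def by blast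
qed

lemma gcell_subset_gcube: "i \<le> M \<Longrightarrow> m \<in> leaves \<Longrightarrow> gcell i m \<subseteq> gcube i m"
  by (auto simp: gcell_eq gcube_def mem_box_cart less_imp_le)

lemma box_subset_gcell:
  "i \<le> M \<Longrightarrow> m \<in> leaves \<Longrightarrow> box (corner i m) (corner i m + (\<chi> j. L / 2 ^ i)) \<subseteq> gcell i m"
  by (auto simp: gcell_eq mem_box_cart less_imp_le)

lemma gcell_sets:
  assumes "i \<le> M" "m \<in> leaves"
  shows "gcell i m \<in> sets lebesgue"
proof -
  have "gcell i m = (\<Inter>j. {x. corner i m $ j \<le> x $ j} \<inter> {x. x $ j < corner i m $ j + L / 2 ^ i})"
    using gcell_eq[OF assms] by auto
  also have "\<dots> \<in> sets borel"
    by (intro sets.finite_INT sets.Int borel_closed borel_open closed_halfspace_component_ge_cart open_halfspace_component_lt_cart) auto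
  finally show ?thesis by (simp add: sets_completionI_sets)
qed

lemma emeasure_gcube: "emeasure lebesgue (gcube i m) = ennreal (vol i)"
proof -
  have "emeasure lborel (gcube i m) = ennreal (\<Prod>b\<in>Basis. ((corner i m + (\<chi> j. L / 2 ^ i)) - corner i m) \<bullet> b)"
    unfolding gcube_def
  proof (rule emeasure_lborel_cbox)
    fix b :: "real ^ 'n" assume "b \<in> Basis"
    then obtain j where "b = axis j 1" by (auto simp: Basis_vec_def)
    then show "corner i m \<bullet> b \<le> (corner i m + (\<chi> j. L / 2 ^ i)) \<bullet> b"
      using L_pos by (simp add: inner_axis inner_add_left)
  qed
  also have "(\<Prod>b\<in>Basis. ((corner i m + (\<chi> j. L / 2 ^ i)) - corner i m) \<bullet> b) = (\<Prod>b\<in>(Basis::(real^'n) set). L / 2 ^ i)"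
    by (intro prod.cong refl) (auto simp: Basis_vec_def inner_axis)
  also have "\<dots> = vol i" by (simp add: vol_def)
  finally show ?thesis by (simp add: gcube_def)
qed

lemma gcell_null: "i \<le> M \<Longrightarrow> m \<in> leaves \<Longrightarrow> gcube i m - gcell i m \<in> null_sets lebesgue"
proof -
  assume im: "i \<le> M" "m \<in> leaves"
  let ?b = "corner i m + (\<chi> j. L / 2 ^ i)"
  have "negligible (cbox (corner i m) ?b - box (corner i m) ?b)"
    by (rule negligible_frontier_interval)
  then have "negligible (gcube i m - gcell i m)"
    by (rule negligible_subset) (use box_subset_gcell[OF im] in \<open>auto simp: gcube_def\<close>)
  then show ?thesis by (simp add: negligible_iff_null_sets)
qed

lemma wmeas_gcell: "i \<le> M \<Longrightarrow> m \<in> leaves \<Longrightarrow> wmeas w (gcell i m) = wmeas w (gcube i m)"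
  by (intro wmeas_cong_null gcell_subset_gcube gcell_null)

lemma wmeas_gcell_sum:
  assumes w: "w \<in> borel_measurable lebesgue" and i: "i \<le> M"
  shows "wmeas w (gcell i m) = (\<Sum>m'\<in>cell i m. wmeas w (gcell M m'))"
  unfolding gcell_UN[OF i]
proof (rule wmeas_disjoint_UN[OF w])
  show "disjoint_family_on (gcell M) (cell i m)"
    unfolding disjoint_family_on_def by (auto simp: gcell_def lab_def)
qed (use gcell_sets[of M] in \<open>auto simp: in_cell_iff\<close>)

lemma vol_pos: "0 < vol i"
  using L_pos by (simp add: vol_def)

lemma vol_Suc: "vol (Suc i) = (1 / 2 ^ CARD('n)) * vol i"
  by (simp add: vol_def power_divide power_mult_distrib)

text \<open>Nesting is read off from labels for the half-open cells and carried over to the cubes,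
  which are the closures of their interiors.\<close>

lemma gcube_subset:
  assumes "i \<le> k" "k \<le> M" "m' \<in> cell i m" "m \<in> leaves"
  shows "gcube k m' \<subseteq> gcube i m"
proof -
  have m': "m' \<in> leaves" using assms by (simp add: in_cell_iff)
  have "gcell k m' \<subseteq> gcell i m"
  proof
    fix x assume x: "x \<in> gcell k m'"
    then have "lab i (loc x) = lab i m'"
      by (intro label_le[OF assms(1)]) (simp add: gcell_def)
    then show "x \<in> gcell i m" using x assms(3) by (simp add: gcell_def in_cell_iff)
  qed
  then have "box (corner k m') (corner k m' + (\<chi> j. L / 2 ^ k)) \<subseteq> gcube i m"
    using box_subset_gcell[of k m'] gcell_subset_gcube[of i m] assms m' by auto
  then have "closure (box (corner k m') (corner k m' + (\<chi> j. L / 2 ^ k))) \<subseteq> gcube i m"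
    by (rule closure_minimal) (simp add: gcube_def closed_cbox)
  moreover have "box (corner k m') (corner k m' + (\<chi> j. L / 2 ^ k)) \<noteq> {}"
    using L_pos by (simp add: interval_ne_empty_cart)
  ultimately show ?thesis by (simp add: gcube_def closure_box)
qed

text \<open>The conversion sends an infinite mass to \<open>0\<close>, so this is the true mass only
  on leaves of finite measure.\<close>

definition leaf_mass :: "(real ^ 'n \<Rightarrow> ennreal) \<Rightarrow> ('n \<Rightarrow> nat) \<Rightarrow> real" where
  "leaf_mass w m = enn2real (wmeas w (gcell M m))"

lemma mass_leaf_mass:
  assumes w: "w \<in> borel_measurable lebesgue" and fin: "\<And>m. m \<in> leaves \<Longrightarrow> wmeas w (gcell M m) < \<infinity>"
    and i: "i \<le> M"
  shows "ennreal (mass (leaf_mass w) i m) = wmeas w (gcell i m)"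
proof -
  have "ennreal (mass (leaf_mass w) i m) = (\<Sum>m'\<in>cell i m. ennreal (leaf_mass w m'))"
    by (subst sum_ennreal) (auto simp: leaf_mass_def)
  also have "\<dots> = (\<Sum>m'\<in>cell i m. wmeas w (gcell M m'))"
    using fin by (intro sum.cong refl) (auto simp: leaf_mass_def in_cell_iff less_top)
  also have "\<dots> = wmeas w (gcell i m)"
    by (rule wmeas_gcell_sum[OF w i, symmetric])
  finally show ?thesis .
qed

lemma wmeas_one: "wmeas (\<lambda>_. 1) (gcube i m) = ennreal (vol i)"
proof -
  have "gcube i m \<in> sets lebesgue" by (simp add: gcube_def)
  then have "wmeas (\<lambda>_. 1) (gcube i m) = emeasure lebesgue (gcube i m)" by (simp add: wmeas_def)
  then show ?thesis by (simp add: emeasure_gcube)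
qed

lemma leaf_mass_one: "m \<in> leaves \<Longrightarrow> leaf_mass (\<lambda>_. 1) m = vol M"
  using vol_pos[of M] by (simp add: leaf_mass_def wmeas_gcell wmeas_one)

lemma mass_vol:
  assumes "i \<le> M" "m \<in> leaves"
  shows "mass (\<lambda>_. vol M) i m = vol i"
proof -
  have "ennreal (mass (leaf_mass (\<lambda>_. 1)) i m) = ennreal (vol i)"
    using mass_leaf_mass[of "\<lambda>_. 1" i m] assms by (simp add: wmeas_gcell wmeas_one)
  moreover have "0 \<le> mass (leaf_mass (\<lambda>_. 1)) i m" by (intro sum_nonneg) (simp add: leaf_mass_def)
  ultimately have "mass (leaf_mass (\<lambda>_. 1)) i m = vol i"
    using vol_pos[of i] ennreal_inj[of "mass (leaf_mass (\<lambda>_. 1)) i m" "vol i"] by simp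
  moreover have "mass (leaf_mass (\<lambda>_. 1)) i m = mass (\<lambda>_. vol M) i m"
    by (intro sum.cong refl leaf_mass_one) (simp add: in_cell_iff)
  ultimately show ?thesis by simp
qed

end

definition cube_finite :: "(real ^ 'n \<Rightarrow> ennreal) \<Rightarrow> bool" where
  "cube_finite w \<longleftrightarrow> w \<in> borel_measurable lebesgue \<and> (\<forall>Q\<in>cubes. 0 < wmeas w Q \<and> wmeas w Q < \<infinity>)"

lemma (in dyadic_grid) mass_leaf_mass_gcube:
  assumes "cube_finite w" "i \<le> M" "m \<in> leaves"
  shows "ennreal (mass (leaf_mass w) i m) = wmeas w (gcube i m)" "mass (leaf_mass w) i m = enn2real (wmeas w (gcube i m))"
proof -
  have "wmeas w (gcell M m) < \<infinity>" if "m \<in> leaves" for m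
    using assms(1) gcube_in_cubes[of M m] that by (simp add: cube_finite_def wmeas_gcell)
  then show *: "ennreal (mass (leaf_mass w) i m) = wmeas w (gcube i m)"
    using mass_leaf_mass[of w i m] assms by (simp add: cube_finite_def wmeas_gcell)
  have "0 \<le> mass (leaf_mass w) i m" by (intro sum_nonneg) (simp add: leaf_mass_def)
  then show "mass (leaf_mass w) i m = enn2real (wmeas w (gcube i m))"
    by (metis * enn2real_ennreal)
qed

lemma (in dyadic_grid) leaf_mass_pos:
  assumes "cube_finite w" "m \<in> leaves"
  shows "0 < leaf_mass w m"
  using assms gcube_in_cubes[of M m] by (auto simp: leaf_mass_def wmeas_gcell cube_finite_def enn2real_positive_iff)

text \<open>The running maximum on a leaf is the average of \<open>w\<close> over some dyadic cube
  that contains the leaf and lies in \<open>Q\<close>. Hence it is at most the maximal function of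
  \<open>w\<close> restricted to \<open>Q\<close> at every point of the leaf, and
  \<open>Ainf_const\<close> bounds the integral of the latter.\<close>

lemma (in dyadic_grid) maximal_sum_le:
  assumes w: "cube_finite w" and K: "Ainf_const w \<le> ennreal K" "0 \<le> K"
    and i: "i \<le> M" and z: "z \<in> leaves"
  shows "(\<Sum>y\<in>cell i z. running_max i (\<lambda>k. mass (leaf_mass w) k y / vol k) M * vol M) \<le> K * mass (leaf_mass w) i z"
proof -
  define rm where "rm y = running_max i (\<lambda>k. mass (leaf_mass w) k y / vol k) M" for y
  define Q where "Q = gcube i z"
  define H where "H = HL_maximal (\<lambda>y. indicator Q y * w y)"
  have rm0: "0 \<le> rm y" for y
  proof -
    have "0 \<le> mass (leaf_mass w) i y / vol i"
      using vol_pos[of i] by (intro divide_nonneg_pos sum_nonneg) (auto simp: leaf_mass_def)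
    also have "\<dots> \<le> rm y"
      unfolding rm_def using i by (intro running_max_ge[of i i M "\<lambda>k. mass (leaf_mass w) k y / vol k"]) auto
    finally show ?thesis .
  qed
  have pointwise: "(\<Sum>y\<in>cell i z. ennreal (rm y) * indicator (gcell M y) x) \<le> H x * indicator Q x" for x
  proof (cases "x \<in> gcell i z")
    case True
    define y where "y = loc x"
    have y: "y \<in> leaves" "y \<in> cell i z" "x \<in> gcell M y"
      using True loc_leaves by (auto simp: y_def gcell_def in_cell_iff lab_def)
    have uniq: "y' = y" if "x \<in> gcell M y'" "y' \<in> leaves" for y'
      using that y by (simp add: gcell_M)
    have "(\<Sum>y'\<in>cell i z. ennreal (rm y') * indicator (gcell M y') x) = (\<Sum>y'\<in>{y}. ennreal (rm y') * indicator (gcell M y') x)"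
    proof (rule sum.mono_neutral_right)
      show "\<forall>y'\<in>cell i z - {y}. ennreal (rm y') * indicator (gcell M y') x = 0"
      proof
        fix y' assume y': "y' \<in> cell i z - {y}"
        then have "x \<notin> gcell M y'" using uniq[of y'] by (force simp: in_cell_iff)
        then show "ennreal (rm y') * indicator (gcell M y') x = 0" by simp
      qed
    qed (use y in auto)
    also have "\<dots> = ennreal (rm y)" using y by simp
    also have "\<dots> \<le> H x"
    proof -
      obtain k where k: "i \<le> k" "k \<le> M" "rm y = mass (leaf_mass w) k y / vol k"
        using running_max_in[OF i, of "\<lambda>k. mass (leaf_mass w) k y / vol k"] by (auto simp: rm_def)
      have sub: "gcube k y \<subseteq> Q"
        unfolding Q_def by (rule gcube_subset[OF k(1,2) y(2) z])
      have "x \<in> gcell k y" using y by (simp add: gcell_def y_def)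
      then have "x \<in> gcube k y" using gcell_subset_gcube[OF k(2) y(1)] by auto
      have "ennreal (rm y) = wmeas w (gcube k y) / ennreal (vol k)"
        using mass_leaf_mass_gcube(1)[OF w k(2) y(1)] vol_pos[of k] k(3)
        by (simp add: divide_ennreal[symmetric] sum_nonneg leaf_mass_def)
      also have "wmeas w (gcube k y) = wmeas (\<lambda>y. indicator Q y * w y) (gcube k y)"
        unfolding wmeas_def using sub by (intro nn_integral_cong) (auto split: split_indicator)
      also have "\<dots> / ennreal (vol k) = avg (\<lambda>y. indicator Q y * w y) (gcube k y)"
        by (simp add: avg_def emeasure_gcube)
      also have "\<dots> \<le> H x"
        unfolding H_def HL_maximal_def using \<open>x \<in> gcube k y\<close> gcube_in_cubes by (intro SUP_upper) auto
      finally show ?thesis .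
    qed
    also have "\<dots> = H x * indicator Q x"
      using True gcell_subset_gcube[OF i z] by (auto simp: Q_def)
    finally show ?thesis .
  next
    case False
    then have "x \<notin> gcell M y" if "y \<in> cell i z" for y
      using gcell_UN[OF i, of z] that by auto
    then show ?thesis by (subst sum.neutral) auto
  qed
  have cl: "gcell M y \<in> sets lebesgue" "emeasure lebesgue (gcell M y) = ennreal (vol M)" if "y \<in> cell i z" for y
  proof -
    have yl: "y \<in> leaves" using that by (simp add: in_cell_iff)
    then show s: "gcell M y \<in> sets lebesgue" by (simp add: gcell_sets)
    have "emeasure lebesgue (gcell M y) = wmeas (\<lambda>_. 1) (gcell M y)" using s by (simp add: wmeas_def)
    then show "emeasure lebesgue (gcell M y) = ennreal (vol M)" using yl by (simp add: wmeas_gcell wmeas_one)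
  qed
  have "ennreal (\<Sum>y\<in>cell i z. rm y * vol M) = (\<Sum>y\<in>cell i z. ennreal (rm y) * ennreal (vol M))"
    using rm0 vol_pos[of M] by (subst sum_ennreal[symmetric]) (auto simp: ennreal_mult)
  also have "\<dots> = (\<Sum>y\<in>cell i z. \<integral>\<^sup>+x. ennreal (rm y) * indicator (gcell M y) x \<partial>lebesgue)"
    using cl by (intro sum.cong refl) (simp add: nn_integral_cmult_indicator)
  also have "\<dots> = (\<integral>\<^sup>+x. (\<Sum>y\<in>cell i z. ennreal (rm y) * indicator (gcell M y) x) \<partial>lebesgue)"
    using cl by (intro nn_integral_sum[symmetric]) auto
  also have "\<dots> \<le> (\<integral>\<^sup>+x\<in>Q. H x \<partial>lebesgue)"
    by (intro nn_integral_mono pointwise)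
  also have "\<dots> \<le> ennreal K * wmeas w Q"
  proof -
    have Q: "Q \<in> cubes" by (simp add: Q_def gcube_in_cubes)
    then have "(\<integral>\<^sup>+x\<in>Q. H x \<partial>lebesgue) / wmeas w Q \<le> Ainf_const w"
      unfolding Ainf_const_def H_def by (intro SUP_upper2[OF Q]) simp
    then have "(\<integral>\<^sup>+x\<in>Q. H x \<partial>lebesgue) / wmeas w Q \<le> ennreal K" using K by simp
    then have "(\<integral>\<^sup>+x\<in>Q. H x \<partial>lebesgue) / wmeas w Q * wmeas w Q \<le> ennreal K * wmeas w Q"
      by (rule mult_right_mono) simp
    moreover have "wmeas w Q \<noteq> 0" "wmeas w Q < top"
      using w Q by (auto simp: cube_finite_def)
    ultimately show ?thesis by (simp add: ennreal_divide_times ennreal_divide_self)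
  qed
  also have "\<dots> = ennreal (K * mass (leaf_mass w) i z)"
    using mass_leaf_mass_gcube(1)[OF w i z] K by (simp add: Q_def ennreal_mult sum_nonneg leaf_mass_def)
  finally show ?thesis
    using K by (subst (asm) ennreal_le_iff) (auto simp: rm_def leaf_mass_def intro!: mult_nonneg_nonneg sum_nonneg)
qed

lemma (in dyadic_grid) grid_testing:
  assumes w1: "cube_finite w1" and w2: "cube_finite w2" and K: "Ainf_const w2 \<le> ennreal K" "0 \<le> K"
    and \<delta>: "0 < \<delta>" and r: "1 < r" and pos: "0 < 1 - \<delta> - 1/r" and A: "0 < A"
    and joint: "\<And>Q. Q \<in> cubes \<Longrightarrow> enn2real (wmeas w2 Q) powr (1 - \<delta> - 1/r) * enn2real (wmeas w1 Q) powr (1/r)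
      \<le> A * enn2real (emeasure lebesgue Q) powr (1 - \<delta>)"
    and z: "z \<in> leaves" and i: "i \<le> M"
  shows "(\<Sum>y\<in>cell i z. (\<Sum>k=i..M. vol k powr (\<delta> - 1) * mass (leaf_mass w2) k y) powr r * leaf_mass w1 y)
    \<le> testing_const (1 / 2 ^ CARD('n)) \<delta> r * A powr r * K * mass (leaf_mass w2) i z powr (1 + r * \<delta>)"
proof -
  interpret two_weight leaves lab "leaf_mass w1" "leaf_mass w2" "\<lambda>_. vol M" vol "1 / 2 ^ CARD('n)" \<delta> r A M
  proof
    fix i x assume x: "x \<in> leaves" and i: "i \<le> M"
    show "mass (leaf_mass w2) i x powr (1 - \<delta> - 1/r) * mass (leaf_mass w1) i x powr (1/r) \<le> A * vol i powr (1 - \<delta>)"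
      using joint[OF gcube_in_cubes[of i x]] vol_pos[of i]
      by (simp add: mass_leaf_mass_gcube(2)[OF w1 i x] mass_leaf_mass_gcube(2)[OF w2 i x] emeasure_gcube)
    show "mass (\<lambda>_. vol M) i x = vol i" using mass_vol[OF i x] .
  qed (use assms leaf_mass_pos vol_pos vol_Suc in auto)
  show ?thesis
    using testing[OF z i maximal_sum_le[OF w2 K i z]] by (simp add: partial_def)
qed

section \<open>Weights on a grid\<close>

lemma epowr_ennreal: "0 \<le> x \<Longrightarrow> 0 < a \<Longrightarrow> ennreal x epowr a = ennreal (x powr a)"
  by (auto simp: epowr_def ennreal_eq_0_iff)

lemma epowr_epowr: "(x epowr a) epowr b = x epowr (a * b)"
  by (cases x rule: ennreal_cases)
    (auto simp: epowr_def ennreal_eq_0_iff powr_powr zero_less_mult_iff mult_less_0_iff)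

lemma epowr_mono: "x \<le> y \<Longrightarrow> 0 < a \<Longrightarrow> x epowr a \<le> y epowr a"
  by (cases x rule: ennreal_cases; cases y rule: ennreal_cases)
    (auto simp: epowr_ennreal powr_mono2 epowr_def top_unique)

lemma epowr_less_mono:
  assumes "x < y" "0 < a"
  shows "x epowr a < y epowr a"
proof (rule ccontr)
  assume "\<not> x epowr a < y epowr a"
  then have "(y epowr a) epowr (1 / a) \<le> (x epowr a) epowr (1 / a)"
    using assms by (intro epowr_mono[of "y epowr a"]) auto
  then have "y epowr 1 \<le> x epowr 1" using assms by (simp add: epowr_epowr)
  moreover have "z epowr 1 = z" for z
    by (cases z rule: ennreal_cases) (auto simp: epowr_def)
  ultimately show False using assms by simp
qed

lemma epowr_one [simp]: "x epowr 1 = x"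
  by (cases x rule: ennreal_cases) (auto simp: epowr_def)

lemma epowr_eq_0_iff: "0 < a \<Longrightarrow> x epowr a = 0 \<longleftrightarrow> x = 0"
  by (cases x rule: ennreal_cases) (auto simp: epowr_def ennreal_eq_0_iff)

lemma epowr_eq_top_iff: "0 < a \<Longrightarrow> x epowr a = \<infinity> \<longleftrightarrow> x = \<infinity>"
  by (cases x rule: ennreal_cases) (auto simp: epowr_def ennreal_eq_0_iff)

lemma measurable_epowr [measurable]:
  assumes f [measurable]: "f \<in> borel_measurable N"
  shows "(\<lambda>x. f x epowr a) \<in> borel_measurable N"
proof -
  have "(\<lambda>x. enn2real (f x) powr a) \<in> borel_measurable N"
    unfolding powr_def using f by measurable
  then have 1: "(\<lambda>x. ennreal (enn2real (f x) powr a)) \<in> borel_measurable N"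
    by (rule measurable_compose[OF _ measurable_ennreal])
  have 2: "Measurable.pred N (\<lambda>x. f x = 0)" "Measurable.pred N (\<lambda>x. f x = \<infinity>)"
    by measurable
  show ?thesis unfolding epowr_def
    by (intro measurable_If borel_measurable_const 1 2[unfolded pred_def]) auto
qed

text \<open>Young's inequality with a free parameter \<open>c\<close> is integrated against
  \<open>w\<close>. The choice \<open>c = 1\<close> shows that the integral of \<open>h\<close> is
  finite, after which \<open>c\<close> can be taken as the average of \<open>\<phi>\<close>.\<close>

lemma Jensen_average:
  fixes w :: "real ^ 'n \<Rightarrow> ennreal" and \<phi> :: "real ^ 'n \<Rightarrow> real" and p :: real
  defines "g \<equiv> \<lambda>x. ennreal (\<phi> x) epowr p * w x" and "h \<equiv> \<lambda>x. ennreal (\<phi> x) * w x"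
  assumes w: "w \<in> borel_measurable lebesgue" and \<phi>: "\<phi> \<in> borel_measurable lebesgue" "\<And>x. 0 \<le> \<phi> x"
    and E: "E \<in> sets lebesgue" and p: "1 < p"
    and fin: "wmeas w E < \<infinity>" "0 < wmeas w E" "wmeas g E < \<infinity>"
  shows "wmeas h E < \<infinity>"
    and "(enn2real (wmeas h E) / enn2real (wmeas w E)) powr p * enn2real (wmeas w E) \<le> enn2real (wmeas g E)"
proof -
  have pp': "1/p + 1/(p/(p-1)) = 1" using p by (simp add: field_simps)
  have young: "\<phi> x * c powr (p - 1) \<le> \<phi> x powr p / p + (p - 1) / p * c powr p" if "0 \<le> c" for c x
    using Young_powr[OF p pp' \<phi>(2), of "c powr (p-1)" x] p by (simp add: powr_powr mult.commute)
  have scaled: "ennreal (p * c powr (p - 1)) * wmeas h E \<le> wmeas g E + ennreal ((p - 1) * c powr p) * wmeas w E"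
    if c: "0 \<le> c" for c
  proof -
    have "ennreal (p * c powr (p - 1)) * wmeas h E = (\<integral>\<^sup>+x\<in>E. ennreal (p * c powr (p - 1)) * h x \<partial>lebesgue)"
      unfolding wmeas_def h_def using w \<phi> E
      by (subst nn_integral_cmult[symmetric]) (auto simp: mult.assoc)
    also have "\<dots> \<le> (\<integral>\<^sup>+x. g x * indicator E x + ennreal ((p - 1) * c powr p) * (w x * indicator E x) \<partial>lebesgue)"
    proof (intro nn_integral_mono)
      fix x
      have "p * c powr (p - 1) * \<phi> x \<le> \<phi> x powr p + (p - 1) * c powr p"
      proof -
        have "p * (\<phi> x * c powr (p - 1)) \<le> p * (\<phi> x powr p / p + (p - 1) / p * c powr p)"
          using young[OF c, of x] p by (intro mult_left_mono) auto
        also have "\<dots> = \<phi> x powr p + (p - 1) * c powr p"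
          using p by (simp add: distrib_left)
        finally show ?thesis by (simp add: mult_ac)
      qed
      then have "ennreal (p * c powr (p - 1)) * ennreal (\<phi> x) \<le> ennreal (\<phi> x) epowr p + ennreal ((p - 1) * c powr p)"
        using p \<phi>(2)[of x] by (simp add: epowr_ennreal ennreal_mult[symmetric] ennreal_plus[symmetric] del: ennreal_plus)
      then have "ennreal (p * c powr (p - 1)) * ennreal (\<phi> x) * w x \<le> (ennreal (\<phi> x) epowr p + ennreal ((p - 1) * c powr p)) * w x"
        by (rule mult_right_mono) simp
      then show "ennreal (p * c powr (p - 1)) * h x * indicator E x
          \<le> g x * indicator E x + ennreal ((p - 1) * c powr p) * (w x * indicator E x)"
        by (auto simp: g_def h_def distrib_right mult.assoc split: split_indicator)
    qed
    also have "\<dots> = wmeas g E + ennreal ((p - 1) * c powr p) * wmeas w E"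
      unfolding wmeas_def g_def using w \<phi> E
      by (subst nn_integral_add) (auto simp: nn_integral_cmult)
    finally show ?thesis .
  qed
  have "ennreal p * wmeas h E \<le> wmeas g E + ennreal (p - 1) * wmeas w E"
    using scaled[of 1] by simp
  also have "\<dots> < \<infinity>" using fin by (simp add: ennreal_mult_less_top)
  finally show hfin: "wmeas h E < \<infinity>"
    using p by (auto simp: ennreal_mult_less_top)
  define W where "W = enn2real (wmeas w E)"
  define H where "H = enn2real (wmeas h E)"
  define G where "G = enn2real (wmeas g E)"
  have W: "0 < W" using fin by (simp add: W_def enn2real_positive_iff)
  have eqs: "wmeas w E = ennreal W" "wmeas h E = ennreal H" "wmeas g E = ennreal G"
    using fin hfin by (simp_all add: W_def H_def G_def)
  have H0: "0 \<le> H" and G0: "0 \<le> G" by (auto simp: H_def G_def)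
  define c where "c = H / W"
  have c: "0 \<le> c" "H = c * W" using W H0 by (auto simp: c_def)
  have "ennreal (p * c powr (p - 1) * H) \<le> ennreal (G + (p - 1) * c powr p * W)"
    using scaled[OF c(1)] W H0 G0 p unfolding eqs by (simp add: ennreal_mult)
  then have "p * c powr (p - 1) * H \<le> G + (p - 1) * c powr p * W"
    using W G0 p by (subst (asm) ennreal_le_iff) auto
  moreover have "c powr (p - 1) * H = c powr p * W"
    using c powr_mult_base[of c "p - 1"] by (simp add: mult_ac)
  then have "p * c powr (p - 1) * H = p * (c powr p * W)" by (simp add: mult.assoc)
  moreover have "(p - 1) * c powr p * W = p * (c powr p * W) - c powr p * W"
    by (simp add: algebra_simps)
  ultimately have "c powr p * W \<le> G" by linarith
  then show "(enn2real (wmeas h E) / enn2real (wmeas w E)) powr p * enn2real (wmeas w E) \<le> enn2real (wmeas g E)"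
    by (simp add: c_def H_def W_def G_def)
qed

text \<open>The condition \<open>p < N / \<alpha>\<close> makes \<open>1 / q\<close> positive. This
  also excludes \<open>q = 0\<close>, where division would give the value zero.\<close>

lemma Sobolev_exponent_gt:
  fixes \<alpha> p q N :: real
  assumes "0 < N" "0 < \<alpha>" "1 < p" "p < N / \<alpha>" and pq: "1 / p - 1 / q = \<alpha> / N"
  shows "p < q"
proof -
  have "\<alpha> / N < 1 / p" "0 < \<alpha> / N" using assms by (auto simp: field_simps)
  moreover have e: "1 / q = 1 / p - \<alpha> / N" using pq by simp
  ultimately have "0 < 1 / q" "1 / q < 1 / p" unfolding e by auto
  then show ?thesis using assms by (simp add: field_simps)
qed

text \<open>\<open>A\<close> stands for the \<open>1/q\<close>-th power of the Muckenhoupt constant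
  of \<open>u\<close>, and \<open>Ku\<close> for its A-infinity constant. Real numbers suffice,
  since an infinite A-infinity constant of \<open>u\<close> makes the theorem trivial.\<close>

locale weight_pair =
  fixes u \<sigma> :: "real ^ 'n \<Rightarrow> ennreal" and \<alpha> p q A Ku :: real
  assumes u: "cube_finite u" and \<sigma>: "cube_finite \<sigma>"
    and alpha: "0 < \<alpha>" "\<alpha> < real CARD('n)" and p: "1 < p" "p < real CARD('n) / \<alpha>"
    and pq: "1 / p - 1 / q = \<alpha> / real CARD('n)" and A: "0 < A"
    and joint: "\<And>Q. Q \<in> cubes \<Longrightarrow> enn2real (wmeas u Q) powr (1/q) * enn2real (wmeas \<sigma> Q) powr (1/conj_exp p)
      \<le> A * enn2real (emeasure lebesgue Q) powr (1 - \<alpha> / real CARD('n))"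
    and Ku: "0 \<le> Ku" "Ainf_const u \<le> ennreal Ku"
begin

definition \<delta> :: real where "\<delta> = \<alpha> / real CARD('n)"
definition p' :: real where "p' = conj_exp p"
definition q' :: real where "q' = conj_exp q"

lemma \<delta>: "0 < \<delta>" "\<delta> < 1"
  using alpha by (auto simp: \<delta>_def)

lemma q: "p < q" "1 < q"
  using Sobolev_exponent_gt[OF _ alpha(1) p pq] p by auto

text \<open>The fifth and sixth identities put the joint condition into the form of
  \<open>two_weight\<close>, once with \<open>r = p'\<close> and once with \<open>r = q\<close> and
  the weights exchanged. The last two match the power of the mass in \<open>testing\<close> with the
  one required by the weak and strong bounds.\<close>

lemma exponents: "1/p + 1/p' = 1" "1/q + 1/q' = 1" "1 < p'" "1 < q'" "1 - \<delta> - 1/p' = 1/q" "1 - \<delta> - 1/q = 1/p'"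
  "1 + p' * \<delta> = p' / q'" "1 + q * \<delta> = q / p"
proof -
  show 1: "1/p + 1/p' = 1" "1/q + 1/q' = 1"
    using p q by (auto simp: p'_def q'_def conj_exp_def field_simps)
  show 2: "1 < p'" "1 < q'"
    using conjugate_exponent_gt_1[OF p(1) 1(1)] conjugate_exponent_gt_1[OF q(2) 1(2)] .
  have d: "\<delta> = 1/p - 1/q" using pq by (simp add: \<delta>_def)
  show "1 - \<delta> - 1/p' = 1/q" "1 - \<delta> - 1/q = 1/p'" using 1 d by auto
  have "1 / q' = 1 / p' + \<delta>" using 1 d by simp
  then have "p' * (1 / q') = p' * (1 / p' + \<delta>)" by simp
  then show "1 + p' * \<delta> = p' / q'" using 2 by (simp add: distrib_left)
  have "q * (1 / p) = q * (1 / q + \<delta>)" using d by simp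
  then show "1 + q * \<delta> = q / p" using q by (simp add: distrib_left)
qed

text \<open>Taking the \<open>p'\<close>-th root leaves \<open>A\<close> linear and puts the
  exponent \<open>1/p'\<close> on \<open>Ku\<close>; in \<open>W\<close> the \<open>q\<close>-th
  root does the same for the constant of \<open>\<sigma>\<close>.\<close>

definition W' :: real where
  "W' = (testing_const (1 / 2 ^ CARD('n)) \<delta> p' * A powr p' * Ku) powr (1 / p')"

definition W :: "real \<Rightarrow> real" where
  "W K = (testing_const (1 / 2 ^ CARD('n)) \<delta> q * A powr q * K) powr (1 / q)"

end

section \<open>Testing conditions and operator bounds on one grid\<close>

locale weighted_grid = weight_pair u \<sigma> \<alpha> p q A Ku + dyadic_grid a L M
  for u \<sigma> :: "real ^ 'n \<Rightarrow> ennreal" and \<alpha> p q A Ku :: real and a :: "real ^ 'n" and L :: real and M :: nat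
begin

lemma W_nonneg: "0 \<le> W'" "0 \<le> W K"
  by (simp_all add: W'_def W_def)

lemma test_u:
  assumes z: "z \<in> leaves" and i: "i \<le> M"
  shows "(\<Sum>y\<in>cell i z. (\<Sum>k=i..M. vol k powr (\<delta> - 1) * mass (leaf_mass u) k y) powr p' * leaf_mass \<sigma> y)
    \<le> W' powr p' * mass (leaf_mass u) i z powr (p' / q')"
proof -
  have C: "0 \<le> testing_const (1 / 2 ^ CARD('n)) \<delta> p'"
    using exponents \<delta> by (intro less_imp_le testing_const_pos) auto
  have "(\<Sum>y\<in>cell i z. (\<Sum>k=i..M. vol k powr (\<delta> - 1) * mass (leaf_mass u) k y) powr p' * leaf_mass \<sigma> y)
    \<le> testing_const (1 / 2 ^ CARD('n)) \<delta> p' * A powr p' * Ku * mass (leaf_mass u) i z powr (1 + p' * \<delta>)"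
  proof (rule grid_testing[OF \<sigma> u])
    show "0 < 1 - \<delta> - 1/p'" unfolding exponents(5) using q by simp
    show "enn2real (wmeas u Q) powr (1 - \<delta> - 1/p') * enn2real (wmeas \<sigma> Q) powr (1/p')
      \<le> A * enn2real (emeasure lebesgue Q) powr (1 - \<delta>)" if "Q \<in> cubes" for Q
      unfolding exponents(5) using joint[OF that] by (simp add: \<delta>_def p'_def)
  qed (use exponents \<delta> A Ku z i in auto)
  also have "\<dots> = W' powr p' * mass (leaf_mass u) i z powr (p' / q')"
    using exponents C Ku by (simp add: W'_def powr_powr)
  finally show ?thesis .
qed

lemma test_\<sigma>:
  assumes K: "0 \<le> K" "Ainf_const \<sigma> \<le> ennreal K" and z: "z \<in> leaves" and i: "i \<le> M"
  shows "(\<Sum>y\<in>cell i z. (\<Sum>k=i..M. vol k powr (\<delta> - 1) * mass (leaf_mass \<sigma>) k y) powr q * leaf_mass u y)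
    \<le> W K powr q * mass (leaf_mass \<sigma>) i z powr (q / p)"
proof -
  have C: "0 \<le> testing_const (1 / 2 ^ CARD('n)) \<delta> q"
    using q \<delta> by (intro less_imp_le testing_const_pos) auto
  have "(\<Sum>y\<in>cell i z. (\<Sum>k=i..M. vol k powr (\<delta> - 1) * mass (leaf_mass \<sigma>) k y) powr q * leaf_mass u y)
    \<le> testing_const (1 / 2 ^ CARD('n)) \<delta> q * A powr q * K * mass (leaf_mass \<sigma>) i z powr (1 + q * \<delta>)"
    using joint exponents \<delta> q A K z i
    by (intro grid_testing[OF u \<sigma>]) (auto simp: mult.commute simp flip: \<delta>_def p'_def)
  also have "\<dots> = W K powr q * mass (leaf_mass \<sigma>) i z powr (q / p)"
    using exponents q C K by (simp add: W_def powr_powr)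
  finally show ?thesis .
qed

definition leaf_sum :: "(real ^ 'n \<Rightarrow> ennreal) \<Rightarrow> ('n \<Rightarrow> nat) \<Rightarrow> real" where
  "leaf_sum h m = (\<Sum>k=0..M. vol k powr (\<delta> - 1) * mass (leaf_mass h) k m)"

definition grid_op :: "(real ^ 'n \<Rightarrow> ennreal) \<Rightarrow> real ^ 'n \<Rightarrow> real" where
  "grid_op h x = (if x \<in> root then leaf_sum h (loc x) else 0)"

lemma leaf_sum_nonneg: "0 \<le> leaf_sum h m"
  unfolding leaf_sum_def by (intro sum_nonneg mult_nonneg_nonneg) (auto simp: leaf_mass_def)

lemma grid_op_nonneg: "0 \<le> grid_op h x"
  by (simp add: grid_op_def leaf_sum_nonneg)

lemma leaf_partition: "root = (\<Union>m\<in>leaves. gcell M m)" "disjoint_family_on (gcell M) leaves"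
  using loc_leaves by (auto simp: gcell_M disjoint_family_on_def)

lemma grid_op_eq_sum: "ennreal (grid_op h x) = (\<Sum>m\<in>leaves. ennreal (leaf_sum h m) * indicator (gcell M m) x)"
proof (cases "x \<in> root")
  case True
  have "(\<Sum>m\<in>leaves. ennreal (leaf_sum h m) * indicator (gcell M m) x) = (\<Sum>m\<in>{loc x}. ennreal (leaf_sum h m) * indicator (gcell M m) x)"
    using True loc_leaves finite_leaves
    by (intro sum.mono_neutral_right) (auto simp: gcell_M split: split_indicator)
  then show ?thesis using True loc_leaves by (simp add: grid_op_def gcell_M)
next
  case False
  then show ?thesis by (subst sum.neutral) (auto simp: grid_op_def gcell_def)
qed

lemma grid_op_measurable: "(\<lambda>x. ennreal (grid_op h x)) \<in> borel_measurable lebesgue"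
  unfolding grid_op_eq_sum using gcell_sets by measurable

context
  fixes \<phi> :: "real ^ 'n \<Rightarrow> real" and I :: real
  assumes \<phi>: "\<phi> \<in> borel_measurable lebesgue" "\<And>x. 0 \<le> \<phi> x"
    and I: "0 \<le> I" "(\<integral>\<^sup>+x. ennreal (\<phi> x) epowr p * \<sigma> x \<partial>lebesgue) = ennreal I"
begin

abbreviation "h \<equiv> \<lambda>x. ennreal (\<phi> x) * \<sigma> x"

text \<open>The average of \<open>\<phi>\<close> over a leaf with respect to
  \<open>\<sigma>\<close>. The grid operator sees only the leaf masses of \<open>h\<close>, so
  \<open>\<phi>\<close> may be replaced by these averages.\<close>

definition leaf_avg :: "('n \<Rightarrow> nat) \<Rightarrow> real" where
  "leaf_avg m = leaf_mass h m / leaf_mass \<sigma> m"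

lemma leaf_avg: "m \<in> leaves \<Longrightarrow> leaf_avg m * leaf_mass \<sigma> m = leaf_mass h m" "0 \<le> leaf_avg m"
proof -
  show "leaf_avg m * leaf_mass \<sigma> m = leaf_mass h m" if "m \<in> leaves"
    using leaf_mass_pos[OF \<sigma> that] by (simp add: leaf_avg_def)
  show "0 \<le> leaf_avg m" unfolding leaf_avg_def by (simp add: leaf_mass_def)
qed

text \<open>Jensen's inequality on every leaf: averaging does not increase the norm.\<close>

lemma leaf_norm: "(\<Sum>m\<in>leaves. leaf_avg m powr p * leaf_mass \<sigma> m) \<le> I"
  and h_finite: "m \<in> leaves \<Longrightarrow> wmeas h (gcell M m) < \<infinity>"
proof -
  define g where "g x = ennreal (\<phi> x) epowr p * \<sigma> x" for x
  have \<sigma>m: "\<sigma> \<in> borel_measurable lebesgue" using \<sigma> by (simp add: cube_finite_def)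
  have gm: "g \<in> borel_measurable lebesgue" unfolding g_def using \<phi> \<sigma>m by measurable
  have g_le: "wmeas g E \<le> ennreal I" for E
  proof -
    have "wmeas g E \<le> wmeas g UNIV" by (rule wmeas_mono) simp
    then show ?thesis using I by (simp add: wmeas_def g_def)
  qed
  have leaf: "wmeas h (gcell M m) < \<infinity> \<and> leaf_avg m powr p * leaf_mass \<sigma> m \<le> enn2real (wmeas g (gcell M m))"
    if m: "m \<in> leaves" for m
  proof -
    have "wmeas \<sigma> (gcell M m) < \<infinity>" "0 < wmeas \<sigma> (gcell M m)"
      using \<sigma> gcube_in_cubes[of M m] m by (auto simp: cube_finite_def wmeas_gcell)
    moreover have "wmeas g (gcell M m) < \<infinity>"
      using g_le[of "gcell M m"] by (simp add: order_le_less_trans)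
    ultimately show ?thesis
      using Jensen_average[OF \<sigma>m \<phi> gcell_sets[of M m] p(1)] m
      unfolding leaf_avg_def leaf_mass_def g_def by simp
  qed
  then show "m \<in> leaves \<Longrightarrow> wmeas h (gcell M m) < \<infinity>" by simp
  have "(\<Sum>m\<in>leaves. leaf_avg m powr p * leaf_mass \<sigma> m) \<le> (\<Sum>m\<in>leaves. enn2real (wmeas g (gcell M m)))"
    using leaf by (intro sum_mono) auto
  also have "\<dots> = enn2real (\<Sum>m\<in>leaves. wmeas g (gcell M m))"
    using order_le_less_trans[OF g_le ennreal_less_top] by (subst enn2real_sum) auto
  also have "(\<Sum>m\<in>leaves. wmeas g (gcell M m)) = wmeas g root"
    unfolding leaf_partition(1) using gcell_sets leaf_partition(2)
    by (intro wmeas_disjoint_UN[symmetric] gm finite_leaves) auto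
  also have "enn2real (wmeas g root) \<le> I"
    using g_le I by (intro enn2real_leI)
  finally show "(\<Sum>m\<in>leaves. leaf_avg m powr p * leaf_mass \<sigma> m) \<le> I" .
qed

lemma leaf_sum_eq: "leaf_sum h m = (\<Sum>k=0..M. vol k powr (\<delta> - 1) * mass (\<lambda>y. leaf_avg y * leaf_mass \<sigma> y) k m)"
  unfolding leaf_sum_def using leaf_avg by (intro sum.cong refl arg_cong2[where f = times]) (auto simp: in_cell_iff)

lemma root_integral:
  assumes "\<And>m. m \<in> leaves \<Longrightarrow> 0 \<le> c m"
  shows "(\<Sum>m\<in>leaves. ennreal (c m) * wmeas u (gcell M m)) = ennreal (\<Sum>m\<in>leaves. c m * leaf_mass u m)"
proof -
  have "ennreal (c m) * wmeas u (gcell M m) = ennreal (c m * leaf_mass u m)" if m: "m \<in> leaves" for m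
  proof -
    have "wmeas u (gcell M m) < \<infinity>" using u gcube_in_cubes[of M m] m by (simp add: cube_finite_def wmeas_gcell)
    then show ?thesis using assms[OF m] by (simp add: leaf_mass_def ennreal_mult)
  qed
  then have "(\<Sum>m\<in>leaves. ennreal (c m) * wmeas u (gcell M m)) = (\<Sum>m\<in>leaves. ennreal (c m * leaf_mass u m))"
    by simp
  also have "\<dots> = ennreal (\<Sum>m\<in>leaves. c m * leaf_mass u m)"
    using assms by (intro sum_ennreal) (auto simp: leaf_mass_def)
  finally show ?thesis .
qed

lemma grid_weak:
  assumes t: "0 < t"
  shows "wmeas u {x. t < grid_op h x} \<le> ennreal (2 * (2 powr (q + 2) * W' * I powr (1/p) / t) powr q)"
proof -
  have um: "u \<in> borel_measurable lebesgue" using u by (simp add: cube_finite_def)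
  let ?m = "{m\<in>leaves. t < leaf_sum h m}"
  have "{x. t < grid_op h x} = (\<Union>m\<in>?m. gcell M m)"
    using t loc_leaves by (auto simp: grid_op_def gcell_M split: if_splits)
  then have "wmeas u {x. t < grid_op h x} = (\<Sum>m\<in>?m. wmeas u (gcell M m))"
    using gcell_sets finite_leaves leaf_partition(2)
    by (simp only:) (intro wmeas_disjoint_UN um, auto intro: disjoint_family_on_mono[rotated])
  also have "\<dots> = (\<Sum>m\<in>leaves. ennreal (if t < leaf_sum h m then 1 else 0) * wmeas u (gcell M m))"
    unfolding sum.inter_filter[OF finite_leaves] by (intro sum.cong refl) auto
  also have "\<dots> = ennreal (\<Sum>m\<in>leaves. (if t < leaf_sum h m then 1 else 0) * leaf_mass u m)"
    by (rule root_integral) auto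
  also have "(\<Sum>m\<in>leaves. (if t < leaf_sum h m then 1 else 0) * leaf_mass u m) = sum (leaf_mass u) ?m"
    unfolding sum.inter_filter[OF finite_leaves] by (intro sum.cong refl) auto
  also have "\<dots> \<le> 2 * (2 powr (q + 2) * W' * I powr (1/p) / t) powr q"
  proof -
    have "t powr q * sum (leaf_mass u) ?m
      \<le> 2 * (2 powr (q + 2) * W' * (\<Sum>x\<in>leaves. leaf_avg x powr p * leaf_mass \<sigma> x) powr (1/p)) powr q"
      unfolding leaf_sum_eq
      using leaf_mass_pos[OF \<sigma>] leaf_mass_pos[OF u] leaf_avg p q exponents W_nonneg test_u t
      by (intro weak_type) auto
    also have "\<dots> \<le> 2 * (2 powr (q + 2) * W' * I powr (1/p)) powr q"
      using p q W_nonneg leaf_norm leaf_mass_pos[OF \<sigma>]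
      by (intro mult_left_mono powr_mono2 mult_nonneg_nonneg sum_nonneg) (auto intro!: mult_nonneg_nonneg intro: less_imp_le)
    finally have "t powr q * sum (leaf_mass u) ?m \<le> 2 * (2 powr (q + 2) * W' * I powr (1/p)) powr q" .
    then show ?thesis
      using t by (simp add: powr_divide pos_le_divide_eq mult.commute)
  qed
  finally show ?thesis by (simp add: ennreal_leI)
qed

lemma grid_strong:
  assumes K: "0 \<le> K" "Ainf_const \<sigma> \<le> ennreal K"
  shows "(\<integral>\<^sup>+x. ennreal (grid_op h x) epowr q * u x \<partial>lebesgue)
    \<le> ennreal ((4 * p' * q * (W K + W') * I powr (1/p)) powr q)"
proof -
  have um: "u \<in> borel_measurable lebesgue" using u by (simp add: cube_finite_def)
  have "ennreal (grid_op h x) epowr q * u x = (\<Sum>m\<in>leaves. ennreal (leaf_sum h m powr q) * (u x * indicator (gcell M m) x))" for x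
  proof (cases "x \<in> root")
    case True
    have "(\<Sum>m\<in>leaves. ennreal (leaf_sum h m powr q) * (u x * indicator (gcell M m) x))
      = (\<Sum>m\<in>{loc x}. ennreal (leaf_sum h m powr q) * (u x * indicator (gcell M m) x))"
      using True loc_leaves finite_leaves
      by (intro sum.mono_neutral_right) (auto simp: gcell_M split: split_indicator)
    then show ?thesis
      using True loc_leaves q leaf_sum_nonneg by (simp add: grid_op_def gcell_M epowr_ennreal)
  next
    case False
    then show ?thesis using q by (subst sum.neutral) (auto simp: grid_op_def gcell_def epowr_def)
  qed
  then have "(\<integral>\<^sup>+x. ennreal (grid_op h x) epowr q * u x \<partial>lebesgue)
      = (\<integral>\<^sup>+x. (\<Sum>m\<in>leaves. ennreal (leaf_sum h m powr q) * (u x * indicator (gcell M m) x)) \<partial>lebesgue)"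
    by simp
  also have "\<dots> = (\<Sum>m\<in>leaves. \<integral>\<^sup>+x. ennreal (leaf_sum h m powr q) * (u x * indicator (gcell M m) x) \<partial>lebesgue)"
    using um gcell_sets by (intro nn_integral_sum) auto
  also have "\<dots> = (\<Sum>m\<in>leaves. ennreal (leaf_sum h m powr q) * wmeas u (gcell M m))"
    unfolding wmeas_def using um gcell_sets by (intro sum.cong refl nn_integral_cmult) auto
  also have "\<dots> = ennreal (\<Sum>m\<in>leaves. leaf_sum h m powr q * leaf_mass u m)"
    by (rule root_integral) auto
  also have "(\<Sum>m\<in>leaves. leaf_sum h m powr q * leaf_mass u m)
      \<le> (4 * p' * q * (W K + W') * (\<Sum>x\<in>leaves. leaf_avg x powr p * leaf_mass \<sigma> x) powr (1/p)) powr q"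
    unfolding leaf_sum_eq
    using leaf_mass_pos[OF \<sigma>] leaf_mass_pos[OF u] leaf_avg p q exponents W_nonneg test_u test_\<sigma>[OF K]
    by (intro strong_type) auto
  also have "\<dots> \<le> (4 * p' * q * (W K + W') * I powr (1/p)) powr q"
    using p q W_nonneg leaf_norm leaf_mass_pos[OF \<sigma>] exponents
    by (intro mult_left_mono powr_mono2 mult_nonneg_nonneg sum_nonneg add_nonneg_nonneg) (auto intro!: mult_nonneg_nonneg intro: less_imp_le)
  finally show ?thesis by (simp add: ennreal_leI)
qed

end

end

section \<open>Domination of the kernel by shifted grids\<close>

text \<open>
  If both grids cut between \<open>t\<close> and \<open>t'\<close>, an integer lies within \<open>1/3\<close> of \<open>2\<^sup>i / 3\<close>, but \<open>3\<close> does not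
  divide \<open>2\<^sup>i\<close>.
\<close>

lemma floor_eq_or_shifted_floor_eq:
  fixes t t' :: real
  assumes "\<bar>t - t'\<bar> < 1/3"
  shows "\<lfloor>t\<rfloor> = \<lfloor>t'\<rfloor> \<or> \<lfloor>t - 2^i/3\<rfloor> = \<lfloor>t' - 2^i/3\<rfloor>"
proof (rule ccontr)
  have sep: "\<exists>k::int. min r r' < of_int k \<and> of_int k \<le> max r r'" if "\<lfloor>r\<rfloor> \<noteq> \<lfloor>r'\<rfloor>" for r r' :: real
    using that
  proof (cases "\<lfloor>r\<rfloor> < \<lfloor>r'\<rfloor>")
    case True
    then show ?thesis by (intro exI[of _ "\<lfloor>r'\<rfloor>"]) (simp add: min_def max_def, linarith)
  next
    case False
    then show ?thesis using that by (intro exI[of _ "\<lfloor>r\<rfloor>"]) (simp add: min_def max_def, linarith)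
  qed
  assume "\<not> ?thesis"
  then obtain k k' :: int where "min t t' < k" "k \<le> max t t'"
    "min (t - 2^i/3) (t' - 2^i/3) < k'" "k' \<le> max (t - 2^i/3) (t' - 2^i/3)"
    using sep[of t t'] sep[of "t - 2^i/3" "t' - 2^i/3"] by auto
  then have "\<bar>of_int k - of_int k' - (2::real)^i/3\<bar> < 1/3" using assms by linarith
  moreover have "\<bar>3 * x - y\<bar> < 1" if "\<bar>x - y / 3\<bar> < 1/3" for x y :: real
    using that by linarith
  ultimately have "\<bar>3 * (of_int k - of_int k') - (2::real)^i\<bar> < 1" by blast
  then have "\<bar>of_int (3 * (k - k') - 2^i)\<bar> < (1::real)" by simp
  then have "3 * (k - k') - 2^i = 0" by linarith
  then have "(3::int) dvd 2^i" by (metis dvd_triv_left eq_iff_diff_eq_0)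
  then have "(3::int) dvd 2"
    using prime_dvd_power[of "3::int" 2 i] by simp
  then show False by simp
qed

lemma powr_sum_le_card:
  fixes z :: "'i \<Rightarrow> real"
  assumes fin: "finite I" "I \<noteq> {}" and nn: "\<And>i. i \<in> I \<Longrightarrow> 0 \<le> z i" and q: "0 \<le> q"
  shows "(\<Sum>i\<in>I. z i) powr q \<le> real (card I) powr q * (\<Sum>i\<in>I. z i powr q)"
proof -
  define Z where "Z = Max (z ` I)"
  have "Z \<in> z ` I" unfolding Z_def using fin by (intro Max_in) auto
  then obtain j where j: "j \<in> I" "Z = z j" by auto
  have "(\<Sum>i\<in>I. z i) \<le> real (card I) * Z"
    using fin by (intro sum_bounded_above) (auto simp: Z_def)
  then have "(\<Sum>i\<in>I. z i) powr q \<le> (real (card I) * Z) powr q"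
    using q nn by (intro powr_mono2 sum_nonneg) auto
  also have "\<dots> = real (card I) powr q * z j powr q" by (simp add: powr_mult j)
  also have "\<dots> \<le> real (card I) powr q * (\<Sum>i\<in>I. z i powr q)"
    using fin j by (intro mult_left_mono member_le_sum) auto
  finally show ?thesis .
qed

lemma wmeas_UN_le:
  assumes w: "w \<in> borel_measurable lebesgue" and fin: "finite I"
    and A: "\<And>i. i \<in> I \<Longrightarrow> A i \<in> sets lebesgue"
  shows "wmeas w (\<Union>i\<in>I. A i) \<le> (\<Sum>i\<in>I. wmeas w (A i))"
proof -
  have "wmeas w (\<Union>i\<in>I. A i) \<le> (\<integral>\<^sup>+x. (\<Sum>i\<in>I. w x * indicator (A i) x) \<partial>lebesgue)"
    unfolding wmeas_def
  proof (intro nn_integral_mono)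
    fix x
    show "w x * indicator (\<Union>i\<in>I. A i) x \<le> (\<Sum>i\<in>I. w x * indicator (A i) x)"
    proof (cases "x \<in> (\<Union>i\<in>I. A i)")
      case True
      then obtain i where i: "i \<in> I" "x \<in> A i" by auto
      then have "w x * indicator (A i) x \<le> (\<Sum>i\<in>I. w x * indicator (A i) x)"
        using fin by (intro member_le_sum) auto
      moreover have "w x * indicator (\<Union>i\<in>I. A i) x = w x * indicator (A i) x"
        using i by (auto simp: indicator_def)
      ultimately show ?thesis by simp
    qed simp
  qed
  also have "\<dots> = (\<Sum>i\<in>I. wmeas w (A i))"
    unfolding wmeas_def using w A by (intro nn_integral_sum) auto
  finally show ?thesis .
qed

text \<open>The roots begin at \<open>- L / 2\<close> or at \<open>- L / 6\<close> in each
  coordinate; with side \<open>L\<close> all of them contain the points of norm below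
  \<open>L / 6\<close>.\<close>

definition shift :: "real \<Rightarrow> ('n \<Rightarrow> bool) \<Rightarrow> real ^ 'n" where
  "shift L s = (\<chi> j. - L / 2 + (if s j then L / 3 else 0))"

text \<open>In each coordinate at least one of the two one-dimensional grids does not separate the
  points, and the shift is chosen coordinate by coordinate.\<close>

lemma common_cell:
  fixes x y :: "real ^ 'n"
  assumes L: "0 < L" and x: "norm x < L / 6" and y: "norm y < L / 6"
    and xy: "norm (x - y) < L / (3 * 2 ^ i)" and i: "i \<le> M"
  shows "\<exists>s. x \<in> dyadic_grid.root (shift L s) L \<and> y \<in> dyadic_grid.gcell (shift L s) L M i (dyadic_grid.loc (shift L s) L M x)"
proof -
  define t where "t z j = (z $ j + L / 2) * 2 ^ i / L" for z :: "real ^ 'n" and j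
  define s where "s j \<longleftrightarrow> \<lfloor>t x j\<rfloor> \<noteq> \<lfloor>t y j\<rfloor>" for j
  interpret G: dyadic_grid "shift L s" L M by unfold_locales (rule L)
  have ts: "(z $ j - shift L s $ j) * 2 ^ i / L = t z j - (if s j then 2 ^ i / 3 else 0)" for z j
    using L by (simp add: shift_def t_def field_simps)
  have comp: "\<bar>z $ j\<bar> < L / 6" if "norm z < L / 6" for z :: "real ^ 'n" and j
    using component_le_norm_cart[of z j] that by linarith
  have in_root: "z \<in> G.root" if "norm z < L / 6" for z
  proof -
    have sh: "shift L s $ j = - L / 2 + (if s j then L / 3 else 0)" for j
      by (simp add: shift_def)
    have "shift L s $ j \<le> z $ j \<and> z $ j < shift L s $ j + L" for j
      using comp[OF that, of j] L unfolding sh by (cases "s j") (auto simp: abs_less_iff)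
    then show ?thesis by (simp add: G.root_def)
  qed
  have "G.lab i (G.loc x) j = G.lab i (G.loc y) j" for j
  proof -
    have "\<bar>x $ j - y $ j\<bar> < L / (3 * 2 ^ i)"
      using component_le_norm_cart[of "x - y" j] xy by simp
    then have "\<bar>x $ j - y $ j\<bar> * (2 ^ i / L) < L / (3 * 2 ^ i) * (2 ^ i / L)"
      using L by (intro mult_strict_right_mono) auto
    moreover have "\<bar>t x j - t y j\<bar> = \<bar>x $ j - y $ j\<bar> * (2 ^ i / L)"
    proof -
      have "t x j - t y j = (x $ j - y $ j) * (2 ^ i / L)"
        by (simp add: t_def diff_divide_distrib[symmetric] algebra_simps)
      then show ?thesis using L by (simp add: abs_mult)
    qed
    ultimately have "\<bar>t x j - t y j\<bar> < 1/3" using L by simp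
    from floor_eq_or_shifted_floor_eq[OF this, of i]
    have "\<lfloor>t x j - (if s j then 2 ^ i / 3 else 0)\<rfloor> = \<lfloor>t y j - (if s j then 2 ^ i / 3 else 0)\<rfloor>"
      by (auto simp: s_def)
    moreover have "shift L s $ j \<le> x $ j" "shift L s $ j \<le> y $ j"
      using in_root[OF x] in_root[OF y] by (auto simp: G.root_def)
    ultimately show ?thesis by (simp add: G.lab_loc[OF i] ts)
  qed
  then have "y \<in> G.gcell i (G.loc x)"
    using in_root[OF y] by (simp add: G.gcell_def fun_eq_iff)
  then show ?thesis using in_root[OF x] by blast
qed

context weight_pair
begin

text \<open>The number \<open>6\<close> bounds the ratio of the side of the chosen common cell to
  the distance of the points, and \<open>2 ^ CARD('n)\<close> counts the grids.\<close>

definition kernel_const :: real where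
  "kernel_const = 6 powr (real CARD('n) - \<alpha>) * 2 ^ CARD('n)"

definition weak_bound :: "real \<Rightarrow> real \<Rightarrow> real" where
  "weak_bound I t = 2 ^ CARD('n) * (2 * (2 powr (q + 2) * W' * I powr (1/p) * kernel_const / t) powr q)"

definition strong_bound :: "real \<Rightarrow> real \<Rightarrow> real" where
  "strong_bound I K = 2 ^ CARD('n) * (kernel_const * (4 * p' * q * (W K + W') * I powr (1/p))) powr q"

text \<open>Bounding the points confines them to all the roots, and bounding their distance from
  below makes \<open>M\<close> generations enough. The bounds for \<open>Z\<close> do not involve
  \<open>L\<close> or \<open>M\<close>, so both truncations can be removed later.\<close>

lemma domination:
  fixes \<phi> :: "real ^ 'n \<Rightarrow> real" and I L :: real and M :: nat
  defines "h \<equiv> \<lambda>x. ennreal (\<phi> x) * \<sigma> x"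
  assumes \<phi>: "\<phi> \<in> borel_measurable lebesgue" "\<And>x. 0 \<le> \<phi> x"
    and I: "0 \<le> I" "(\<integral>\<^sup>+x. ennreal (\<phi> x) epowr p * \<sigma> x \<partial>lebesgue) = ennreal I"
    and L: "0 < L"
  shows "\<exists>Z. Z \<in> borel_measurable lebesgue \<and>
    (\<forall>x. norm x < L / 6 \<longrightarrow>
      (\<integral>\<^sup>+y. h y * ennreal (1 / norm (x - y) powr (real CARD('n) - \<alpha>))
        * indicator {y. norm y < L / 6 \<and> L / (6 * 2 ^ M) \<le> norm (x - y)} y \<partial>lebesgue) \<le> Z x) \<and>
    (\<forall>t>0. wmeas u {x. ennreal t < Z x} \<le> ennreal (weak_bound I t)) \<and>
    (\<forall>K\<ge>0. Ainf_const \<sigma> \<le> ennreal K \<longrightarrow>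
      (\<integral>\<^sup>+x. Z x epowr q * u x \<partial>lebesgue) \<le> ennreal (strong_bound I K))"
proof -
  interpret G: weighted_grid u \<sigma> \<alpha> p q A Ku "shift L s" L M for s
    by unfold_locales (rule L)
  define b where "b = real CARD('n) - \<alpha>"
  define c6 where "c6 = 6 powr b"
  define S where "S = (2::real) ^ CARD('n)"
  define g where "g s x = G.grid_op s h x" for s x
  define Z where "Z x = ennreal (c6 * (\<Sum>s\<in>UNIV. g s x))" for x
  have b: "0 < b" using alpha by (simp add: b_def)
  have c6: "0 < c6" by (simp add: c6_def)
  have S: "0 < S" "real (card (UNIV :: ('n \<Rightarrow> bool) set)) = S"
    by (auto simp: S_def card_fun)
  have kernel_const: "kernel_const = c6 * S" by (simp add: kernel_const_def c6_def b_def S_def)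
  have g0: "0 \<le> g s x" for s x by (simp add: g_def G.grid_op_nonneg)
  have gm: "(\<lambda>x. ennreal (g s x)) \<in> borel_measurable lebesgue" for s
    unfolding g_def by (rule G.grid_op_measurable)
  have um: "u \<in> borel_measurable lebesgue" using u by (simp add: cube_finite_def)
  have \<sigma>m: "\<sigma> \<in> borel_measurable lebesgue" using \<sigma> by (simp add: cube_finite_def)
  have hm: "h \<in> borel_measurable lebesgue" unfolding h_def using \<phi> \<sigma>m by measurable
  have Z_eq: "Z x = ennreal c6 * (\<Sum>s\<in>UNIV. ennreal (g s x))" for x
    unfolding Z_def using c6 g0 by (simp add: ennreal_mult sum_nonneg)
  have Zm: "Z \<in> borel_measurable lebesgue"
    unfolding Z_eq[abs_def] using gm by measurable
  have dom: "(\<integral>\<^sup>+y. h y * ennreal (1 / norm (x - y) powr b)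
        * indicator {y. norm y < L / 6 \<and> L / (6 * 2 ^ M) \<le> norm (x - y)} y \<partial>lebesgue) \<le> Z x"
    if x: "norm x < L / 6" for x
  proof -
    define k where "k s i y = (if x \<in> G.root s then ennreal (G.vol i powr (\<delta> - 1)) * indicator (G.gcell s i (G.loc s x)) y else 0)"
      for s i y
    have pointwise: "ennreal (1 / norm (x - y) powr b) * indicator {y. norm y < L / 6 \<and> L / (6 * 2 ^ M) \<le> norm (x - y)} y
      \<le> ennreal c6 * (\<Sum>s\<in>UNIV. \<Sum>i=0..M. k s i y)" for y
    proof (cases "norm y < L / 6 \<and> L / (6 * 2 ^ M) \<le> norm (x - y)")
      case True
      define P where "P i \<longleftrightarrow> norm (x - y) < L / (3 * 2 ^ i)" for i :: nat
      have P0: "P 0" using norm_triangle_ineq4[of x y] x True by (simp add: P_def)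
      \<comment> \<open>The finest usable scale. Either the next scale fails, or
        \<open>i = M\<close> and the truncation applies; in both cases the side
        \<open>L / 2 ^ i\<close> is at most six times the distance.\<close>
      define i where "i = (GREATEST i. P i \<and> i \<le> M)"
      have Pi: "P i \<and> i \<le> M"
        unfolding i_def by (rule GreatestI_nat[of _ 0 M]) (use P0 in auto)
      have low: "L / (6 * 2 ^ i) \<le> norm (x - y)"
      proof (cases "i = M")
        case False
        have "\<not> P (Suc i)"
        proof
          assume "P (Suc i)"
          then have "Suc i \<le> i"
            unfolding i_def using False Pi by (intro Greatest_le_nat[of _ _ M]) (auto simp: i_def)
          then show False by simp
        qed
        then show ?thesis by (simp add: P_def)
      qed (use True in simp)
      have sc: "0 < L / 2 ^ i" using L by simp
      have volb: "G.vol i powr (\<delta> - 1) = 1 / (L / 2 ^ i) powr b"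
      proof -
        have "real CARD('n) * (\<delta> - 1) = - b" using alpha by (simp add: \<delta>_def b_def right_diff_distrib)
        then show ?thesis
          using sc by (simp add: G.vol_def powr_realpow[symmetric] powr_powr powr_minus_divide)
      qed
      have "(L / 2 ^ i) powr b \<le> (6 * norm (x - y)) powr b"
      proof (intro powr_mono2)
        show "L / 2 ^ i \<le> 6 * norm (x - y)" using low by (simp add: field_simps)
      qed (use sc b in auto)
      also have "\<dots> = c6 * norm (x - y) powr b" by (simp add: powr_mult c6_def)
      finally have le: "(L / 2 ^ i) powr b \<le> c6 * norm (x - y) powr b" .
      have "1 / norm (x - y) powr b \<le> c6 * G.vol i powr (\<delta> - 1)"
      proof -
        have "0 < (L / 2 ^ i) powr b" using L by simp
        moreover have "0 < norm (x - y) powr b"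
        proof -
          have "0 < L / (6 * 2 ^ i)" using L by simp
          then have "0 < norm (x - y)" using low by linarith
          then show ?thesis by simp
        qed
        ultimately show ?thesis unfolding volb using le by (simp add: divide_simps)
      qed
      then have "ennreal (1 / norm (x - y) powr b) \<le> ennreal c6 * ennreal (G.vol i powr (\<delta> - 1))"
        using c6 by (simp add: ennreal_mult[symmetric] ennreal_leI)
      also have "\<dots> \<le> ennreal c6 * (\<Sum>s\<in>UNIV. \<Sum>i=0..M. k s i y)"
      proof (rule mult_left_mono)
        obtain s where s: "x \<in> G.root s" "y \<in> G.gcell s i (G.loc s x)"
          using common_cell[OF L x, of y i M] True Pi by (auto simp: P_def)
        have "ennreal (G.vol i powr (\<delta> - 1)) = k s i y" using s by (simp add: k_def)
        also have "\<dots> \<le> (\<Sum>i=0..M. k s i y)" using Pi by (intro member_le_sum) auto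
        also have "\<dots> \<le> (\<Sum>s\<in>UNIV. \<Sum>i=0..M. k s i y)"
          by (intro member_le_sum[of s UNIV "\<lambda>s. \<Sum>i=0..M. k s i y"]) auto
        finally show "ennreal (G.vol i powr (\<delta> - 1)) \<le> (\<Sum>s\<in>UNIV. \<Sum>i=0..M. k s i y)" .
      qed simp
      finally show ?thesis using True by simp
    qed simp
    have cell_int: "(\<integral>\<^sup>+y. h y * k s i y \<partial>lebesgue) = ennreal (if x \<in> G.root s then G.vol i powr (\<delta> - 1) * G.mass (G.leaf_mass s h) i (G.loc s x) else 0)"
      and km: "(\<lambda>y. k s i y) \<in> borel_measurable lebesgue" if i: "i \<in> {0..M}" for s i
    proof -
      have set: "G.gcell s i (G.loc s x) \<in> sets lebesgue" if "x \<in> G.root s"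
        using i that by (intro G.gcell_sets G.loc_leaves) auto
      show km: "(\<lambda>y. k s i y) \<in> borel_measurable lebesgue"
        unfolding k_def using set by (cases "x \<in> G.root s") auto
      show "(\<integral>\<^sup>+y. h y * k s i y \<partial>lebesgue) = ennreal (if x \<in> G.root s then G.vol i powr (\<delta> - 1) * G.mass (G.leaf_mass s h) i (G.loc s x) else 0)"
      proof (cases "x \<in> G.root s")
        case True
        have "(\<integral>\<^sup>+y. h y * k s i y \<partial>lebesgue) = (\<integral>\<^sup>+y. ennreal (G.vol i powr (\<delta> - 1)) * (h y * indicator (G.gcell s i (G.loc s x)) y) \<partial>lebesgue)"
          using True by (intro nn_integral_cong) (simp add: k_def mult_ac)
        also have "\<dots> = ennreal (G.vol i powr (\<delta> - 1)) * wmeas h (G.gcell s i (G.loc s x))"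
          unfolding wmeas_def using hm set[OF True] by (intro nn_integral_cmult) auto
        also have "wmeas h (G.gcell s i (G.loc s x)) = ennreal (G.mass (G.leaf_mass s h) i (G.loc s x))"
          using G.h_finite[OF \<phi> I] i unfolding h_def by (intro G.mass_leaf_mass[symmetric]) (use hm in \<open>auto simp: h_def\<close>)
        finally show ?thesis using True by (simp add: ennreal_mult sum_nonneg G.leaf_mass_def)
      qed (simp add: k_def)
    qed
    have "(\<integral>\<^sup>+y. h y * ennreal (1 / norm (x - y) powr b)
        * indicator {y. norm y < L / 6 \<and> L / (6 * 2 ^ M) \<le> norm (x - y)} y \<partial>lebesgue)
      \<le> (\<integral>\<^sup>+y. h y * (ennreal c6 * (\<Sum>s\<in>UNIV. \<Sum>i=0..M. k s i y)) \<partial>lebesgue)"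
      unfolding mult.assoc by (intro nn_integral_mono mult_left_mono pointwise) simp
    also have "\<dots> = (\<integral>\<^sup>+y. ennreal c6 * (\<Sum>s\<in>UNIV. \<Sum>i=0..M. h y * k s i y) \<partial>lebesgue)"
      by (intro nn_integral_cong) (simp add: sum_distrib_left mult_ac)
    also have "\<dots> = ennreal c6 * (\<integral>\<^sup>+y. (\<Sum>s\<in>UNIV. \<Sum>i=0..M. h y * k s i y) \<partial>lebesgue)"
      using hm km by (intro nn_integral_cmult borel_measurable_sum borel_measurable_times_ennreal) auto
    also have "(\<integral>\<^sup>+y. (\<Sum>s\<in>UNIV. \<Sum>i=0..M. h y * k s i y) \<partial>lebesgue)
      = (\<Sum>s\<in>UNIV. \<integral>\<^sup>+y. (\<Sum>i=0..M. h y * k s i y) \<partial>lebesgue)"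
      using hm km by (intro nn_integral_sum borel_measurable_sum borel_measurable_times_ennreal) auto
    also have "\<dots> = (\<Sum>s\<in>UNIV. \<Sum>i=0..M. \<integral>\<^sup>+y. h y * k s i y \<partial>lebesgue)"
      using hm km by (intro sum.cong refl nn_integral_sum borel_measurable_times_ennreal) auto
    also have "\<dots> = (\<Sum>s\<in>UNIV. ennreal (g s x))"
    proof (rule sum.cong[OF refl])
      fix s
      have "(\<Sum>i=0..M. \<integral>\<^sup>+y. h y * k s i y \<partial>lebesgue)
        = (\<Sum>i=0..M. ennreal (if x \<in> G.root s then G.vol i powr (\<delta> - 1) * G.mass (G.leaf_mass s h) i (G.loc s x) else 0))"
        using cell_int by (intro sum.cong) auto
      also have "\<dots> = ennreal (\<Sum>i=0..M. if x \<in> G.root s then G.vol i powr (\<delta> - 1) * G.mass (G.leaf_mass s h) i (G.loc s x) else 0)"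
        by (intro sum_ennreal) (auto simp: G.leaf_mass_def intro!: mult_nonneg_nonneg sum_nonneg)
      also have "\<dots> = ennreal (g s x)" by (simp add: g_def G.grid_op_def G.leaf_sum_def)
      finally show "(\<Sum>i=0..M. \<integral>\<^sup>+y. h y * k s i y \<partial>lebesgue) = ennreal (g s x)" .
    qed
    finally show ?thesis by (simp add: Z_eq)
  qed
  have weak: "wmeas u {x. ennreal t < Z x} \<le> ennreal (S * (2 * (2 powr (q + 2) * W' * I powr (1/p) * kernel_const / t) powr q))"
    if t: "0 < t" for t
  proof -
    have cKp: "0 < kernel_const" unfolding kernel_const using c6 S by simp
    have "{x. ennreal t < Z x} \<subseteq> (\<Union>s\<in>UNIV. {x. t / kernel_const < g s x})"
    proof
      fix x assume "x \<in> {x. ennreal t < Z x}"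
      then have lt: "t < c6 * (\<Sum>s\<in>UNIV. g s x)"
        using t by (simp add: Z_def ennreal_less_iff)
      \<comment> \<open>Pigeonhole over the grids: \<open>kernel_const\<close> contains their
        number.\<close>
      have "\<exists>s. t / kernel_const < g s x"
      proof (rule ccontr)
        assume "\<not> (\<exists>s. t / kernel_const < g s x)"
        then have "(\<Sum>s\<in>UNIV. g s x) \<le> real (card (UNIV :: ('n \<Rightarrow> bool) set)) * (t / kernel_const)"
          by (intro sum_bounded_above) (auto simp: not_less)
        then have "c6 * (\<Sum>s\<in>UNIV. g s x) \<le> c6 * (S * (t / kernel_const))"
          using c6 unfolding S(2) by (intro mult_left_mono) auto
        also have "\<dots> = t" using c6 S by (simp add: kernel_const)
        finally show False using lt by simp
      qed
      then show "x \<in> (\<Union>s\<in>UNIV. {x. t / kernel_const < g s x})" by simp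
    qed
    then have "wmeas u {x. ennreal t < Z x} \<le> wmeas u (\<Union>s\<in>UNIV. {x. t / kernel_const < g s x})"
      by (rule wmeas_mono)
    also have "\<dots> \<le> (\<Sum>s\<in>UNIV. wmeas u {x. t / kernel_const < g s x})"
    proof (intro wmeas_UN_le um)
      fix s
      have "{x. t / kernel_const < g s x} = {x \<in> space lebesgue. ennreal (t / kernel_const) < ennreal (g s x)}"
        using t cKp by (auto simp: ennreal_less_iff)
      also have "\<dots> \<in> sets lebesgue" using gm by measurable
      finally show "{x. t / kernel_const < g s x} \<in> sets lebesgue" .
    qed simp
    also have "\<dots> \<le> (\<Sum>s\<in>(UNIV :: ('n \<Rightarrow> bool) set). ennreal (2 * (2 powr (q + 2) * W' * I powr (1/p) * kernel_const / t) powr q))"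
    proof (intro sum_mono)
      fix s
      show "wmeas u {x. t / kernel_const < g s x} \<le> ennreal (2 * (2 powr (q + 2) * W' * I powr (1/p) * kernel_const / t) powr q)"
        using G.grid_weak[OF \<phi> I, of "t / kernel_const" s] t cKp unfolding g_def h_def by simp
    qed
    also have "\<dots> = ennreal (S * (2 * (2 powr (q + 2) * W' * I powr (1/p) * kernel_const / t) powr q))"
      using S by (simp add: ennreal_mult ennreal_of_nat_eq_real_of_nat)
    finally show ?thesis .
  qed
  have strong: "(\<integral>\<^sup>+x. Z x epowr q * u x \<partial>lebesgue) \<le> ennreal (S * (kernel_const * (4 * p' * q * (W K + W') * I powr (1/p))) powr q)"
    if K: "0 \<le> K" "Ainf_const \<sigma> \<le> ennreal K" for K
  proof -
    let ?B = "4 * p' * q * (W K + W') * I powr (1/p)"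
    have B0: "0 \<le> ?B" using G.W_nonneg exponents q by simp
    have cKp: "0 < kernel_const" unfolding kernel_const using c6 S by simp
    have "Z x epowr q \<le> ennreal (kernel_const powr q) * (\<Sum>s\<in>UNIV. ennreal (g s x) epowr q)" for x
    proof -
      have "Z x epowr q = ennreal ((c6 * (\<Sum>s\<in>UNIV. g s x)) powr q)"
        unfolding Z_def using c6 g0 q by (intro epowr_ennreal mult_nonneg_nonneg sum_nonneg) auto
      also have "(c6 * (\<Sum>s\<in>UNIV. g s x)) powr q = c6 powr q * (\<Sum>s\<in>UNIV. g s x) powr q"
        by (rule powr_mult)
      also have "\<dots> \<le> c6 powr q * (S powr q * (\<Sum>s\<in>UNIV. g s x powr q))"
        using powr_sum_le_card[of "UNIV :: ('n \<Rightarrow> bool) set" "\<lambda>s. g s x" q] g0 q S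
        by (intro mult_left_mono) auto
      also have "\<dots> = kernel_const powr q * (\<Sum>s\<in>UNIV. g s x powr q)"
        by (simp add: kernel_const powr_mult)
      finally have "Z x epowr q \<le> ennreal (kernel_const powr q * (\<Sum>s\<in>UNIV. g s x powr q))"
        by (simp add: ennreal_leI)
      also have "\<dots> = ennreal (kernel_const powr q) * (\<Sum>s\<in>UNIV. ennreal (g s x) epowr q)"
        using g0 q by (simp add: ennreal_mult sum_nonneg epowr_ennreal)
      finally show ?thesis .
    qed
    then have "(\<integral>\<^sup>+x. Z x epowr q * u x \<partial>lebesgue) \<le> (\<integral>\<^sup>+x. ennreal (kernel_const powr q) * (\<Sum>s\<in>UNIV. ennreal (g s x) epowr q) * u x \<partial>lebesgue)"
      by (intro nn_integral_mono mult_right_mono) auto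
    also have "\<dots> = (\<integral>\<^sup>+x. ennreal (kernel_const powr q) * (\<Sum>s\<in>UNIV. ennreal (g s x) epowr q * u x) \<partial>lebesgue)"
      by (simp add: sum_distrib_right mult.assoc)
    also have "\<dots> = ennreal (kernel_const powr q) * (\<integral>\<^sup>+x. (\<Sum>s\<in>UNIV. ennreal (g s x) epowr q * u x) \<partial>lebesgue)"
      using gm um by (intro nn_integral_cmult borel_measurable_sum borel_measurable_times_ennreal measurable_epowr) auto
    also have "(\<integral>\<^sup>+x. (\<Sum>s\<in>UNIV. ennreal (g s x) epowr q * u x) \<partial>lebesgue) = (\<Sum>s\<in>UNIV. \<integral>\<^sup>+x. ennreal (g s x) epowr q * u x \<partial>lebesgue)"
      using gm um by (intro nn_integral_sum borel_measurable_times_ennreal measurable_epowr) auto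
    also have "ennreal (kernel_const powr q) * (\<Sum>s\<in>UNIV. \<integral>\<^sup>+x. ennreal (g s x) epowr q * u x \<partial>lebesgue)
      \<le> ennreal (kernel_const powr q) * (\<Sum>s\<in>(UNIV :: ('n \<Rightarrow> bool) set). ennreal (?B powr q))"
      using G.grid_strong[OF \<phi> I K] unfolding g_def h_def by (intro mult_left_mono sum_mono) auto
    also have "\<dots> = ennreal (kernel_const powr q) * (ennreal S * ennreal (?B powr q))"
      using S by (simp add: ennreal_of_nat_eq_real_of_nat)
    also have "\<dots> = ennreal (S * (kernel_const * ?B) powr q)"
      using S by (simp add: ennreal_mult[symmetric] powr_mult mult_ac)
    finally show ?thesis .
  qed
  show ?thesis
    using Zm dom weak strong unfolding b_def S_def weak_bound_def strong_bound_def
    by (intro exI[of _ Z]) blast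
qed

end

section \<open>Bounds for the Riesz potential\<close>

lemma Liminf_le_const:
  fixes f :: "nat \<Rightarrow> ennreal"
  assumes "\<And>n. f n \<le> C"
  shows "liminf f \<le> C"
proof -
  have "liminf f \<le> liminf (\<lambda>n::nat. C)"
    using assms by (intro Liminf_mono always_eventually) auto
  then show ?thesis by (simp add: Liminf_const)
qed

lemma epowr_liminf_le:
  fixes f :: "nat \<Rightarrow> ennreal"
  assumes q: "0 < q"
  shows "liminf f epowr q \<le> liminf (\<lambda>n. f n epowr q)"
  unfolding le_Liminf_iff
proof (intro allI impI)
  fix y assume y: "y < liminf f epowr q"
  then have "y epowr (1/q) < (liminf f epowr q) epowr (1/q)"
    using q by (intro epowr_less_mono) auto
  then have "y epowr (1/q) < liminf f" using q by (simp add: epowr_epowr)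
  then have "eventually (\<lambda>n. y epowr (1/q) < f n) sequentially"
    by (rule less_LiminfD)
  then show "eventually (\<lambda>n. y < f n epowr q) sequentially"
  proof eventually_elim
    case (elim n)
    then have "(y epowr (1/q)) epowr q < f n epowr q" using q by (intro epowr_less_mono)
    then show ?case using q by (simp add: epowr_epowr)
  qed
qed

lemma riesz_kernel_measurable:
  fixes f :: "real ^ 'n \<Rightarrow> complex"
  assumes "f \<in> borel_measurable lebesgue" "\<sigma> \<in> borel_measurable lebesgue"
  shows "riesz_kernel \<alpha> (wmult f \<sigma>) x \<in> borel_measurable lebesgue"
proof -
  have "(\<lambda>y. norm (x - y)) \<in> borel_measurable borel"
    by (intro borel_measurable_continuous_onI continuous_intros)
  then have "(\<lambda>y. norm (x - y) powr (real CARD('n) - \<alpha>)) \<in> borel_measurable borel"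
    unfolding powr_def by measurable
  then have "(\<lambda>y. norm (x - y) powr (real CARD('n) - \<alpha>)) \<in> borel_measurable lebesgue"
    by (simp add: measurable_completion)
  then show ?thesis
    unfolding riesz_kernel_def[abs_def] wmult_def using assms by measurable
qed

context weight_pair
begin

text \<open>The truncated potentials increase to \<open>J\<close> and each has a majorant with the
  same bounds. The majorants come from unrelated grids, so their \<open>liminf\<close> is used, and
  Fatou's lemma keeps both bounds.\<close>

lemma potential_majorant:
  fixes \<phi> :: "real ^ 'n \<Rightarrow> real" and I :: real
  defines "J \<equiv> \<lambda>x. \<integral>\<^sup>+y. ennreal (\<phi> y) * \<sigma> y * ennreal (1 / norm (x - y) powr (real CARD('n) - \<alpha>)) \<partial>lebesgue"
  assumes \<phi>: "\<phi> \<in> borel_measurable lebesgue" "\<And>x. 0 \<le> \<phi> x"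
    and I: "0 \<le> I" "(\<integral>\<^sup>+x. ennreal (\<phi> x) epowr p * \<sigma> x \<partial>lebesgue) = ennreal I"
  obtains Z where "Z \<in> borel_measurable lebesgue" "\<And>x. J x \<le> Z x"
    "\<And>t. 0 < t \<Longrightarrow> wmeas u {x. ennreal t < Z x}
      \<le> ennreal (weak_bound I t)"
    "\<And>K. 0 \<le> K \<Longrightarrow> Ainf_const \<sigma> \<le> ennreal K \<Longrightarrow>
      (\<integral>\<^sup>+x. Z x epowr q * u x \<partial>lebesgue)
        \<le> ennreal (strong_bound I K)"
proof -
  define b where "b = real CARD('n) - \<alpha>"
  define h where "h x = ennreal (\<phi> x) * \<sigma> x" for x
  define D where "D N x = {y :: real ^ 'n. norm y < 2 ^ N \<and> 1 / 2 ^ N \<le> norm (x - y)}" for N :: nat and x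
  define F where "F N x y = h y * ennreal (1 / norm (x - y) powr b) * indicator (D N x) y" for N x y
  have um: "u \<in> borel_measurable lebesgue" using u by (simp add: cube_finite_def)
  have hm: "h \<in> borel_measurable lebesgue"
    unfolding h_def using \<phi> \<sigma> by (auto simp: cube_finite_def)
  have D_meas: "D N x \<in> sets lebesgue" for N x
  proof -
    have "D N x = {y. norm y < 2 ^ N} \<inter> {y. 1 / 2 ^ N \<le> norm (x - y)}" by (auto simp: D_def)
    moreover have "open {y :: real ^ 'n. norm y < 2 ^ N}"
      by (intro open_Collect_less continuous_intros)
    moreover have "closed {y. 1 / 2 ^ N \<le> norm (x - y)}"
      by (intro closed_Collect_le continuous_intros)
    ultimately have "D N x \<in> sets borel" by (simp add: borel_open borel_closed sets.Int)
    then show ?thesis by (simp add: sets_completionI_sets)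
  qed
  have km: "(\<lambda>y. ennreal (1 / norm (x - y) powr b)) \<in> borel_measurable lebesgue" for x
  proof -
    have "(\<lambda>y. norm (x - y)) \<in> borel_measurable borel"
      by (intro borel_measurable_continuous_onI continuous_intros)
    then have "(\<lambda>y. ennreal (1 / norm (x - y) powr b)) \<in> borel_measurable borel"
      unfolding powr_def by measurable
    then show ?thesis by (simp add: measurable_completion)
  qed
  have Fm: "F N x \<in> borel_measurable lebesgue" for N x
    unfolding F_def by (intro borel_measurable_times_ennreal hm km borel_measurable_indicator D_meas)
  have "\<exists>Z. Z \<in> borel_measurable lebesgue \<and>
    (\<forall>x. norm x < 2 ^ N \<longrightarrow> (\<integral>\<^sup>+y. F N x y \<partial>lebesgue) \<le> Z x) \<and>
    (\<forall>t>0. wmeas u {x. ennreal t < Z x} \<le> ennreal (weak_bound I t)) \<and>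
    (\<forall>K\<ge>0. Ainf_const \<sigma> \<le> ennreal K \<longrightarrow>
      (\<integral>\<^sup>+x. Z x epowr q * u x \<partial>lebesgue) \<le> ennreal (strong_bound I K))" for N
  proof -
    \<comment> \<open>With \<open>L = 6 * 2 ^ N\<close> and depth \<open>2 * N\<close>, the
      truncation is at radius \<open>2 ^ N\<close> and at distance \<open>1 / 2 ^ N\<close>, so the
      truncated regions exhaust all points \<open>y \<noteq> x\<close>.\<close>
    have "(0::real) < 6 * 2 ^ N" by simp
    have "(6::real) * 2 ^ N / 6 = 2 ^ N" "(6::real) * 2 ^ N / (6 * 2 ^ (2 * N)) = 1 / 2 ^ N"
      by (simp_all add: mult_2 power_add)
    then show ?thesis
      using domination[OF \<phi> I \<open>0 < 6 * 2 ^ N\<close>, of "2 * N"] unfolding F_def D_def h_def b_def by simp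
  qed
  then have "\<exists>Z. \<forall>N. Z N \<in> borel_measurable lebesgue \<and>
    (\<forall>x. norm x < 2 ^ N \<longrightarrow> (\<integral>\<^sup>+y. F N x y \<partial>lebesgue) \<le> Z N x) \<and>
    (\<forall>t>0. wmeas u {x. ennreal t < Z N x} \<le> ennreal (weak_bound I t)) \<and>
    (\<forall>K\<ge>0. Ainf_const \<sigma> \<le> ennreal K \<longrightarrow>
      (\<integral>\<^sup>+x. Z N x epowr q * u x \<partial>lebesgue) \<le> ennreal (strong_bound I K))"
    by (intro choice) blast
  then obtain Z where Z: "\<And>N. Z N \<in> borel_measurable lebesgue"
    "\<And>N x. norm x < 2 ^ N \<Longrightarrow> (\<integral>\<^sup>+y. F N x y \<partial>lebesgue) \<le> Z N x"
    "\<And>N t. 0 < t \<Longrightarrow> wmeas u {x. ennreal t < Z N x} \<le> ennreal (weak_bound I t)"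
    "\<And>N K. 0 \<le> K \<Longrightarrow> Ainf_const \<sigma> \<le> ennreal K \<Longrightarrow>
      (\<integral>\<^sup>+x. Z N x epowr q * u x \<partial>lebesgue) \<le> ennreal (strong_bound I K)"
    by blast
  define Zl where "Zl x = liminf (\<lambda>N. Z N x)" for x
  have Zlm: "Zl \<in> borel_measurable lebesgue" unfolding Zl_def using Z(1) by measurable
  have J_le: "J x \<le> Zl x" for x
  proof -
    have D_inc: "D N x \<subseteq> D N' x" if "N \<le> N'" for N N'
    proof -
      have 1: "(2::real) ^ N \<le> 2 ^ N'" using that by (simp add: power_increasing)
      then have 2: "1 / (2::real) ^ N' \<le> 1 / 2 ^ N" by (simp add: frac_le)
      show ?thesis
        unfolding D_def by (auto intro: less_le_trans[OF _ 1] order_trans[OF 2])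
    qed
    have inc: "incseq (\<lambda>N. F N x)"
    proof (intro monoI le_funI)
      fix N N' y assume "N \<le> (N' :: nat)"
      then show "F N x y \<le> F N' x y"
        unfolding F_def using D_inc[of N N'] by (intro mult_left_mono) (auto split: split_indicator)
    qed
    have sup: "(SUP N. F N x y) = h y * ennreal (1 / norm (x - y) powr b)" for y
    \<comment> \<open>On the diagonal both sides vanish by the values \<open>0 powr b = 0\<close>
      and \<open>1 / 0 = 0\<close>.\<close>
    proof (cases "y = x")
      case True
      then show ?thesis by (simp add: F_def)
    next
      case False
      obtain N1 where N1: "norm y < 2 ^ N1" using real_arch_pow[of 2 "norm y"] by auto
      obtain N2 where N2: "1 / norm (x - y) < 2 ^ N2" using real_arch_pow[of 2 "1 / norm (x - y)"] by auto
      define N where "N = max N1 N2"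
      have "norm y < 2 ^ N"
        by (rule less_le_trans[OF N1]) (simp add: N_def)
      moreover have "1 / norm (x - y) < 2 ^ N"
        by (rule less_le_trans[OF N2]) (simp add: N_def)
      then have "1 / 2 ^ N \<le> norm (x - y)" using False by (simp add: field_simps)
      ultimately have "y \<in> D N x" by (simp add: D_def)
      then have "F N x y = h y * ennreal (1 / norm (x - y) powr b)" by (simp add: F_def)
      moreover have "F N' x y \<le> h y * ennreal (1 / norm (x - y) powr b)" for N'
        by (simp add: F_def split: split_indicator)
      ultimately show ?thesis by (intro antisym SUP_least) (auto intro: SUP_upper2[of N])
    qed
    have "J x = (\<integral>\<^sup>+y. (SUP N. F N x y) \<partial>lebesgue)"
      unfolding J_def sup by (simp add: h_def b_def)
    also have "\<dots> = (SUP N. \<integral>\<^sup>+y. F N x y \<partial>lebesgue)"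
      using inc Fm by (intro nn_integral_monotone_convergence_SUP)
    also have "\<dots> = liminf (\<lambda>N. \<integral>\<^sup>+y. F N x y \<partial>lebesgue)"
    proof -
      have "incseq (\<lambda>N. \<integral>\<^sup>+y. F N x y \<partial>lebesgue)"
        using inc by (intro monoI nn_integral_mono) (auto dest: monoD le_funD)
      then show ?thesis
        by (intro lim_imp_Liminf[symmetric] LIMSEQ_SUP) auto
    qed
    also have "\<dots> \<le> Zl x"
      unfolding Zl_def
    proof (rule Liminf_mono)
      obtain N0 where N0: "norm x < 2 ^ N0" using real_arch_pow[of 2 "norm x"] by auto
      show "\<forall>\<^sub>F N in sequentially. (\<integral>\<^sup>+y. F N x y \<partial>lebesgue) \<le> Z N x"
        using eventually_ge_at_top[of N0]
      proof eventually_elim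
        case (elim N)
        then have "norm x < 2 ^ N" by (intro less_le_trans[OF N0]) simp
        then show ?case by (rule Z(2))
      qed
    qed
    finally show ?thesis .
  qed
  have weak: "wmeas u {x. ennreal t < Zl x} \<le> ennreal (weak_bound I t)"
    if t: "0 < t" for t
  proof -
    define G where "G N x = u x * indicator {x. ennreal t < Z N x} x" for N x
    have Gset: "{x. ennreal t < Z N x} \<in> sets lebesgue" for N
    proof -
      have "{x \<in> space lebesgue. ennreal t < Z N x} \<in> sets lebesgue" using Z(1)[of N] by measurable
      then show ?thesis by simp
    qed
    have "wmeas u {x. ennreal t < Zl x} \<le> (\<integral>\<^sup>+x. liminf (\<lambda>N. G N x) \<partial>lebesgue)"
      unfolding wmeas_def
    proof (intro nn_integral_mono)
      fix x
      show "u x * indicator {x. ennreal t < Zl x} x \<le> liminf (\<lambda>N. G N x)"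
      proof (cases "ennreal t < Zl x")
        case True
        then have "\<forall>\<^sub>F N in sequentially. ennreal t < Z N x"
          unfolding Zl_def by (rule less_LiminfD)
        then have "\<forall>\<^sub>F N in sequentially. u x \<le> G N x"
          by eventually_elim (simp add: G_def)
        then have "liminf (\<lambda>N::nat. u x) \<le> liminf (\<lambda>N. G N x)" by (rule Liminf_mono)
        then show ?thesis using True by (simp add: Liminf_const)
      qed simp
    qed
    also have "\<dots> \<le> liminf (\<lambda>N. \<integral>\<^sup>+x. G N x \<partial>lebesgue)"
      unfolding G_def using um Gset by (intro nn_integral_liminf) auto
    also have "\<dots> \<le> ennreal (weak_bound I t)"
      using Z(3)[OF t] by (intro Liminf_le_const) (simp add: G_def wmeas_def)
    finally show ?thesis .
  qed
  have strong: "(\<integral>\<^sup>+x. Zl x epowr q * u x \<partial>lebesgue) \<le> ennreal (strong_bound I K)"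
    if K: "0 \<le> K" "Ainf_const \<sigma> \<le> ennreal K" for K
  proof -
    have "(\<integral>\<^sup>+x. Zl x epowr q * u x \<partial>lebesgue) \<le> (\<integral>\<^sup>+x. liminf (\<lambda>N. Z N x epowr q * u x) \<partial>lebesgue)"
    proof (intro nn_integral_mono)
      fix x
      have "Zl x epowr q * u x \<le> liminf (\<lambda>N. Z N x epowr q) * u x"
        unfolding Zl_def using q by (intro mult_right_mono epowr_liminf_le) auto
      also have "\<dots> \<le> liminf (\<lambda>N. Z N x epowr q * u x)"
        unfolding le_Liminf_iff
      proof (intro allI impI)
        fix y assume y: "y < liminf (\<lambda>N. Z N x epowr q) * u x"
        have "liminf (\<lambda>N. Z N x epowr q) = (SUP n. INF m\<in>{n..}. Z m x epowr q)"
          by (rule liminf_SUP_INF)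
        then have "y < (SUP n. (INF m\<in>{n..}. Z m x epowr q) * u x)"
          using y by (simp add: SUP_mult_right_ennreal)
        then obtain n where n: "y < (INF m\<in>{n..}. Z m x epowr q) * u x"
          by (auto simp: less_SUP_iff)
        show "\<forall>\<^sub>F N in sequentially. y < Z N x epowr q * u x"
          using eventually_ge_at_top[of n]
        proof eventually_elim
          case (elim N)
          then have "(INF m\<in>{n..}. Z m x epowr q) * u x \<le> Z N x epowr q * u x"
            by (intro mult_right_mono INF_lower) auto
          then show ?case using n by simp
        qed
      qed
      finally show "Zl x epowr q * u x \<le> liminf (\<lambda>N. Z N x epowr q * u x)" .
    qed
    also have "\<dots> \<le> liminf (\<lambda>N. \<integral>\<^sup>+x. Z N x epowr q * u x \<partial>lebesgue)"
      using um Z(1) by (intro nn_integral_liminf borel_measurable_times_ennreal measurable_epowr) auto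
    also have "\<dots> \<le> ennreal (strong_bound I K)"
      using Z(4)[OF K] by (intro Liminf_le_const)
    finally show ?thesis .
  qed
  show ?thesis by (rule that[OF Zlm J_le weak strong])
qed

definition C_weak :: real where
  "C_weak = (2 * 2 ^ CARD('n)) powr (1/q) * 2 powr (q + 2) * kernel_const * testing_const (1 / 2 ^ CARD('n)) \<delta> p' powr (1/p')"

definition C_strong :: real where
  "C_strong = (2 ^ CARD('n)) powr (1/q) * kernel_const * (4 * p' * q)
    * (testing_const (1 / 2 ^ CARD('n)) \<delta> p' powr (1/p') + testing_const (1 / 2 ^ CARD('n)) \<delta> q powr (1/q))"

lemma W'_eq: "W' = testing_const (1 / 2 ^ CARD('n)) \<delta> p' powr (1/p') * A * Ku powr (1/p')"
  using exponents A by (simp add: W'_def powr_mult powr_powr)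

lemma W_eq: "W K = testing_const (1 / 2 ^ CARD('n)) \<delta> q powr (1/q) * A * K powr (1/q)"
  using q A by (simp add: W_def powr_mult powr_powr)

lemma kernel_const_pos: "0 < kernel_const"
  by (simp add: kernel_const_def)

text \<open>Both norm bounds pass from the majorant to the potential. Absolute convergence comes
  from the weak bound: letting the level grow shows that the set where the majorant is infinite has
  \<open>u\<close>-measure zero, and \<open>u\<close> is positive almost everywhere.\<close>

lemma riesz_bounds:
  fixes f :: "real ^ 'n \<Rightarrow> complex"
  assumes f: "f \<in> Lp_space p \<sigma>" and upos: "AE x in lebesgue. 0 < u x"
  shows "AE x in lebesgue. integrable lebesgue (riesz_kernel \<alpha> (wmult f \<sigma>) x)"
    and "weak_Lp_norm q u (riesz_potential \<alpha> (wmult f \<sigma>)) \<le> ennreal (C_weak * A * Ku powr (1/p')) * Lp_norm p \<sigma> f"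
    and "\<And>K. 0 \<le> K \<Longrightarrow> Ainf_const \<sigma> \<le> ennreal K \<Longrightarrow>
      Lp_norm q u (riesz_potential \<alpha> (wmult f \<sigma>)) \<le> ennreal (C_strong * A * (Ku powr (1/p') + K powr (1/q))) * Lp_norm p \<sigma> f"
proof -
  define \<phi> where "\<phi> x = norm (f x)" for x
  define b where "b = real CARD('n) - \<alpha>"
  have fm: "f \<in> borel_measurable lebesgue" using f by (simp add: Lp_space_def)
  have \<sigma>m: "\<sigma> \<in> borel_measurable lebesgue" using \<sigma> by (simp add: cube_finite_def)
  have um: "u \<in> borel_measurable lebesgue" using u by (simp add: cube_finite_def)
  have \<phi>: "\<phi> \<in> borel_measurable lebesgue" "0 \<le> \<phi> x" for x
    unfolding \<phi>_def using fm by auto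
  define E where "E = (\<integral>\<^sup>+x. ennreal (\<phi> x) epowr p * \<sigma> x \<partial>lebesgue)"
  have "E epowr (1/p) < \<infinity>" using f by (simp add: Lp_space_def Lp_norm_def E_def \<phi>_def)
  then have "E \<noteq> \<infinity>" using p epowr_eq_top_iff[of "1/p" E] by auto
  then obtain I where I: "0 \<le> I" "E = ennreal I" by (cases E rule: ennreal_cases) auto
  have norm_f: "Lp_norm p \<sigma> f = ennreal (I powr (1/p))"
    using I p by (simp add: Lp_norm_def E_def \<phi>_def epowr_ennreal)
  define J where "J x = (\<integral>\<^sup>+y. ennreal (\<phi> y) * \<sigma> y * ennreal (1 / norm (x - y) powr b) \<partial>lebesgue)" for x
  obtain Z where Z: "Z \<in> borel_measurable lebesgue" "\<And>x. J x \<le> Z x"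
    "\<And>t. 0 < t \<Longrightarrow> wmeas u {x. ennreal t < Z x}
      \<le> ennreal (weak_bound I t)"
    "\<And>K. 0 \<le> K \<Longrightarrow> Ainf_const \<sigma> \<le> ennreal K \<Longrightarrow>
      (\<integral>\<^sup>+x. Z x epowr q * u x \<partial>lebesgue)
        \<le> ennreal (strong_bound I K)"
    by (rule potential_majorant[OF \<phi> I(1) I(2)[unfolded E_def]])
      (rule that; simp add: J_def b_def)
  have kernel_m: "riesz_kernel \<alpha> (wmult f \<sigma>) x \<in> borel_measurable lebesgue" for x
    using fm \<sigma>m by (rule riesz_kernel_measurable)
  have kernel_norm: "(\<integral>\<^sup>+y. ennreal (norm (riesz_kernel \<alpha> (wmult f \<sigma>) x y)) \<partial>lebesgue) \<le> J x" for x
    unfolding J_def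
  proof (intro nn_integral_mono)
    fix y
    have "ennreal (norm (riesz_kernel \<alpha> (wmult f \<sigma>) x y)) = ennreal (\<phi> y) * ennreal (enn2real (\<sigma> y)) * ennreal (1 / norm (x - y) powr b)"
      by (simp add: riesz_kernel_def wmult_def norm_divide norm_mult \<phi>_def b_def flip: ennreal_mult)
    also have "\<dots> \<le> ennreal (\<phi> y) * \<sigma> y * ennreal (1 / norm (x - y) powr b)"
      by (intro mult_right_mono mult_left_mono) (auto simp: ennreal_enn2real_if)
    finally show "ennreal (norm (riesz_kernel \<alpha> (wmult f \<sigma>) x y)) \<le> ennreal (\<phi> y) * \<sigma> y * ennreal (1 / norm (x - y) powr b)" .
  qed
  have pot: "ennreal (norm (riesz_potential \<alpha> (wmult f \<sigma>) x)) \<le> Z x" for x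
  proof (cases "integrable lebesgue (riesz_kernel \<alpha> (wmult f \<sigma>) x)")
    case True
    then have "ennreal (norm (riesz_potential \<alpha> (wmult f \<sigma>) x)) \<le> (\<integral>\<^sup>+y. ennreal (norm (riesz_kernel \<alpha> (wmult f \<sigma>) x y)) \<partial>lebesgue)"
      unfolding riesz_potential_def by (rule integral_norm_bound_ennreal)
    then show ?thesis using kernel_norm[of x] Z(2)[of x] by (meson order_trans)
  next
    \<comment> \<open>A Bochner integral that does not exist has the value \<open>0\<close>, so the
      bound is trivial here.\<close>
    case False
    then show ?thesis by (simp add: riesz_potential_def not_integrable_integral_eq)
  qed
  have W'0: "0 \<le> W'" by (simp add: W'_def)
  define B where "B = 2 powr (q + 2) * W' * I powr (1/p) * kernel_const"
  have B0: "0 \<le> B" unfolding B_def using W'0 kernel_const_pos by simp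
  define S where "S = (2::real) ^ CARD('n)"
  have S: "0 < S" by (simp add: S_def)
  have weak: "wmeas u {x. ennreal t < Z x} \<le> ennreal (S * (2 * (B / t) powr q))" if "0 < t" for t
    using Z(3)[OF that] by (simp add: weak_bound_def B_def S_def)
  have "AE x in lebesgue. Z x \<noteq> \<infinity>"
  proof -
    have set: "{x. Z x = \<infinity>} \<in> sets lebesgue"
    proof -
      have "{x \<in> space lebesgue. Z x = \<infinity>} \<in> sets lebesgue" using Z(1) by measurable
      then show ?thesis by simp
    qed
    have le: "wmeas u {x. Z x = \<infinity>} \<le> ennreal (S * (2 * (B / t) powr q))" if "0 < t" for t
    proof -
      have "wmeas u {x. Z x = \<infinity>} \<le> wmeas u {x. ennreal t < Z x}"
        by (rule wmeas_mono) auto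
      then show ?thesis using weak[OF that] by (rule order_trans)
    qed
    have "wmeas u {x. Z x = \<infinity>} \<le> 0"
    proof (rule ennreal_le_epsilon)
      fix e :: real assume e: "0 < e"
      \<comment> \<open>Chosen to make \<open>S * (2 * (B / t) powr q) \<le> e\<close>; the summand
        \<open>1\<close> keeps \<open>t\<close> positive when \<open>B = 0\<close>.\<close>
      define t where "t = (B + 1) / (e / (2 * S)) powr (1/q)"
      have pos: "0 < (e / (2 * S)) powr (1/q)" using e S by simp
      have t: "0 < t" unfolding t_def using B0 pos by simp
      have "B / t \<le> (e / (2 * S)) powr (1/q)"
      proof -
        have "B / t = B / (B + 1) * (e / (2 * S)) powr (1/q)" by (simp add: t_def)
        also have "\<dots> \<le> 1 * (e / (2 * S)) powr (1/q)"
          using B0 by (intro mult_right_mono) auto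
        finally show ?thesis by simp
      qed
      then have "(B / t) powr q \<le> ((e / (2 * S)) powr (1/q)) powr q"
        using q B0 t by (intro powr_mono2) auto
      also have "\<dots> = e / (2 * S)" using q e S by (simp add: powr_powr)
      finally have "S * (2 * (B / t) powr q) \<le> e" using S by (simp add: field_simps)
      then have "ennreal (S * (2 * (B / t) powr q)) \<le> ennreal e" by (rule ennreal_leI)
      then show "wmeas u {x. Z x = \<infinity>} \<le> 0 + ennreal e" using le[OF t] by simp
    qed
    then have "(\<integral>\<^sup>+x. u x * indicator {x. Z x = \<infinity>} x \<partial>lebesgue) = 0" by (simp add: wmeas_def)
    then have "AE x in lebesgue. u x * indicator {x. Z x = \<infinity>} x = 0"
      using um set by (subst (asm) nn_integral_0_iff_AE) auto
    with upos show ?thesis by eventually_elim (auto split: split_indicator)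
  qed
  then show "AE x in lebesgue. integrable lebesgue (riesz_kernel \<alpha> (wmult f \<sigma>) x)"
  proof eventually_elim
    case (elim x)
    then have "(\<integral>\<^sup>+y. ennreal (norm (riesz_kernel \<alpha> (wmult f \<sigma>) x y)) \<partial>lebesgue) < \<infinity>"
      using kernel_norm[of x] Z(2)[of x] by (metis infinity_ennreal_def order_le_less_trans top.not_eq_extremum)
    then show ?case using kernel_m by (intro integrableI_bounded)
  qed
  show "weak_Lp_norm q u (riesz_potential \<alpha> (wmult f \<sigma>)) \<le> ennreal (C_weak * A * Ku powr (1/p')) * Lp_norm p \<sigma> f"
    unfolding weak_Lp_norm_def
  proof (rule SUP_least)
    fix t :: real assume "t \<in> {0<..}"
    then have t: "0 < t" by simp
    have "{x. t < norm (riesz_potential \<alpha> (wmult f \<sigma>) x)} \<subseteq> {x. ennreal t < Z x}"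
    proof
      fix x assume "x \<in> {x. t < norm (riesz_potential \<alpha> (wmult f \<sigma>) x)}"
      then have "ennreal t < ennreal (norm (riesz_potential \<alpha> (wmult f \<sigma>) x))"
        using t by (simp add: ennreal_less_iff)
      then show "x \<in> {x. ennreal t < Z x}" using pot[of x] by simp
    qed
    then have "wmeas u {x. t < norm (riesz_potential \<alpha> (wmult f \<sigma>) x)} \<le> ennreal (S * (2 * (B / t) powr q))"
      using wmeas_mono weak[OF t] order_trans by blast
    then have "wmeas u {x. t < norm (riesz_potential \<alpha> (wmult f \<sigma>) x)} epowr (1/q) \<le> ennreal (S * (2 * (B / t) powr q)) epowr (1/q)"
      using q by (intro epowr_mono) auto
    also have "\<dots> = ennreal ((S * (2 * (B / t) powr q)) powr (1/q))"
      using q S by (intro epowr_ennreal) auto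
    also have "(S * (2 * (B / t) powr q)) powr (1/q) = (2 * S) powr (1/q) * (B / t)"
      using q B0 t by (simp add: powr_mult powr_powr)
    finally have "ennreal t * wmeas u {x. t < norm (riesz_potential \<alpha> (wmult f \<sigma>) x)} epowr (1/q)
        \<le> ennreal t * ennreal ((2 * S) powr (1/q) * (B / t))"
      by (intro mult_left_mono) auto
    also have "\<dots> = ennreal ((2 * S) powr (1/q) * B)"
      using t B0 by (simp flip: ennreal_mult)
    also have "(2 * S) powr (1/q) * B = C_weak * A * Ku powr (1/p') * I powr (1/p)"
      by (simp add: B_def C_weak_def W'_eq S_def)
    also have "ennreal \<dots> = ennreal (C_weak * A * Ku powr (1/p')) * Lp_norm p \<sigma> f"
      using kernel_const_pos A unfolding norm_f by (intro ennreal_mult) (auto simp: C_weak_def)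
    finally show "ennreal t * wmeas u {x. t < norm (riesz_potential \<alpha> (wmult f \<sigma>) x)} epowr (1/q)
      \<le> ennreal (C_weak * A * Ku powr (1/p')) * Lp_norm p \<sigma> f" .
  qed
  show "Lp_norm q u (riesz_potential \<alpha> (wmult f \<sigma>)) \<le> ennreal (C_strong * A * (Ku powr (1/p') + K powr (1/q))) * Lp_norm p \<sigma> f"
    if K: "0 \<le> K" "Ainf_const \<sigma> \<le> ennreal K" for K
  proof -
    let ?D = "kernel_const * (4 * p' * q * (W K + W') * I powr (1/p))"
    let ?c1 = "testing_const (1 / 2 ^ CARD('n)) \<delta> p' powr (1/p')"
    let ?c2 = "testing_const (1 / 2 ^ CARD('n)) \<delta> q powr (1/q)"
    have D0: "0 \<le> ?D" using kernel_const_pos exponents q W'0 by (simp add: W_def)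
    have "Lp_norm q u (riesz_potential \<alpha> (wmult f \<sigma>)) \<le> (\<integral>\<^sup>+x. Z x epowr q * u x \<partial>lebesgue) epowr (1/q)"
      unfolding Lp_norm_def using q pot by (intro epowr_mono nn_integral_mono mult_right_mono) auto
    also have "\<dots> \<le> ennreal (S * ?D powr q) epowr (1/q)"
      using Z(4)[OF K] q by (intro epowr_mono) (auto simp: strong_bound_def S_def)
    also have "\<dots> = ennreal ((S * ?D powr q) powr (1/q))"
      using q S by (intro epowr_ennreal) auto
    also have "(S * ?D powr q) powr (1/q) = S powr (1/q) * ?D"
      using q D0 unfolding powr_mult[of S] powr_powr by simp
    also have "S powr (1/q) * ?D \<le> C_strong * A * (Ku powr (1/p') + K powr (1/q)) * I powr (1/p)"
    proof -
      have "W K + W' \<le> (?c1 + ?c2) * A * (Ku powr (1/p') + K powr (1/q))"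
        unfolding W_eq W'_eq using A by (simp add: algebra_simps)
      then have "S powr (1/q) * (kernel_const * (4 * p' * q * (W K + W') * I powr (1/p)))
        \<le> S powr (1/q) * (kernel_const * (4 * p' * q * ((?c1 + ?c2) * A * (Ku powr (1/p') + K powr (1/q))) * I powr (1/p)))"
        using kernel_const_pos exponents q by (intro mult_left_mono mult_right_mono) auto
      also have "\<dots> = C_strong * A * (Ku powr (1/p') + K powr (1/q)) * I powr (1/p)"
        by (simp add: C_strong_def S_def)
      finally show ?thesis .
    qed
    finally have "Lp_norm q u (riesz_potential \<alpha> (wmult f \<sigma>)) \<le> ennreal (C_strong * A * (Ku powr (1/p') + K powr (1/q)) * I powr (1/p))"
      by (simp add: ennreal_leI)
    also have "\<dots> = ennreal (C_strong * A * (Ku powr (1/p') + K powr (1/q))) * Lp_norm p \<sigma> f"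
      using kernel_const_pos exponents q A unfolding norm_f by (intro ennreal_mult) (auto simp: C_strong_def)
    finally show ?thesis .
  qed
qed

end

section \<open>Weights in A(p, q)\<close>

text \<open>A cube is the top cube of a grid of depth zero, whose volume is already
  computed.\<close>

lemma cube_measure:
  fixes Q :: "(real ^ 'n) set"
  assumes "Q \<in> cubes"
  obtains v where "0 < v" "emeasure lebesgue Q = ennreal v" "Q \<in> sets lebesgue"
proof -
  obtain a :: "real ^ 'n" and l where Q: "Q = cbox a (a + (\<chi> i. l))" and l: "0 < l"
    using assms by (auto simp: cubes_def)
  interpret dyadic_grid a l 0 by unfold_locales (rule l)
  have "corner 0 (\<lambda>_. 0) = a" by (simp add: vec_eq_iff corner_def lab_def)
  then have "Q = gcube 0 (\<lambda>_. 0)" by (simp add: Q gcube_def)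
  moreover have "Q \<in> sets lebesgue" by (simp add: Q)
  ultimately show ?thesis
    using emeasure_gcube[of 0 "\<lambda>_. 0"] vol_pos[of 0] by (intro that[of "vol 0"]) simp_all
qed

text \<open>An exhaustion of the space by members of \<open>cubes\<close>; \<open>Suc N\<close>
  makes the side positive also for \<open>N = 0\<close>.\<close>

definition big_cube :: "nat \<Rightarrow> (real ^ 'n) set" where
  "big_cube N = cbox (\<chi> j. - real (Suc N)) ((\<chi> j. - real (Suc N)) + (\<chi> j. 2 * real (Suc N)))"

lemma big_cube_in_cubes: "big_cube N \<in> cubes"
proof -
  have "0 < 2 * real (Suc N)" by simp
  then show ?thesis unfolding big_cube_def cubes_def by blast
qed

lemma mem_big_cube: "x \<in> big_cube N \<longleftrightarrow> (\<forall>j. \<bar>x $ j\<bar> \<le> real (Suc N))"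
  unfolding big_cube_def mem_box_cart by (auto simp: abs_le_iff) (smt (verit))+

lemma big_cube_mono: "N \<le> N' \<Longrightarrow> big_cube N \<subseteq> big_cube N'"
  unfolding subset_iff mem_big_cube by (meson Suc_le_mono of_nat_mono order_trans)

lemma ex_big_cube: "\<exists>N. x \<in> big_cube N"
proof -
  obtain N where "norm x \<le> real N" using real_arch_simple by blast
  then have "\<bar>x $ j\<bar> \<le> real (Suc N)" for j
    using component_le_norm_cart[of x j] by simp
  then show ?thesis by (auto simp: mem_big_cube)
qed

lemma AE_big_cubeI:
  assumes "\<And>N. N0 \<le> N \<Longrightarrow> AE x in lebesgue. x \<in> big_cube N \<longrightarrow> P x"
  shows "AE x in lebesgue. P x"
proof -
  have "AE x in lebesgue. \<forall>N. x \<in> big_cube (N + N0) \<longrightarrow> P x"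
    using assms by (subst AE_all_countable) auto
  then show ?thesis
  proof eventually_elim
    case (elim x)
    obtain N where "x \<in> big_cube N" using ex_big_cube by blast
    then have "x \<in> big_cube (N + N0)" using big_cube_mono[of N "N + N0"] by auto
    then show ?case using elim by blast
  qed
qed

section \<open>Finiteness and positivity of weights almost everywhere\<close>

lemma wmeas_finite_AE:
  assumes "w \<in> borel_measurable lebesgue" "E \<in> sets lebesgue" "wmeas w E \<noteq> \<infinity>"
  shows "AE x in lebesgue. x \<in> E \<longrightarrow> w x \<noteq> \<infinity>"
proof -
  have "AE x in lebesgue. w x * indicator E x \<noteq> \<infinity>"
    using assms unfolding wmeas_def by (intro nn_integral_PInf_AE) auto
  then show ?thesis by eventually_elim (auto split: split_indicator)
qed

lemma wmeas_zero_AE: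
  assumes "w \<in> borel_measurable lebesgue" "E \<in> sets lebesgue" "wmeas w E = 0"
  shows "AE x in lebesgue. x \<in> E \<longrightarrow> w x = 0"
proof -
  have "AE x in lebesgue. w x * indicator E x = 0"
    using assms unfolding wmeas_def by (subst (asm) nn_integral_0_iff_AE) auto
  then show ?thesis by eventually_elim (auto split: split_indicator)
qed

lemma wmeas_cube_pos:
  assumes w: "w \<in> borel_measurable lebesgue" and pos: "AE x in lebesgue. 0 < w x" and Q: "Q \<in> cubes"
  shows "0 < wmeas w Q"
proof (rule ccontr)
  obtain v where v: "0 < v" "emeasure lebesgue Q = ennreal v" "Q \<in> sets lebesgue"
    using cube_measure[OF Q] .
  assume "\<not> 0 < wmeas w Q"
  then have "wmeas w Q = 0" by simp
  from wmeas_zero_AE[OF w v(3) this] pos have "AE x in lebesgue. x \<notin> Q"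
    by eventually_elim auto
  then have "Q \<in> null_sets lebesgue" using v(3) by (simp add: AE_iff_null_sets)
  then show False using v by (simp add: null_sets_def)
qed

lemma avg_eq_0_iff: "Q \<in> cubes \<Longrightarrow> avg w Q = 0 \<longleftrightarrow> wmeas w Q = 0"
  by (elim cube_measure) (simp add: avg_def)

lemma avg_eq_top_iff: "Q \<in> cubes \<Longrightarrow> avg w Q = \<infinity> \<longleftrightarrow> wmeas w Q = \<infinity>"
  by (elim cube_measure) (auto simp: avg_def ennreal_divide_eq_top_iff)

lemma Apq_term_finite:
  assumes "w \<in> Apq p q" "Q \<in> cubes"
  shows "(avg (\<lambda>x. w x epowr q) Q) epowr (1 / q) * (avg (\<lambda>x. w x epowr (- conj_exp p)) Q) epowr (1 / conj_exp p)
      \<le> Apq_const p q w" "Apq_const p q w < \<infinity>"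
proof -
  show "(avg (\<lambda>x. w x epowr q) Q) epowr (1 / q) * (avg (\<lambda>x. w x epowr (- conj_exp p)) Q) epowr (1 / conj_exp p)
      \<le> Apq_const p q w"
    unfolding Apq_const_def by (rule SUP_upper[OF assms(2)])
  show "Apq_const p q w < \<infinity>" using assms by (simp add: Apq_def)
qed

text \<open>The zero weight belongs to \<open>Apq\<close>, because
  \<open>0 * \<infinity> = 0\<close>. Otherwise every large cube has a nonzero average of
  \<open>w epowr q\<close>; the finite product then forces the dual average to be finite, so
  \<open>w\<close> vanishes only on a null set.\<close>

lemma Apq_weight_trivial_or_positive:
  fixes w :: "real ^ 'n \<Rightarrow> ennreal"
  assumes w: "w \<in> Apq p q" and q: "0 < q" and p: "0 < conj_exp p"
  shows "(AE x in lebesgue. w x = 0) \<or> (AE x in lebesgue. 0 < w x \<and> w x < \<infinity>)"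
proof (cases "AE x in lebesgue. w x = 0")
  case False
  have wm [measurable]: "w \<in> borel_measurable lebesgue" using w by (simp add: Apq_def weight_def)
  have um: "(\<lambda>x. w x epowr q) \<in> borel_measurable lebesgue" by measurable
  have \<sigma>m: "(\<lambda>x. w x epowr (- conj_exp p)) \<in> borel_measurable lebesgue" by measurable
  have big: "big_cube N \<in> sets lebesgue" for N :: nat
    by (simp add: big_cube_def)
  have fin: "AE x in lebesgue. w x \<noteq> \<infinity>"
  proof (rule AE_big_cubeI[of 0])
    fix N :: nat
    have "compact (big_cube N :: (real ^ 'n) set)" unfolding big_cube_def by (rule compact_cbox)
    then have "wmeas w (big_cube N) \<noteq> \<infinity>" using w by (auto simp: Apq_def weight_def)
    then show "AE x in lebesgue. x \<in> big_cube N \<longrightarrow> w x \<noteq> \<infinity>"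
      by (rule wmeas_finite_AE[OF wm big])
  qed
  have "\<exists>N0. \<not> (AE x in lebesgue. x \<in> big_cube N0 \<longrightarrow> w x = 0)"
    using False AE_big_cubeI[of 0 "\<lambda>x. w x = 0"] by blast
  then obtain N0 where N0: "\<not> (AE x in lebesgue. x \<in> big_cube N0 \<longrightarrow> w x = 0)" ..
  have "AE x in lebesgue. w x \<noteq> 0"
  proof (rule AE_big_cubeI[of N0])
    fix N assume N: "N0 \<le> N"
    let ?Q = "big_cube N :: (real ^ 'n) set"
    have "wmeas (\<lambda>x. w x epowr q) ?Q \<noteq> 0"
    proof
      assume "wmeas (\<lambda>x. w x epowr q) ?Q = 0"
      from wmeas_zero_AE[OF um big this] have "AE x in lebesgue. x \<in> big_cube N0 \<longrightarrow> w x = 0"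
        by eventually_elim (use big_cube_mono[OF N] q in \<open>auto simp: epowr_eq_0_iff\<close>)
      then show False using N0 by simp
    qed
    then have "(avg (\<lambda>x. w x epowr q) ?Q) epowr (1/q) \<noteq> 0"
      using q by (simp add: epowr_eq_0_iff avg_eq_0_iff big_cube_in_cubes)
    moreover have "(avg (\<lambda>x. w x epowr q) ?Q) epowr (1/q) * (avg (\<lambda>x. w x epowr (- conj_exp p)) ?Q) epowr (1 / conj_exp p) < \<infinity>"
      using Apq_term_finite[OF w big_cube_in_cubes] by (rule order_le_less_trans)
    ultimately have "(avg (\<lambda>x. w x epowr (- conj_exp p)) ?Q) epowr (1 / conj_exp p) \<noteq> \<infinity>"
      by (auto simp: ennreal_mult_less_top)
    then have "wmeas (\<lambda>x. w x epowr (- conj_exp p)) ?Q \<noteq> \<infinity>"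
      using p by (subst (asm) epowr_eq_top_iff) (auto simp: avg_eq_top_iff[OF big_cube_in_cubes, unfolded infinity_ennreal_def])
    from wmeas_finite_AE[OF \<sigma>m big this] show "AE x in lebesgue. x \<in> big_cube N \<longrightarrow> w x \<noteq> 0"
      by eventually_elim (use p in \<open>auto simp: epowr_def\<close>)
  qed
  with fin have "AE x in lebesgue. 0 < w x \<and> w x < \<infinity>"
    by eventually_elim (auto simp: less_top zero_less_iff_neq_zero)
  then show ?thesis ..
qed simp

text \<open>On every cube both averages are nonzero and the product of their powers is finite, so
  both averages are finite.\<close>

lemma Apq_weight_regular:
  fixes w :: "real ^ 'n \<Rightarrow> ennreal"
  assumes w: "w \<in> Apq p q" and q: "0 < q" and p: "0 < conj_exp p"
    and pos: "AE x in lebesgue. 0 < w x \<and> w x < \<infinity>"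
  shows "cube_finite (\<lambda>x. w x epowr q)" "cube_finite (\<lambda>x. w x epowr (- conj_exp p))"
    "AE x in lebesgue. 0 < w x epowr q"
proof -
  have wm [measurable]: "w \<in> borel_measurable lebesgue" using w by (simp add: Apq_def weight_def)
  have um: "(\<lambda>x. w x epowr q) \<in> borel_measurable lebesgue" by measurable
  have \<sigma>m: "(\<lambda>x. w x epowr (- conj_exp p)) \<in> borel_measurable lebesgue" by measurable
  show upos: "AE x in lebesgue. 0 < w x epowr q"
    using pos by eventually_elim (use q in \<open>auto simp: zero_less_iff_neq_zero epowr_eq_0_iff\<close>)
  have \<sigma>pos: "AE x in lebesgue. 0 < w x epowr (- conj_exp p)"
    using pos by eventually_elim (use p in \<open>auto simp: epowr_def enn2real_eq_0_iff\<close>)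
  have fin: "wmeas (\<lambda>x. w x epowr q) Q < \<infinity> \<and> wmeas (\<lambda>x. w x epowr (- conj_exp p)) Q < \<infinity>" if Q: "Q \<in> cubes" for Q
  proof -
    let ?a = "avg (\<lambda>x. w x epowr q) Q" and ?b = "avg (\<lambda>x. w x epowr (- conj_exp p)) Q"
    have "?a \<noteq> 0" "?b \<noteq> 0"
      using wmeas_cube_pos[OF um upos Q] wmeas_cube_pos[OF \<sigma>m \<sigma>pos Q] by (auto simp: avg_eq_0_iff[OF Q])
    then have "?a epowr (1/q) \<noteq> 0" "?b epowr (1 / conj_exp p) \<noteq> 0"
      using p q by (simp_all add: epowr_eq_0_iff)
    moreover have "?a epowr (1/q) * ?b epowr (1 / conj_exp p) < \<infinity>"
      using Apq_term_finite[OF w Q] by (rule order_le_less_trans)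
    ultimately have "?a epowr (1/q) \<noteq> \<infinity>" "?b epowr (1 / conj_exp p) \<noteq> \<infinity>"
      by (auto simp: ennreal_mult_less_top)
    then have "?a \<noteq> \<infinity>" "?b \<noteq> \<infinity>"
      using p q epowr_eq_top_iff[of "1/q" ?a] epowr_eq_top_iff[of "1 / conj_exp p" ?b] by auto
    then show ?thesis using avg_eq_top_iff[OF Q] by (simp flip: less_top)
  qed
  show "cube_finite (\<lambda>x. w x epowr q)"
    unfolding cube_finite_def using um wmeas_cube_pos[OF um upos] fin by auto
  show "cube_finite (\<lambda>x. w x epowr (- conj_exp p))"
    unfolding cube_finite_def using \<sigma>m wmeas_cube_pos[OF \<sigma>m \<sigma>pos] fin by auto
qed

lemma avg_cube_finite:
  assumes "cube_finite w" and Q: "Q \<in> cubes"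
  obtains "avg w Q = ennreal (enn2real (wmeas w Q) / enn2real (emeasure lebesgue Q))"
    "0 < enn2real (wmeas w Q)" "0 < enn2real (emeasure lebesgue Q)"
proof -
  obtain v where v: "0 < v" "emeasure lebesgue Q = ennreal v" using cube_measure[OF Q] .
  have fin: "0 < wmeas w Q" "wmeas w Q < \<infinity>" using assms by (auto simp: cube_finite_def)
  then have e: "wmeas w Q = ennreal (enn2real (wmeas w Q))" by simp
  have "avg w Q = ennreal (enn2real (wmeas w Q)) / ennreal v"
    unfolding avg_def v(2) using e by simp
  also have "\<dots> = ennreal (enn2real (wmeas w Q) / v)"
    using v by (intro divide_ennreal) auto
  finally have "avg w Q = ennreal (enn2real (wmeas w Q) / enn2real (emeasure lebesgue Q))"
    using v by simp
  then show ?thesis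
    using that v fin by (simp add: enn2real_positive_iff)
qed

text \<open>For \<open>s = 1 + q / p'\<close> the dual exponent satisfies
  \<open>1 - conj_exp s = - (p' / q)\<close>, so the dual weight of \<open>u\<close> is
  \<open>\<sigma>\<close>. The \<open>1/q\<close>-th power of each term of the Muckenhoupt constant
  is then the corresponding term of \<open>Apq_const\<close>; multiplied by powers of the volume it
  is the joint condition.\<close>

lemma Ar_const_bounds:
  fixes w :: "real ^ 'n \<Rightarrow> ennreal" and p q :: real
  defines "u \<equiv> \<lambda>x. w x epowr q" and "\<sigma> \<equiv> \<lambda>x. w x epowr (- conj_exp p)" and "p' \<equiv> conj_exp p"
  defines "Ar \<equiv> Ar_const (1 + q / p') u"
  assumes w: "w \<in> Apq p q" and q: "0 < q" and p: "0 < p'"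
    and cu: "cube_finite u" and c\<sigma>: "cube_finite \<sigma>"
  obtains A where "0 < A" "Ar epowr (1/q) = ennreal A"
    "\<And>Q. Q \<in> cubes \<Longrightarrow> enn2real (wmeas u Q) powr (1/q) * enn2real (wmeas \<sigma> Q) powr (1/p')
      \<le> A * enn2real (emeasure lebesgue Q) powr (1/q + 1/p')"
proof -
  define U where "U Q = enn2real (wmeas u Q)" for Q
  define S where "S Q = enn2real (wmeas \<sigma> Q)" for Q
  define V where "V Q = enn2real (emeasure lebesgue (Q :: (real ^ 'n) set))" for Q
  define R where "R Q = U Q / V Q * (S Q / V Q) powr (q / p')" for Q
  have pos: "0 < U Q" "0 < S Q" "0 < V Q" and av: "avg u Q = ennreal (U Q / V Q)" "avg \<sigma> Q = ennreal (S Q / V Q)"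
    if "Q \<in> cubes" for Q
    using avg_cube_finite[OF cu that] avg_cube_finite[OF c\<sigma> that] unfolding U_def S_def V_def by blast+
  have "1 - conj_exp (1 + q / p') = - (p' / q)"
    using q p by (simp add: conj_exp_def field_simps)
  then have dual: "u x epowr (1 - conj_exp (1 + q / p')) = \<sigma> x" for x
    using q by (simp add: u_def \<sigma>_def p'_def epowr_epowr)
  have trm: "avg u Q * (avg (\<lambda>x. u x epowr (1 - conj_exp (1 + q / p'))) Q) epowr (1 + q / p' - 1) = ennreal (R Q)"
    if Q: "Q \<in> cubes" for Q
    using pos[OF Q] q p unfolding dual av[OF Q] R_def
    by (simp add: epowr_ennreal flip: ennreal_mult)
  have Ar: "Ar = (SUP Q\<in>cubes. ennreal (R Q))"
    unfolding Ar_def Ar_const_def using trm by (intro SUP_cong) auto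
  have root: "R Q powr (1/q) = (U Q / V Q) powr (1/q) * (S Q / V Q) powr (1/p')" if "Q \<in> cubes" for Q
    unfolding R_def powr_mult powr_powr using q by simp
  have Rpos: "0 < R Q" if "Q \<in> cubes" for Q
    using pos[OF that] by (simp add: R_def)
  obtain k where k: "0 \<le> k" "Apq_const p q w = ennreal k"
    using Apq_term_finite(2)[OF w big_cube_in_cubes] by (cases "Apq_const p q w" rule: ennreal_cases) auto
  have "R Q \<le> k powr q" if Q: "Q \<in> cubes" for Q
  proof -
    have "ennreal ((U Q / V Q) powr (1/q) * (S Q / V Q) powr (1/p')) \<le> ennreal k"
      using Apq_term_finite(1)[OF w Q, folded u_def \<sigma>_def, folded p'_def] pos[OF Q] q p k av[OF Q]
      by (simp add: epowr_ennreal ennreal_mult)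
    then have "R Q powr (1/q) \<le> k" using k root[OF Q] by simp
    then have "(R Q powr (1/q)) powr q \<le> k powr q" using q by (intro powr_mono2) auto
    then show ?thesis using q Rpos[OF Q] by (simp add: powr_powr)
  qed
  then have "Ar \<le> ennreal (k powr q)"
    unfolding Ar by (intro SUP_least ennreal_leI)
  then have "Ar < \<infinity>" by (simp add: order_le_less_trans)
  then obtain r where r: "0 \<le> r" "Ar = ennreal r" by (cases Ar rule: ennreal_cases) auto
  have Rr: "R Q \<le> r" if Q: "Q \<in> cubes" for Q
  proof -
    have "ennreal (R Q) \<le> ennreal r" unfolding r(2)[symmetric] Ar by (rule SUP_upper[OF Q])
    then show ?thesis using r by simp
  qed
  have "0 < r" using Rr[OF big_cube_in_cubes[of 0]] Rpos[OF big_cube_in_cubes[of 0]] by simp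
  show ?thesis
  proof (rule that)
    show "0 < r powr (1/q)" using \<open>0 < r\<close> by simp
    show "Ar epowr (1/q) = ennreal (r powr (1/q))" using r q by (simp add: epowr_ennreal)
    fix Q :: "(real ^ 'n) set" assume Q: "Q \<in> cubes"
    have "U Q powr (1/q) * S Q powr (1/p') = R Q powr (1/q) * V Q powr (1/q + 1/p')"
      using pos[OF Q] unfolding root[OF Q] by (simp add: powr_divide powr_add)
    also have "\<dots> \<le> r powr (1/q) * V Q powr (1/q + 1/p')"
      using Rr[OF Q] Rpos[OF Q] q by (intro mult_right_mono powr_mono2) auto
    finally show "enn2real (wmeas u Q) powr (1/q) * enn2real (wmeas \<sigma> Q) powr (1/p')
      \<le> r powr (1/q) * enn2real (emeasure lebesgue Q) powr (1/q + 1/p')"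
      by (simp add: U_def S_def V_def)
  qed
qed

text \<open>The case of the zero weight. Where \<open>\<sigma>\<close> is infinite,
  \<open>wmult\<close> takes the value \<open>0\<close>, so every potential vanishes.\<close>

lemma riesz_opnorm_zero:
  fixes \<sigma> :: "real ^ 'n \<Rightarrow> ennreal"
  assumes \<sigma>: "AE x in lebesgue. \<sigma> x = \<infinity>" "\<sigma> \<in> borel_measurable lebesgue" and X: "X (\<lambda>x. 0) = 0"
  shows "riesz_opnorm \<alpha> p \<sigma> X = 0"
proof -
  have "(AE x in lebesgue. integrable lebesgue (riesz_kernel \<alpha> (wmult f \<sigma>) x)) \<and>
      X (riesz_potential \<alpha> (wmult f \<sigma>)) \<le> 0 * Lp_norm p \<sigma> f" if f: "f \<in> Lp_space p \<sigma>" for f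
  proof -
    have zero: "AE y in lebesgue. riesz_kernel \<alpha> (wmult f \<sigma>) x y = 0" for x
      using \<sigma>(1) by eventually_elim (simp add: riesz_kernel_def wmult_def)
    have m: "riesz_kernel \<alpha> (wmult f \<sigma>) x \<in> borel_measurable lebesgue" for x
      using f \<sigma>(2) by (intro riesz_kernel_measurable) (auto simp: Lp_space_def)
    have "integrable lebesgue (riesz_kernel \<alpha> (wmult f \<sigma>) x)" for x
      using integrable_cong_AE[OF m borel_measurable_const zero] by simp
    moreover have "riesz_potential \<alpha> (wmult f \<sigma>) = (\<lambda>x. 0)"
      unfolding riesz_potential_def using integral_eq_zero_AE[OF zero] by auto
    ultimately show ?thesis using X by simp
  qed
  then have "riesz_opnorm \<alpha> p \<sigma> X \<le> 0"
    unfolding riesz_opnorm_def by (intro Inf_lower) auto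
  then show ?thesis by simp
qed

theorem theorem1p2:
  fixes \<alpha> p q :: real
  assumes "0 < \<alpha>" and "\<alpha> < real CARD('n::finite)"
    and "1 < p" and "p < real CARD('n) / \<alpha>"
    and "1 / p - 1 / q = \<alpha> / real CARD('n)"
  shows "\<exists>C::real. 0 < C \<and>
    (\<forall>w \<in> (Apq p q :: (real ^ 'n \<Rightarrow> ennreal) set).
      let u = (\<lambda>x. w x epowr q);
          \<sigma> = (\<lambda>x. w x epowr (- conj_exp p));
          s = 1 + q / conj_exp p
      in riesz_opnorm \<alpha> p \<sigma> (weak_Lp_norm q u)
           \<le> ennreal C * Ar_const s u epowr (1 / q) * Ainf_const u epowr (1 / conj_exp p)
       \<and> riesz_opnorm \<alpha> p \<sigma> (Lp_norm q u)
           \<le> ennreal C * Ar_const s u epowr (1 / q)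
               * (Ainf_const u epowr (1 / conj_exp p) + Ainf_const \<sigma> epowr (1 / q)))"
proof -
  define n where "n = real CARD('n)"
  define p' where "p' = conj_exp p"
  define c1 where "c1 = testing_const (1 / 2 ^ CARD('n)) (\<alpha> / n) p' powr (1/p')"
  define c2 where "c2 = testing_const (1 / 2 ^ CARD('n)) (\<alpha> / n) q powr (1/q)"
  define k where "k = 6 powr (n - \<alpha>) * 2 ^ CARD('n)"
  \<comment> \<open>\<open>Cw\<close> and \<open>Cs\<close> are \<open>C_weak\<close> and
    \<open>C_strong\<close> of \<open>weight_pair\<close> written out, so that they are fixed before
    any weight is chosen.\<close>
  define Cw where "Cw = (2 * 2 ^ CARD('n)) powr (1/q) * 2 powr (q + 2) * k * c1"
  define Cs where "Cs = (2 ^ CARD('n)) powr (1/q) * k * (4 * p' * q) * (c1 + c2)"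
  have n0: "0 < n" by (simp add: n_def)
  have q: "p < q" using Sobolev_exponent_gt[OF n0 assms(1,3)] assms(4,5) by (simp add: n_def)
  have q1: "1 < q" "0 < q" using q assms by auto
  have p': "1 < p'" using assms by (simp add: p'_def conj_exp_def)
  have "(2::real) ^ 1 \<le> 2 ^ CARD('n)" by (rule power_increasing) (auto simp: Suc_le_eq)
  then have "1 / (2::real) ^ CARD('n) < 1" by simp
  then have "0 < testing_const (1 / 2 ^ CARD('n)) (\<alpha> / n) r" if "1 < r" for r
    using assms that n0 by (intro testing_const_pos) (auto simp: n_def)
  from this[OF p'] this[OF q1(1)] have c: "0 < c1" "0 < c2" "0 < k"
    using p' q1 by (auto simp: c1_def c2_def k_def)
  then have C: "0 < Cw" "0 < Cs"
    using p' q1 by (auto simp: Cw_def Cs_def intro!: mult_pos_pos add_pos_pos)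
  show ?thesis
  proof (intro exI[of _ "Cw + Cs"] conjI ballI)
    show "0 < Cw + Cs" using C by simp
    fix w :: "real ^ 'n \<Rightarrow> ennreal" assume w: "w \<in> Apq p q"
    define u where "u = (\<lambda>x. w x epowr q)"
    define \<sigma> where "\<sigma> = (\<lambda>x. w x epowr (- p'))"
    have [measurable]: "w \<in> borel_measurable lebesgue" using w by (simp add: Apq_def weight_def)
    have \<sigma>m: "\<sigma> \<in> borel_measurable lebesgue" unfolding \<sigma>_def by measurable
    define Ar where "Ar = Ar_const (1 + q / p') u"
    have "riesz_opnorm \<alpha> p \<sigma> (weak_Lp_norm q u) \<le> ennreal (Cw + Cs) * Ar epowr (1/q) * Ainf_const u epowr (1/p')
      \<and> riesz_opnorm \<alpha> p \<sigma> (Lp_norm q u)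
        \<le> ennreal (Cw + Cs) * Ar epowr (1/q) * (Ainf_const u epowr (1/p') + Ainf_const \<sigma> epowr (1/q))"
    proof (cases "AE x in lebesgue. w x = 0")
      case True
      have s: "AE x in lebesgue. \<sigma> x = \<infinity>"
        using True by eventually_elim (use p' in \<open>simp add: \<sigma>_def epowr_def\<close>)
      have z: "(0::ennreal) epowr q = 0" "(0::ennreal) epowr (1/q) = 0" using q1 by (simp_all add: epowr_def)
      have "weak_Lp_norm q u (\<lambda>x. 0) = 0"
        unfolding weak_Lp_norm_def by (intro antisym SUP_least) (auto simp: wmeas_def z)
      moreover have "Lp_norm q u (\<lambda>x. 0) = 0" by (simp add: Lp_norm_def z)
      ultimately show ?thesis
        using riesz_opnorm_zero[OF s \<sigma>m] by simp
    next
      case False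
      have p'0: "0 < conj_exp p" using p' by (simp add: p'_def)
      have pos: "AE x in lebesgue. 0 < w x \<and> w x < \<infinity>"
        using Apq_weight_trivial_or_positive[OF w q1(2) p'0] False by blast
      note reg = Apq_weight_regular[OF w q1(2) p'0 pos, folded p'_def, folded u_def \<sigma>_def]
      obtain A where A: "0 < A" "Ar epowr (1/q) = ennreal A"
        "\<And>Q. Q \<in> cubes \<Longrightarrow> enn2real (wmeas u Q) powr (1/q) * enn2real (wmeas \<sigma> Q) powr (1/p')
          \<le> A * enn2real (emeasure lebesgue Q) powr (1/q + 1/p')"
        using Ar_const_bounds[OF w q1(2) p'0] reg unfolding Ar_def u_def \<sigma>_def p'_def by blast
      have exps: "1/q + 1/p' = 1 - \<alpha> / real CARD('n)"
        using assms p' by (simp add: p'_def conj_exp_def field_simps)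
      have bounds: "riesz_opnorm \<alpha> p \<sigma> (weak_Lp_norm q u) \<le> ennreal (Cw + Cs) * ennreal A * Ainf_const u epowr (1/p')
        \<and> (Ainf_const \<sigma> \<noteq> \<infinity> \<longrightarrow> riesz_opnorm \<alpha> p \<sigma> (Lp_norm q u)
          \<le> ennreal (Cw + Cs) * ennreal A * (Ainf_const u epowr (1/p') + Ainf_const \<sigma> epowr (1/q)))"
        if fin: "Ainf_const u \<noteq> \<infinity>"
      proof -
        define Ku where "Ku = enn2real (Ainf_const u)"
        have Ku: "0 \<le> Ku" "Ainf_const u = ennreal Ku" using fin by (auto simp: Ku_def less_top)
        interpret W: weight_pair u \<sigma> \<alpha> p q A Ku
          by unfold_locales (use reg assms A Ku exps in \<open>auto simp: p'_def\<close>)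
        have eqs: "W.p' = p'" "W.C_weak = Cw" "W.C_strong = Cs"
          by (simp_all add: W.p'_def W.C_weak_def W.C_strong_def W.kernel_const_def W.\<delta>_def Cw_def Cs_def k_def c1_def c2_def n_def p'_def)
        have "AE x in lebesgue. 0 < u x" using reg(3) by (simp add: u_def)
        note rb = W.riesz_bounds[OF _ this, unfolded eqs]
        have "riesz_opnorm \<alpha> p \<sigma> (weak_Lp_norm q u) \<le> ennreal (Cw * A * Ku powr (1/p'))"
          unfolding riesz_opnorm_def using rb(1,2) by (intro Inf_lower) auto
        also have "\<dots> \<le> ennreal ((Cw + Cs) * A * Ku powr (1/p'))"
          using C A Ku by (intro ennreal_leI mult_right_mono) auto
        also have "\<dots> = ennreal (Cw + Cs) * ennreal A * Ainf_const u epowr (1/p')"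
          using C A Ku p' by (simp add: epowr_ennreal ennreal_mult)
        finally have 1: "riesz_opnorm \<alpha> p \<sigma> (weak_Lp_norm q u) \<le> ennreal (Cw + Cs) * ennreal A * Ainf_const u epowr (1/p')" .
        have 2: "riesz_opnorm \<alpha> p \<sigma> (Lp_norm q u)
          \<le> ennreal (Cw + Cs) * ennreal A * (Ainf_const u epowr (1/p') + Ainf_const \<sigma> epowr (1/q))"
          if fin\<sigma>: "Ainf_const \<sigma> \<noteq> \<infinity>"
        proof -
          define K where "K = enn2real (Ainf_const \<sigma>)"
          have K: "0 \<le> K" "Ainf_const \<sigma> = ennreal K" using fin\<sigma> by (auto simp: K_def less_top)
          have "riesz_opnorm \<alpha> p \<sigma> (Lp_norm q u) \<le> ennreal (Cs * A * (Ku powr (1/p') + K powr (1/q)))"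
            unfolding riesz_opnorm_def using rb(1) rb(3)[of _ K] K by (intro Inf_lower) auto
          also have "\<dots> \<le> ennreal ((Cw + Cs) * A * (Ku powr (1/p') + K powr (1/q)))"
            using C A Ku by (intro ennreal_leI mult_right_mono) auto
          also have "\<dots> = ennreal (Cw + Cs) * ennreal A * (Ainf_const u epowr (1/p') + Ainf_const \<sigma> epowr (1/q))"
            using C A Ku K p' q1 by (simp add: epowr_ennreal ennreal_mult)
          finally show ?thesis .
        qed
        show ?thesis using 1 2 by blast
      qed
      \<comment> \<open>With a nonzero factor, an infinite A-infinity constant makes the right side
        infinite: both bounds are then trivial for \<open>u\<close>, and the strong one for
        \<open>\<sigma>\<close>.\<close>
      have CA: "ennreal (Cw + Cs) * ennreal A \<noteq> 0" using C A by (simp add: ennreal_eq_0_iff)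
      have inf_u: "Ainf_const u epowr (1/p') = \<infinity>" if "Ainf_const u = \<infinity>"
        using that p' epowr_eq_top_iff[of "1/p'" "Ainf_const u"] by simp
      have inf_\<sigma>: "Ainf_const \<sigma> epowr (1/q) = \<infinity>" if "Ainf_const \<sigma> = \<infinity>"
        using that q1 epowr_eq_top_iff[of "1/q" "Ainf_const \<sigma>"] by simp
      show ?thesis
      proof (cases "Ainf_const u = \<infinity>")
        case True
        show ?thesis
          unfolding A(2) inf_u[OF True] using CA by (simp add: ennreal_mult_top)
      next
        case False
        show ?thesis
        proof (cases "Ainf_const \<sigma> = \<infinity>")
          case True
          show ?thesis
            unfolding A(2) inf_\<sigma>[OF True] using CA bounds[OF \<open>Ainf_const u \<noteq> \<infinity>\<close>]
            by (simp add: ennreal_mult_top)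
        next
          case False
          then show ?thesis using bounds[OF \<open>Ainf_const u \<noteq> \<infinity>\<close>] unfolding A(2) by simp
        qed
      qed
    qed
    then show "let u = (\<lambda>x. w x epowr q); \<sigma> = (\<lambda>x. w x epowr (- conj_exp p)); s = 1 + q / conj_exp p
      in riesz_opnorm \<alpha> p \<sigma> (weak_Lp_norm q u)
           \<le> ennreal (Cw + Cs) * Ar_const s u epowr (1 / q) * Ainf_const u epowr (1 / conj_exp p)
       \<and> riesz_opnorm \<alpha> p \<sigma> (Lp_norm q u)
           \<le> ennreal (Cw + Cs) * Ar_const s u epowr (1 / q)
               * (Ainf_const u epowr (1 / conj_exp p) + Ainf_const \<sigma> epowr (1 / q))"
      unfolding Let_def Ar_def u_def \<sigma>_def p'_def .
  qed
qed

end
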